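(* Let $\beta\in(0,1)$, $k\in\mathbb{N}$, $p,q\in[0,1]$ with $p+q=1$, and $t>0$. For $\gamma>0$ let $Q_j^{\gamma,\beta(2k+1)}$, $j\ge 0$, be i.i.d. random variables with $\Pr\{Q_j^{\gamma,\beta(2k+1)}>w\}=(\gamma/w)^{\beta(2k+1)}$ for $w>\gamma$ and $=1$ for $w<\gamma$; let $\epsilon_j$, $j\ge 0$, be i.i.d. with $\Pr\{\epsilon_j=1\}=p$, $\Pr\{\epsilon_j=-1\}=q$; let $N$ be a homogeneous Poisson process with rate $\lambda=1/\Gamma(1-\beta)$; let $U_j^{2k+1}(1)$, $j\ge0$, be independent pseudo random variables, each with the signed law $u_{2k+1}(x,1)$, where $u_{2k+1}(x,t)$ is the fundamental solution of $$\frac{\partial}{\partial t}u_{2k+1}(x,t)=(-1)^k\frac{\partial^{2k+1}}{\partial x^{2k+1}}u_{2k+1}(x,t),\quad x\in\mathbb{R},\ t>0,\qquad u_{2k+1}(x,0)=\delta(x),$$ so that $\int_{\mathbb{R}}e^{i\xi x}u_{2k+1}(x,1)\,dx=e^{-i\xi^{2k+1}}$. All the random variables $N(t)$, $\epsilon_j$, $Q_j^{\gamma,\beta(2k+1)}$ are independent and also independent from the pseudo random variables $U_j^{2k+1}(1)$. Then the following limit in distribution holds: $$\lim_{\gamma\to 0}\ \sum_{j=0}^{N(t\gamma^{-\beta(2k+1)})}\epsilon_j\,U_j^{2k+1}(1)\,Q_j^{\gamma,\beta(2k+1)}\ \stackrel{\text{law}}{=}\ U_1^{2k+1}\big(H_1^\beta(pt)\big)-U_2^{2k+1}\big(H_2^\beta(qt)\big),$$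 where $H_1^\beta,H_2^\beta$ are independent positively skewed stable processes (stable subordinators) of order $\beta$, and $U_1^{2k+1},U_2^{2k+1}$ are independent pseudoprocesses of order $2k+1$ (with law $u_{2k+1}(x,s)$ at time $s$), independent of $H_1^\beta,H_2^\beta$. The Fourier transform of the law of the limiting pseudoprocess is, for $\xi\in\mathbb{R}$, $$\mathbb{E}\,e^{i\xi\left[U_1^{2k+1}(H_1^\beta(pt))-U_2^{2k+1}(H_2^\beta(qt))\right]}=\exp\Big\{-t|\xi|^{\beta(2k+1)}\Big(\cos\tfrac{\beta\pi}{2}-i\,\mathrm{sign}(\xi)\,(p-q)\sin\tfrac{\beta\pi}{2}\Big)\Big\}.$$
   Context: Pseudo random variables and pseudoprocesses are endowed with signed laws of total mass one, and expectations $\mathbb{E}e^{i\xi\,\cdot}$ are understood with respect to these signed laws, i.e. as Fourier transforms. Two pseudo random variables (or pseudoprocesses) are independent if the Fourier transform of the convolution of their signed densities is the product of their Fourier transforms. Fourier transforms of products and random sums involving genuine random variables ($N$, $\epsilon_j$, $Q_j$) are computed by conditioning on the genuine random variables. The stable subordinator $H^\beta(t)$ has probability density $h_\beta(s,t)$, $s\ge0$, with $\int_0^\infty e^{-\mu s}h_\beta(s,t)\,ds=e^{-t\mu^\beta}$. The composition $U^{2k+1}(H^\beta(t))$, with $H^\beta$ independent of $U^{2k+1}$, has signed law $\int_0^\infty u_{2k+1}(x,s)h_\beta(s,t)\,ds$. The limit in law means convergence of the Fourier transforms.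
   Formalization: The printed Fourier transform has the wrong sign: with the stated transforms of u and of the subordinator, the term is +i sign(ξ)(p−q) sin(βπ/2), not minus (for p=1, ξ=1 the transform is exp(−t i^β)); the formula is proved with the plus sign. *)

theory Defs
  imports "HOL-Probability.Probability"
begin

section \<open>Signed laws and their Fourier transforms\<close>

text \<open>
  A pseudo random variable is represented by its signed density.  The densities used here are in
  general not absolutely integrable (for order 3 one gets a rescaled Airy function), so the Fourier
  transform is taken with the Henstock-Kurzweil integral, which over the whole line is the improper
  integral, the two endpoints tending to infinity independently.
\<close>

definition fourier :: "(real \<Rightarrow> real) \<Rightarrow> real \<Rightarrow> complex" where
  "fourier f \<xi> = integral UNIV (\<lambda>x. cis (\<xi> * x) * complex_of_real (f x))"

definition test_function :: "(real \<Rightarrow> real) \<Rightarrow> bool" where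
  "test_function \<phi> \<longleftrightarrow>
     (\<forall>m x. ((deriv ^^ m) \<phi>) differentiable (at x)) \<and> (\<exists>R. \<forall>x. R < \<bar>x\<bar> \<longrightarrow> \<phi> x = 0)"

text \<open>
  \<open>u x t\<close> is the fundamental solution of
  \<open>\<partial>u/\<partial>t = (-1)\<^sup>k \<partial>\<^sup>2\<^sup>k\<^sup>+\<^sup>1u/\<partial>x\<^sup>2\<^sup>k\<^sup>+\<^sup>1\<close>, \<open>u x 0 = \<delta> x\<close>.
  The equation and the initial condition alone do not determine a solution on the whole line: the
  fundamental solution is the one that is bounded in \<open>x\<close> at each positive time and whose Fourier
  transform is \<open>exp (-i t \<xi>\<^sup>2\<^sup>k\<^sup>+\<^sup>1)\<close>, in particular with total mass one.  For \<open>k = 0\<close> it is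
  \<open>\<delta> (x + t)\<close>, which is not a function, and nothing satisfies the predicate.
\<close>

definition fundamental_solution :: "nat \<Rightarrow> (real \<Rightarrow> real \<Rightarrow> real) \<Rightarrow> bool" where
  "fundamental_solution k u \<longleftrightarrow>
     (\<forall>t>0. \<forall>x. \<forall>m\<le>2 * k. ((deriv ^^ m) (\<lambda>y. u y t)) differentiable (at x)) \<and>
     (\<forall>t>0. \<forall>x. ((\<lambda>s. u x s) has_real_derivative
                    (- 1) ^ k * (deriv ^^ (2 * k + 1)) (\<lambda>y. u y t) x) (at t)) \<and>
     (\<forall>\<phi>. test_function \<phi> \<longrightarrow>
           ((\<lambda>t. integral UNIV (\<lambda>x. u x t * \<phi> x)) \<longlongrightarrow> \<phi> 0) (at_right 0)) \<and>
     (\<forall>t>0. bounded (range (\<lambda>x. u x t))) \<and>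
     (\<forall>t>0. \<forall>\<xi>. ((\<lambda>x. cis (\<xi> * x) * complex_of_real (u x t)) has_integral
                    exp (- (\<i> * complex_of_real (t * \<xi> ^ (2 * k + 1))))) UNIV)"

text \<open>
  Fourier transform of \<open>\<Sum>j=0..n. a j * U j\<close>, where the pseudo random variables \<open>U j\<close> have signed
  density \<open>f\<close> and are independent of each other and of the genuine random variables \<open>n\<close> and \<open>a j\<close>.
  Conditionally on the latter, \<open>a j * U j\<close> has Fourier transform \<open>\<lambda>\<xi>. fourier f (\<xi> * a j)\<close>, and
  independence of the \<open>U j\<close> means that these factors multiply.
\<close>

definition random_sum_fourier ::
  "'a measure \<Rightarrow> (real \<Rightarrow> real) \<Rightarrow> ('a \<Rightarrow> nat) \<Rightarrow> (nat \<Rightarrow> 'a \<Rightarrow> real) \<Rightarrow> real \<Rightarrow> complex" where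
  "random_sum_fourier M f n a \<xi> = (\<integral>\<omega>. (\<Prod>j\<le>n \<omega>. fourier f (\<xi> * a j \<omega>)) \<partial>M)"

text \<open>
  Signed law of \<open>U (H t)\<close>: \<open>u\<close> is the kernel of the pseudoprocess \<open>U\<close>, and \<open>h s t\<close> the density at
  \<open>s\<close> of the independent subordinator \<open>H t\<close>.  There is no density at \<open>t = 0\<close>, where
  \<open>U (H 0) = U 0 = 0\<close> has law \<open>\<delta>\<close>.
\<close>

definition subordinated_law ::
  "(real \<Rightarrow> real \<Rightarrow> real) \<Rightarrow> (real \<Rightarrow> real \<Rightarrow> real) \<Rightarrow> real \<Rightarrow> real \<Rightarrow> real" where
  "subordinated_law u h t x = (LBINT s:{0..}. u x s * h s t)"

definition subordinated_fourier ::
  "(real \<Rightarrow> real \<Rightarrow> real) \<Rightarrow> (real \<Rightarrow> real \<Rightarrow> real) \<Rightarrow> real \<Rightarrow> real \<Rightarrow> complex" where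
  "subordinated_fourier u h t \<xi> = (if t = 0 then 1 else fourier (subordinated_law u h t) \<xi>)"

text \<open>
  If \<open>X\<close> and \<open>Y\<close> are independent with Fourier transforms \<open>F\<close> and \<open>G\<close>, the Fourier transform of
  \<open>X - Y\<close> is the product of those of \<open>X\<close> and \<open>- Y\<close>.
\<close>

definition difference_fourier :: "(real \<Rightarrow> complex) \<Rightarrow> (real \<Rightarrow> complex) \<Rightarrow> real \<Rightarrow> complex" where
  "difference_fourier F G \<xi> = F \<xi> * G (- \<xi>)"


section \<open>Genuine processes\<close>

definition indep_increments :: "'a measure \<Rightarrow> (real \<Rightarrow> 'a \<Rightarrow> real) \<Rightarrow> bool" where
  "indep_increments M X \<longleftrightarrow>
     (\<forall>\<tau> :: nat \<Rightarrow> real. 0 \<le> \<tau> 0 \<and> mono \<tau> \<longrightarrow>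
        prob_space.indep_vars M (\<lambda>_. borel) (\<lambda>i \<omega>. X (\<tau> (Suc i)) \<omega> - X (\<tau> i) \<omega>) UNIV)"

definition homogeneous_poisson_process :: "'a measure \<Rightarrow> real \<Rightarrow> (real \<Rightarrow> 'a \<Rightarrow> nat) \<Rightarrow> bool" where
  "homogeneous_poisson_process M rate N \<longleftrightarrow>
     (\<forall>s\<ge>0. N s \<in> measurable M (count_space UNIV)) \<and>
     (AE \<omega> in M. N 0 \<omega> = 0 \<and> mono_on {0..} (\<lambda>s. N s \<omega>) \<and>
                 (\<forall>s\<ge>0. continuous (at_right s) (\<lambda>r. N r \<omega>))) \<and>
     indep_increments M (\<lambda>s \<omega>. real (N s \<omega>)) \<and>
     (\<forall>a b n. 0 \<le> a \<and> a < b \<longrightarrow>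
        measure M {\<omega> \<in> space M. N b \<omega> = N a \<omega> + n} = pmf (poisson_pmf (rate * (b - a))) n)"

definition stable_subordinator :: "'a measure \<Rightarrow> real \<Rightarrow> (real \<Rightarrow> 'a \<Rightarrow> real) \<Rightarrow> bool" where
  "stable_subordinator M \<beta> H \<longleftrightarrow>
     (\<forall>s\<ge>0. H s \<in> borel_measurable M) \<and>
     (AE \<omega> in M. H 0 \<omega> = 0 \<and> mono_on {0..} (\<lambda>s. H s \<omega>) \<and>
                 (\<forall>s\<ge>0. continuous (at_right s) (\<lambda>r. H r \<omega>))) \<and>
     indep_increments M H \<and>
     (\<forall>a b \<mu>. 0 \<le> a \<and> a < b \<and> 0 \<le> \<mu> \<longrightarrow>
        (\<integral>\<omega>. exp (- \<mu> * (H b \<omega> - H a \<omega>)) \<partial>M) = exp (- (b - a) * \<mu> powr \<beta>))"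

definition indep_processes ::
  "'a measure \<Rightarrow> (real \<Rightarrow> 'a \<Rightarrow> real) \<Rightarrow> (real \<Rightarrow> 'a \<Rightarrow> real) \<Rightarrow> bool" where
  "indep_processes M X Y \<longleftrightarrow>
     prob_space.indep_var M
       (\<Pi>\<^sub>M s\<in>{0..}. borel) (\<lambda>\<omega>. \<lambda>s\<in>{0..}. X s \<omega>)
       (\<Pi>\<^sub>M s\<in>{0..}. borel) (\<lambda>\<omega>. \<lambda>s\<in>{0..}. Y s \<omega>)"

text \<open>Index set for the joint independence of the number of terms, the signs and the sizes.\<close>

datatype source = Count | Sign nat | Size nat

definition indep_count_sign_size ::
  "'a measure \<Rightarrow> ('a \<Rightarrow> nat) \<Rightarrow> (nat \<Rightarrow> 'a \<Rightarrow> real) \<Rightarrow> (nat \<Rightarrow> 'a \<Rightarrow> real) \<Rightarrow> bool" where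
  "indep_count_sign_size M n \<epsilon> Q \<longleftrightarrow>
     prob_space.indep_vars M (\<lambda>_. borel)
       (\<lambda>i. case i of Count \<Rightarrow> (\<lambda>\<omega>. real (n \<omega>)) | Sign j \<Rightarrow> \<epsilon> j | Size j \<Rightarrow> Q j) UNIV"

end

theory Submission
  imports Defs "HOL-Complex_Analysis.Complex_Analysis"
begin

text \<open>
  Put \<open>n = 2 k + 1\<close>.  Given the number of terms and the signs, a term of the sum has Fourier transform
  \<open>exp (- i (\<plusminus> \<xi>\<^sup>n) Q\<^sup>n)\<close>, and \<open>Q\<^sup>n\<close> has a Pareto law with index \<open>\<beta>\<close>.  Hence the sum is
  compound Poisson, and in the limit its exponent is the integral of \<open>1 - exp (- i y x)\<close> against the
  Levy measure \<open>\<beta> x\<^sup>-\<^sup>\<beta>\<^sup>-\<^sup>1 dx\<close>, that is \<open>\<Gamma>(1 - \<beta>) (i y)\<^sup>\<beta>\<close>, at \<open>y = \<plusminus> \<xi>\<^sup>n\<close>.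

  The delicate part is the Fourier transform of \<open>w x = \<integral> u x s h(s) ds\<close>, because \<open>u\<close> and \<open>w\<close> have only
  conditionally convergent Fourier integrals and the integrals cannot be interchanged directly.
  Riemann's method for trigonometric series shows that the transform of the bounded function
  \<open>u(\<cdot>, s)\<close> determines its Gaussian means, as if Parseval's formula applied.  These means inherit the
  scaling of \<open>exp (- i s \<xi>\<^sup>n)\<close>, so they are bounded by a multiple of \<open>s\<^sup>-\<^sup>1\<^sup>/\<^sup>n\<close> uniformly in the
  variance.  As the subordinator has finite negative moments, \<open>w\<close> is the inverse Fourier integral of
  \<open>\<Psi>(\<omega>) = E exp (- i \<omega>\<^sup>n H) = exp (- r (i \<omega>\<^sup>n)\<^sup>\<beta>)\<close>.  This function is integrable and satisfies
  Dini's condition at every point, so the improper integral of \<open>exp (i \<xi> x) w x\<close> converges to \<open>\<Psi>(\<xi>)\<close>.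
  The case \<open>k = 0\<close>, where the hypotheses are contradictory, needs no separate treatment.
\<close>

section \<open>Trigonometric integrals of bounded functions\<close>

text \<open>The transform of u(., s) is only a conditionally convergent integral, so two
  regularisations are stacked. A Gaussian weight in frequency produces means of u, but exchanging it
  with the x-integral takes absolute convergence, which the factor (sin hx / hx)^2 supplies. Letting
  h tend to 0 under the Gaussian then takes a bound on the regularised transforms uniform in h;
  pointwise summability does not give one, whereas second differences carry the bound on the limit F
  over to every h. The Gaussian variance is removed only after integrating in s. Boundedness of u at
  each single time does not suffice there; scaling makes it uniform up to a factor singular at s =
  0. On the probabilistic side nothing is approximated before the last limit: a Pareto law is
  exactly a normalised restriction of the Levy measure, so the transform of the sum is explicit for
  each \<gamma>. The sum has N + 1 terms, which leaves one surplus factor tending to 1, and the rate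
  1/\<Gamma>(1 - \<beta>) cancels the constant of the Levy exponent.\<close>

lemma integral_dominated_convergence_at_within:
  fixes s :: "'c::first_countable_topology \<Rightarrow> 'a \<Rightarrow> 'b::{banach, second_countable_topology}"
  assumes "f \<in> borel_measurable M"
    and "\<And>t. t \<in> S \<Longrightarrow> t \<noteq> a \<Longrightarrow> s t \<in> borel_measurable M"
    and "integrable M w"
    and "\<And>t. t \<in> S \<Longrightarrow> t \<noteq> a \<Longrightarrow> AE x in M. norm (s t x) \<le> w x"
    and "AE x in M. ((\<lambda>t. s t x) \<longlongrightarrow> f x) (at a within S)"
  shows "((\<lambda>t. integral\<^sup>L M (s t)) \<longlongrightarrow> integral\<^sup>L M f) (at a within S)"
  unfolding tendsto_at_iff_sequentially comp_def
proof (intro allI impI)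
  fix X assume X: "\<forall>i. X i \<in> S - {a}" "X \<longlonglongrightarrow> a"
  show "(\<lambda>i. integral\<^sup>L M (s (X i))) \<longlonglongrightarrow> integral\<^sup>L M f"
  proof (rule integral_dominated_convergence)
    show "AE x in M. (\<lambda>i. s (X i) x) \<longlonglongrightarrow> f x"
      using assms(5) by eventually_elim (use X in \<open>auto simp: tendsto_at_iff_sequentially comp_def\<close>)
  qed (use assms(1-4) X in auto)
qed

text \<open>Schwarz's argument. If the bound fails, subtract from \<Phi> a parabola of curvature m'
  > m and a chord. The remainder is smaller at the centre than at both ends, so it has an interior
  minimum, where its second differences are nonnegative. There l is at least m', against l \<le>
  m.\<close>

lemma second_difference_le:
  fixes \<Phi> :: "real \<Rightarrow> real"
  assumes cont: "continuous_on UNIV \<Phi>"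
    and lim: "\<And>x. ((\<lambda>e. (\<Phi> (x + e) + \<Phi> (x - e) - 2 * \<Phi> x) / e\<^sup>2) \<longlongrightarrow> l x) (at_right 0)"
    and le: "\<And>x. l x \<le> m"
    and "0 < d"
  shows "\<Phi> (x + d) + \<Phi> (x - d) - 2 * \<Phi> x \<le> m * d\<^sup>2"
proof (rule ccontr)
  assume "\<not> ?thesis"
  then have "m < (\<Phi> (x + d) + \<Phi> (x - d) - 2 * \<Phi> x) / d\<^sup>2"
    using \<open>0 < d\<close> by (simp add: field_simps)
  \<comment> \<open>The gap between m and m' keeps a contradiction after the limit has weakened
    strict inequalities.\<close>
  then obtain m' where m': "m < m'" "m' < (\<Phi> (x + d) + \<Phi> (x - d) - 2 * \<Phi> x) / d\<^sup>2"
    using dense by blast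
  then have gt: "m' * d\<^sup>2 < \<Phi> (x + d) + \<Phi> (x - d) - 2 * \<Phi> x"
    using \<open>0 < d\<close> by (simp add: field_simps)
  \<comment> \<open>The slope of the chord makes \<open>S d = S (-d)\<close>; a value below both
    ends then forces the minimum into the interior.\<close>
  define c where "c = (\<Phi> (x + d) - \<Phi> (x - d)) / (2 * d)"
  define S where "S y = \<Phi> (x + y) - m' * y\<^sup>2 / 2 - c * y" for y
  have "continuous_on {-d..d} S"
    unfolding S_def by (intro continuous_intros continuous_on_compose2[OF cont]) auto
  then obtain y where y: "y \<in> {-d..d}" "\<And>z. z \<in> {-d..d} \<Longrightarrow> S y \<le> S z"
    using continuous_attains_inf[of "{-d..d}" S] \<open>0 < d\<close> by auto
  have cd: "c * d = (\<Phi> (x + d) - \<Phi> (x - d)) / 2"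
    using \<open>0 < d\<close> by (simp add: c_def)
  have "S d = S (-d)" "S 0 < S d"
    using gt cd by (simp_all add: S_def)
  then have "y \<noteq> d" "y \<noteq> - d" using y(2)[of 0] \<open>0 < d\<close> by auto
  then have ym: "-d < y" "y < d" using y(1) by auto
  have "eventually (\<lambda>e. m' \<le> (\<Phi> (x + y + e) + \<Phi> (x + y - e) - 2 * \<Phi> (x + y)) / e\<^sup>2) (at_right 0)"
    unfolding eventually_at_right_field
  proof (intro exI[of _ "min (d - y) (y + d)"] conjI allI impI)
    fix e assume e: "0 < e" "e < min (d - y) (y + d)"
    then have "S y \<le> S (y + e)" "S y \<le> S (y - e)" by (auto intro!: y(2))
    then have "m' * e\<^sup>2 \<le> \<Phi> (x + y + e) + \<Phi> (x + y - e) - 2 * \<Phi> (x + y)"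
      by (simp add: S_def power2_eq_square field_simps)
    then show "m' \<le> (\<Phi> (x + y + e) + \<Phi> (x + y - e) - 2 * \<Phi> (x + y)) / e\<^sup>2"
      using e by (simp add: field_simps)
  qed (use ym in auto)
  then have "m' \<le> l (x + y)"
    by (intro tendsto_lowerbound[OF lim]) auto
  with le[of "x + y"] m' show False by simp
qed

section \<open>Summation of improper integrals by the squared sinc factor\<close>

text \<open>Riemann's convergence factor: it is what second differences of exp (i v x) in v produce,
  up to the factor (d x)^2.\<close>

definition sinc_sq :: "real \<Rightarrow> real" where
  "sinc_sq y = (sinc y)\<^sup>2"

lemma isCont_sinc_sq: "isCont sinc_sq y"
  unfolding sinc_sq_def[abs_def] by (intro continuous_intros isCont_sinc)

lemma continuous_on_sinc_sq [continuous_intros]: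
  "continuous_on S f \<Longrightarrow> continuous_on S (\<lambda>x. sinc_sq (f x))"
  using continuous_on_compose[of S f sinc_sq, OF _ continuous_at_imp_continuous_on]
  by (auto simp: isCont_sinc_sq)

lemma borel_measurable_sinc_sq [measurable]: "sinc_sq \<in> borel_measurable borel"
  by (intro borel_measurable_continuous_onI continuous_intros)

lemma sinc_sq_0 [simp]: "sinc_sq 0 = 1"
  by (simp add: sinc_sq_def)

lemma sinc_sq_minus [simp]: "sinc_sq (- y) = sinc_sq y"
  by (simp add: sinc_sq_def)

lemma sinc_sq_nonneg: "0 \<le> sinc_sq y"
  by (simp add: sinc_sq_def)

lemma sinc_sq_le_1: "sinc_sq y \<le> 1"
proof (cases "y = 0")
  case False
  have "\<bar>sin y / y\<bar> \<le> 1" using False abs_sin_x_le_abs_x[of y] by (simp add: divide_le_eq)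
  then show ?thesis using False by (simp only: sinc_sq_def if_False abs_square_le_1)
qed simp

definition sinc_sq' :: "real \<Rightarrow> real" where
  "sinc_sq' y = 2 * (sin y / y) * ((y * cos y - sin y) / y\<^sup>2)"

lemma has_real_derivative_sinc_sq:
  assumes "y \<noteq> 0"
  shows "(sinc_sq has_real_derivative sinc_sq' y) (at y)"
proof -
  have "((\<lambda>y. (sin y / y)\<^sup>2) has_real_derivative sinc_sq' y) (at y)"
    using assms by (auto intro!: derivative_eq_intros simp: sinc_sq'_def power2_eq_square field_simps)
  then show ?thesis
    by (rule has_field_derivative_transform_within_open[where S="-{0}"]) (use assms in \<open>auto simp: sinc_sq_def\<close>)
qed

text \<open>Integrability of the derivative is what integration by parts in
  \<open>sinc_sq_summation\<close> rests on. Near 0 the denominator is harmless because y cos y -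
  sin y is of order y^2 or smaller; away from 0 the quotient decays like 1 / y^2.\<close>

lemma sinc_sq'_bound: "\<bar>sinc_sq' y\<bar> \<le> 8 * inverse (1 + y\<^sup>2)"
proof (cases "y = 0")
  case False
  have A: "\<bar>sinc_sq' y\<bar> = 2 * (\<bar>sin y\<bar> / \<bar>y\<bar>) * (\<bar>y * cos y - sin y\<bar> / y\<^sup>2)"
    by (simp add: sinc_sq'_def abs_mult abs_divide)
  show ?thesis
  proof (cases "\<bar>y\<bar> \<le> 1")
    case True
    have "\<bar>cos y - 1\<bar> \<le> \<bar>y\<bar>"
    proof -
      have "\<bar>cos y - 1\<bar> = 2 * (sin (y/2))\<^sup>2" using cos_double_sin[of "y/2"] by simp
      also have "\<dots> \<le> 2 * \<bar>y/2\<bar>\<^sup>2"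
        using abs_sin_x_le_abs_x[of "y/2"] by (metis mult_left_mono power2_abs power_mono abs_ge_zero zero_le_numeral)
      also have "\<dots> \<le> \<bar>y\<bar>" using True mult_left_mono[OF True, of "\<bar>y\<bar>"] by (simp add: power2_eq_square)
      finally show ?thesis .
    qed
    moreover have "\<bar>sin y - y\<bar> \<le> y\<^sup>2"
    proof -
      have "\<bar>sin y - (\<Sum>i<2. sin_coeff i * y ^ i)\<bar> \<le> inverse (fact 2) * \<bar>y\<bar> ^ 2" by (rule Maclaurin_sin_bound)
      then have "\<bar>sin y - y\<bar> * 2 \<le> y\<^sup>2" by (simp add: numeral_2_eq_2 sin_coeff_def)
      then show ?thesis by (intro order_trans[OF _ \<open>_ \<le> y\<^sup>2\<close>]) simp
    qed
    ultimately have "\<bar>y * (cos y - 1)\<bar> + \<bar>sin y - y\<bar> \<le> 2 * y\<^sup>2"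
      using mult_left_mono[of "\<bar>cos y - 1\<bar>" "\<bar>y\<bar>" "\<bar>y\<bar>"] by (simp add: abs_mult power2_eq_square)
    then have "\<bar>y * cos y - sin y\<bar> \<le> 2 * y\<^sup>2" by (simp add: algebra_simps)
    then have "\<bar>y * cos y - sin y\<bar> / y\<^sup>2 \<le> 2" using False by (simp add: divide_le_eq)
    moreover have "\<bar>sin y\<bar> / \<bar>y\<bar> \<le> 1" using False abs_sin_x_le_abs_x[of y] by (simp add: divide_le_eq)
    ultimately have "(\<bar>sin y\<bar> / \<bar>y\<bar>) * (\<bar>y * cos y - sin y\<bar> / y\<^sup>2) \<le> 1 * 2"
      by (intro mult_mono) auto
    moreover have "4 \<le> 8 * inverse (1 + y\<^sup>2)" 
      using True power_le_one[of "\<bar>y\<bar>" 2] by (simp add: field_simps add_pos_nonneg)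
    ultimately show ?thesis using A by simp
  next
    case F: False
    have "\<bar>y * cos y\<bar> \<le> \<bar>y\<bar> * 1" unfolding abs_mult by (intro mult_left_mono) auto
    then have "\<bar>y * cos y - sin y\<bar> \<le> 2 * \<bar>y\<bar>" using F abs_sin_le_one[of y] by linarith
    then have "\<bar>sin y\<bar> * \<bar>y * cos y - sin y\<bar> \<le> 1 * (2 * \<bar>y\<bar>)" by (intro mult_mono) auto
    then have "(\<bar>sin y\<bar> / \<bar>y\<bar>) * (\<bar>y * cos y - sin y\<bar> / y\<^sup>2) \<le> (2 * \<bar>y\<bar>) / (\<bar>y\<bar> * y\<^sup>2)"
      unfolding times_divide_times_eq by (intro divide_right_mono) auto
    also have "\<dots> = 2 / y\<^sup>2" using False by simp
    finally have "\<bar>sinc_sq' y\<bar> \<le> 4 / y\<^sup>2" using A by simp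
    also have "\<dots> \<le> 8 * inverse (1 + y\<^sup>2)"
      using F one_le_power[of "\<bar>y\<bar>" 2] by (simp add: field_simps add_pos_nonneg)
    finally show ?thesis .
  qed
qed (simp add: sinc_sq'_def)

lemma integrable_inverse_1_plus_sq: "integrable lborel (\<lambda>x::real. inverse (1 + x\<^sup>2))"
  using integrable_inverse_1_plus_square by (simp add: set_integrable_def)

lemma sinc_sq_bound: "sinc_sq y \<le> 2 * inverse (1 + y\<^sup>2)"
proof (cases "\<bar>y\<bar> \<le> 1")
  case True
  have "1 \<le> 2 * inverse (1 + y\<^sup>2)"
    using True power_le_one[of "\<bar>y\<bar>" 2] by (simp add: field_simps add_pos_nonneg)
  with sinc_sq_le_1[of y] show ?thesis by linarith
next
  case False
  have "(sin y)\<^sup>2 \<le> 1" using abs_sin_le_one[of y] by (simp only: abs_square_le_1)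
  then have "sinc_sq y \<le> 1 / y\<^sup>2" using False by (auto simp: sinc_sq_def power_divide intro!: divide_right_mono)
  also have "\<dots> \<le> 2 * inverse (1 + y\<^sup>2)" using False one_le_power[of "\<bar>y\<bar>" 2] by (simp add: field_simps add_pos_nonneg)
  finally show ?thesis .
qed

lemma continuous_sinc_sq': "0 < y \<Longrightarrow> isCont sinc_sq' y"
  unfolding sinc_sq'_def[abs_def] by (intro continuous_intros) auto

lemma borel_measurable_sinc_sq' [measurable]: "sinc_sq' \<in> borel_measurable borel"
  unfolding sinc_sq'_def[abs_def] by measurable

lemma tendsto_sinc_sq_at_top: "(sinc_sq \<longlongrightarrow> 0) at_top"
proof (rule tendsto_sandwich[of "\<lambda>_. 0"])
  show "\<forall>\<^sub>F y in at_top. sinc_sq y \<le> 2 * inverse (1 + y\<^sup>2)" by (simp add: sinc_sq_bound)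
  show "((\<lambda>y::real. 2 * inverse (1 + y\<^sup>2)) \<longlongrightarrow> 0) at_top" by real_asymp
qed (auto simp: sinc_sq_nonneg)

lemma sinc_sq'_integrable: "set_integrable lborel {0<..} sinc_sq'"
  unfolding set_integrable_def
proof (rule Bochner_Integration.integrable_bound)
  show "integrable lborel (\<lambda>y::real. 8 * inverse (1 + y\<^sup>2))"
    by (intro integrable_mult_right integrable_inverse_1_plus_sq)
qed (use sinc_sq'_bound in \<open>auto intro!: AE_I2 simp: indicator_def add_nonneg_nonneg\<close>)

lemma sinc_sq'_integral: "(LBINT y:{0<..}. sinc_sq' y) = - 1"
proof -
  have lim0: "(sinc_sq \<longlongrightarrow> 1) (at_right 0)"
    using isCont_sinc_sq[of 0] by (simp add: isCont_def filterlim_at_split)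
  have "(LBINT y=0..\<infinity>. sinc_sq' y) = 0 - 1"
    unfolding zero_ereal_def
    by (rule interval_integral_FTC_integrable[where F = sinc_sq])
       (use sinc_sq'_integrable lim0 tendsto_sinc_sq_at_top in
         \<open>auto simp: ereal_tendsto_simps continuous_sinc_sq' 
           simp flip: has_real_derivative_iff_has_vector_derivative intro!: has_real_derivative_sinc_sq\<close>)
  then show ?thesis by (simp add: interval_lebesgue_integral_0_infty)
qed

lemma integrable_sinc_sq_mult:
  fixes \<phi> :: "real \<Rightarrow> 'a::{banach, second_countable_topology}"
  assumes [measurable]: "\<phi> \<in> borel_measurable borel" and bound: "\<And>x. norm (\<phi> x) \<le> B" and "0 < h"
  shows "integrable lborel (\<lambda>x. sinc_sq (h * x) *\<^sub>R \<phi> x)"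
proof (rule Bochner_Integration.integrable_bound)
  have "0 \<le> B" using bound[of 0] norm_ge_zero order_trans by blast
  show "integrable lborel (\<lambda>x::real. 2 * B * inverse (1 + (0 + h * x)\<^sup>2))"
    using \<open>0 < h\<close> by (intro integrable_mult_right lborel_integrable_real_affine[OF integrable_inverse_1_plus_sq]) auto
  show "AE x in lborel. norm (sinc_sq (h * x) *\<^sub>R \<phi> x) \<le> norm (2 * B * inverse (1 + (0 + h * x)\<^sup>2))"
  proof (rule AE_I2)
    fix x
    have "norm (sinc_sq (h * x) *\<^sub>R \<phi> x) \<le> (2 * inverse (1 + (h * x)\<^sup>2)) * B"
      unfolding norm_scaleR using sinc_sq_bound[of "h * x"] bound[of x] sinc_sq_nonneg[of "h * x"]
      by (intro mult_mono) auto
    also have "\<dots> \<le> norm (2 * B * inverse (1 + (0 + h * x)\<^sup>2))"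
      using \<open>0 \<le> B\<close> by (simp add: abs_mult add_nonneg_nonneg)
    finally show "norm (sinc_sq (h * x) *\<^sub>R \<phi> x) \<le> norm (2 * B * inverse (1 + (0 + h * x)\<^sup>2))" .
  qed
qed simp

text \<open>An Abelian theorem: a convergent improper integral is summable to the same value.
  Integration by parts moves the derivative onto the factor and replaces \<phi> by its symmetric
  partial integrals T, which are bounded and converge to I; then dominated convergence
  applies.\<close>

lemma sinc_sq_summation:
  fixes \<phi> :: "real \<Rightarrow> complex"
  assumes cont: "continuous_on UNIV \<phi>" and bound: "\<And>x. norm (\<phi> x) \<le> B"
    and int: "(\<phi> has_integral I) UNIV"
  shows "((\<lambda>h. LBINT x. sinc_sq (h * x) *\<^sub>R \<phi> x) \<longlongrightarrow> I) (at_right 0)"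
proof -
  have "0 \<le> B" using bound[of 0] norm_ge_zero order_trans by blast
  have [measurable]: "\<phi> \<in> borel_measurable borel" by (intro borel_measurable_continuous_onI cont)
  \<comment> \<open>The factor is even, so folding the line at 0 leaves one half-line integral, and
    the primitive of \<open>k\<close> is the integral of \<phi> over [-X, X].\<close>
  define k where "k x = \<phi> x + \<phi> (- x)" for x
  have contk: "continuous_on S k" for S
    unfolding k_def by (intro continuous_intros continuous_on_compose2[OF cont]) auto
  have [measurable]: "k \<in> borel_measurable borel" by (intro borel_measurable_continuous_onI contk)
  have kB: "norm (k x) \<le> 2 * B" for x
    unfolding k_def using bound[of x] bound[of "-x"] norm_triangle_ineq[of "\<phi> x" "\<phi> (-x)"] by linarith
  define T where "T X = integral {0..X} k" for X
  have derT: "(T has_vector_derivative k x) (at x)" if "0 < x" for x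
    using integral_has_vector_derivative[OF contk, of x 0 "x+1"] that
    unfolding T_def by (simp add: at_within_Icc_at)
  have T_eq: "T X = integral {-X..X} \<phi>" if "0 \<le> X" for X
  proof -
    have i: "\<phi> integrable_on {a..b}" for a b by (intro integrable_continuous_interval continuous_on_subset[OF cont]) auto
    have "T X = integral {0..X} \<phi> + integral {0..X} (\<lambda>x. \<phi> (- x))"
      unfolding T_def k_def using Henstock_Kurzweil_Integration.integrable_reflect_real[of \<phi> 0 "-X"]
      by (intro Henstock_Kurzweil_Integration.integral_add) (simp_all add: i)
    also have "integral {0..X} (\<lambda>x. \<phi> (- x)) = integral {-X..0} \<phi>"
      using Henstock_Kurzweil_Integration.integral_reflect_real[of 0 "-X" \<phi>] that by simp
    finally show ?thesis
      using Henstock_Kurzweil_Integration.integral_combine[of "-X" 0 X \<phi>] that i by (simp add: add.commute)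
  qed
  have T_lim: "(T \<longlongrightarrow> I) at_top"
  proof (rule tendstoI)
    fix e :: real assume "0 < e"
    then obtain b where b: "b > 0" "\<And>a c. ball 0 b \<subseteq> cbox a c \<Longrightarrow> norm (integral (cbox a c) \<phi> - I) < e"
      using int unfolding has_integral_alt' by auto
    show "\<forall>\<^sub>F X in at_top. dist (T X) I < e"
      using eventually_ge_at_top[of b]
    proof eventually_elim
      case (elim X)
      have "ball 0 b \<subseteq> cbox (-X) X" using elim by (auto simp: dist_real_def)
      from b(2)[OF this] show ?case using elim b(1) by (simp add: T_eq dist_norm)
    qed
  qed
  have T_lin: "norm (T X) \<le> 2 * B * X" if "0 \<le> X" for X
    using Henstock_Kurzweil_Integration.integral_bound[OF that contk kB] by (simp add: T_def)
  have contT: "isCont T x" if "0 < x" for x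
    using derT[OF that] by (rule has_vector_derivative_continuous)
  \<comment> \<open>Convergence bounds \<open>T\<close> near infinity; on the remaining bounded
    interval linear growth does.\<close>
  obtain K where K: "\<And>X. 0 \<le> X \<Longrightarrow> norm (T X) \<le> K"
  proof -
    obtain X0 where X0: "\<And>X. X0 \<le> X \<Longrightarrow> dist (T X) I < 1"
      using tendstoD[OF T_lim, of 1] by (auto simp: eventually_at_top_linorder)
    have "norm (T X) \<le> norm I + 1 + 2 * B * max X0 0" if "0 \<le> X" for X
    proof (cases "X0 \<le> X")
      case True
      have "norm (T X) \<le> norm I + 1"
        using X0[OF True] norm_triangle_ineq2[of "T X" I] by (simp add: dist_norm)
      then show ?thesis using \<open>0 \<le> B\<close> by (simp add: add_increasing2)
    next
      case False
      have "norm (T X) \<le> 2 * B * max X0 0"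
        using T_lin[OF that] False \<open>0 \<le> B\<close> by (smt (verit) mult_left_mono max.cobounded1)
      then show ?thesis by (simp add: add_increasing)
    qed
    then show thesis by (rule that)
  qed
  have "0 \<le> K" using K[of 0] norm_ge_zero order_trans by blast
  have measT: "(\<lambda>y. indicator {0<..} y *\<^sub>R T (y / h)) \<in> borel_measurable borel" if "0 < h" for h
  proof (rule borel_measurable_continuous_on_indicator)
    show "continuous_on {0<..} (\<lambda>y. T (y / h))"
      using that by (intro continuous_on_compose2[OF continuous_at_imp_continuous_on[of "{0<..}" T]]
          ballI contT continuous_intros) auto
  qed simp
  have measT': "(\<lambda>y. indicator {0<..} y *\<^sub>R sinc_sq' y *\<^sub>R T (y / h)) \<in> borel_measurable borel" if "0 < h" for h
    using borel_measurable_scaleR[OF borel_measurable_sinc_sq' measT[OF that]] by (simp add: mult.commute)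
  have intT: "set_integrable lborel {0<..} (\<lambda>y. sinc_sq' y *\<^sub>R T (y / h))" if "0 < h" for h
    unfolding set_integrable_def
  proof (rule Bochner_Integration.integrable_bound)
    show "integrable lborel (\<lambda>y::real. K * (indicator {0<..} y *\<^sub>R sinc_sq' y))"
      using sinc_sq'_integrable by (intro integrable_mult_right) (simp add: set_integrable_def)
    show "AE y in lborel. norm (indicator {0<..} y *\<^sub>R sinc_sq' y *\<^sub>R T (y / h)) \<le> norm (K * (indicator {0<..} y *\<^sub>R sinc_sq' y))"
    proof (rule AE_I2)
      fix y :: real
      show "norm (indicator {0<..} y *\<^sub>R sinc_sq' y *\<^sub>R T (y / h)) \<le> norm (K * (indicator {0<..} y *\<^sub>R sinc_sq' y))"
        using K[of "y / h"] that \<open>0 \<le> K\<close> by (auto simp: indicator_def abs_mult mult.commute[of K] intro!: mult_left_mono)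
    qed
  qed (use measT'[OF that] in simp)
  have eq: "(LBINT x. sinc_sq (h * x) *\<^sub>R \<phi> x) = - (LBINT y:{0<..}. sinc_sq' y *\<^sub>R T (y / h))" if h: "0 < h" for h
  proof -
    have int: "integrable lborel (\<lambda>x. sinc_sq (h * x) *\<^sub>R \<phi> x)"
      by (rule integrable_sinc_sq_mult[OF _ bound h]) simp
    define g where "g x = sinc_sq (h * x) *\<^sub>R \<phi> x" for x
    have [measurable]: "g \<in> borel_measurable borel" unfolding g_def by measurable
    have int: "integrable lborel g" using int by (simp add: g_def[abs_def])
    then have int': "integrable lborel (\<lambda>x. g (-x))"
      using lborel_integrable_real_affine[of g "-1" 0] by simp
    have si: "set_integrable lborel A g" if "A \<in> sets borel" for A
      using integrable_mult_indicator[of A lborel g] int that by (simp add: set_integrable_def)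
    have si': "set_integrable lborel A (\<lambda>x. g (-x))" if "A \<in> sets borel" for A
      using integrable_mult_indicator[of A lborel "\<lambda>x. g (-x)"] int' that by (simp add: set_integrable_def)
    have "(LBINT x. g x) = (LBINT x:{0<..} \<union> {..<0}. g x)"
      unfolding set_lebesgue_integral_def
      by (rule integral_discrete_difference[of "{0}"]) (auto simp: indicator_def)
    also have "\<dots> = (LBINT x:{0<..}. g x) + (LBINT x:{..<0}. g x)"
      by (rule set_integral_Un) (auto intro: si)
    also have "(LBINT x:{..<0}. g x) = (LBINT x:{0<..}. g (-x))"
      using lborel_integral_real_affine[of "-1" "\<lambda>x. indicator {..<0} x *\<^sub>R g x" 0]
      by (simp add: set_lebesgue_integral_def indicator_def)
    also have "(LBINT x:{0<..}. g x) + (LBINT x:{0<..}. g (-x)) = (LBINT x:{0<..}. g x + g (-x))"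
      by (rule set_integral_add(2)[symmetric]) (auto intro: si si')
    also have "\<dots> = (LBINT x:{0<..}. sinc_sq (h * x) *\<^sub>R k x)"
      by (simp add: g_def k_def scaleR_add_right)
    also have "\<dots> = (LBINT y:{0<..}. sinc_sq y *\<^sub>R (k (y / h) /\<^sub>R h))"
      using h lborel_integral_real_affine[of "1 / h" "\<lambda>x. indicator {0<..} x *\<^sub>R sinc_sq (h * x) *\<^sub>R k x" 0]
      by (simp add: set_lebesgue_integral_def indicator_def inverse_eq_divide zero_less_divide_iff
          flip: integral_scaleR_right)
    finally have 1: "(LBINT x. g x) = (LBINT y:{0<..}. sinc_sq y *\<^sub>R (k (y / h) /\<^sub>R h))" .
    have "set_integrable lborel {0<..} (\<lambda>x. g x + g (-x))"
      by (intro set_integral_add si si') auto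
    then have "set_integrable lborel {0<..} (\<lambda>x. sinc_sq (h * x) *\<^sub>R k x)"
      by (simp add: g_def k_def scaleR_add_right)
    then have "integrable lborel (\<lambda>y. (1/h) *\<^sub>R (indicator {0<..} (0 + 1 / h * y) *\<^sub>R sinc_sq (h * (0 + 1 / h * y)) *\<^sub>R k (0 + 1 / h * y)))"
      unfolding set_integrable_def using h by (intro integrable_scaleR_right lborel_integrable_real_affine) auto
    also have "(\<lambda>y. (1/h) *\<^sub>R (indicator {0<..} (0 + 1 / h * y) *\<^sub>R sinc_sq (h * (0 + 1 / h * y)) *\<^sub>R k (0 + 1 / h * y)))
        = (\<lambda>y. indicator {0<..} y *\<^sub>R sinc_sq y *\<^sub>R (k (y / h) /\<^sub>R h))"
      using h by (auto simp: fun_eq_iff indicator_def zero_less_divide_iff inverse_eq_divide)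
    finally have intk: "set_integrable lborel {0<..} (\<lambda>y. sinc_sq y *\<^sub>R (k (y / h) /\<^sub>R h))"
      by (simp add: set_integrable_def)
    \<comment> \<open>The integrand is the derivative of
      \<open>sinc_sq y *\<^sub>R T (y / h)\<close>. Its boundary values vanish: at 0 because
      \<open>T\<close> grows at most linearly from 0, at infinity because \<open>T\<close> is
      bounded and the factor decays.\<close>
    have "(LBINT y=0..\<infinity>. sinc_sq y *\<^sub>R (k (y / h) /\<^sub>R h) + sinc_sq' y *\<^sub>R T (y / h)) = 0 - 0"
      unfolding zero_ereal_def
    proof (rule interval_integral_FTC_integrable[where F = "\<lambda>y. sinc_sq y *\<^sub>R T (y / h)"]; (unfold ereal_less(2) ereal_less_eq less_ereal.simps ereal_tendsto_simps einterval_eq)?)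
      fix y :: real assume y: "0 < y"
      have "((\<lambda>y. y / h) has_real_derivative 1 / h) (at y)"
        by (rule DERIV_cdivide[OF DERIV_ident])
      then have "((\<lambda>y. T (y / h)) has_vector_derivative k (y / h) /\<^sub>R h) (at y)"
        using vector_diff_chain_at[of "\<lambda>y. y / h" "1 / h" y T "k (y / h)"] derT[of "y / h"] y h
        by (simp add: comp_def has_real_derivative_iff_has_vector_derivative inverse_eq_divide)
      from has_vector_derivative_scaleR[OF has_real_derivative_sinc_sq[of y] this] y
      show "((\<lambda>y. sinc_sq y *\<^sub>R T (y / h)) has_vector_derivative
           sinc_sq y *\<^sub>R (k (y / h) /\<^sub>R h) + sinc_sq' y *\<^sub>R T (y / h)) (at y)"
        by blast
      show "isCont (\<lambda>y. sinc_sq y *\<^sub>R (k (y / h) /\<^sub>R h) + sinc_sq' y *\<^sub>R T (y / h)) y"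
        using y h contT[of "y / h"]
        by (intro continuous_intros isCont_sinc_sq continuous_sinc_sq'
            isCont_o2[of _ "\<lambda>y. y / h" T] isCont_o2[of _ "\<lambda>y. y / h" k])
           (use contk[of UNIV] in \<open>auto simp: continuous_on_eq_continuous_at\<close>)
    next
      show "set_integrable lborel {0<..} (\<lambda>y. sinc_sq y *\<^sub>R (k (y / h) /\<^sub>R h) + sinc_sq' y *\<^sub>R T (y / h))"
        by (intro set_integral_add intk intT h)
      show "((\<lambda>y. sinc_sq y *\<^sub>R T (y / h)) \<longlongrightarrow> 0) (at_right 0)"
      proof (rule Lim_null_comparison)
        show "\<forall>\<^sub>F y in at_right 0. norm (sinc_sq y *\<^sub>R T (y / h)) \<le> 2 * B * (y / h)"
          unfolding eventually_at_right_field
        proof (intro exI[of _ 1] conjI allI impI)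
          fix y :: real assume "0 < y"
          then show "norm (sinc_sq y *\<^sub>R T (y / h)) \<le> 2 * B * (y / h)"
            using mult_mono[OF sinc_sq_le_1[of y] T_lin[of "y / h"]] sinc_sq_nonneg[of y] h by simp
        qed simp
        show "((\<lambda>y. 2 * B * (y / h)) \<longlongrightarrow> 0) (at_right 0)"
          using h by (auto intro!: tendsto_eq_intros)
      qed
      show "((\<lambda>y. sinc_sq y *\<^sub>R T (y / h)) \<longlongrightarrow> 0) at_top"
      proof (rule Lim_null_comparison)
        show "\<forall>\<^sub>F y in at_top. norm (sinc_sq y *\<^sub>R T (y / h)) \<le> sinc_sq y * K"
          using eventually_ge_at_top[of 0]
        proof eventually_elim
          case (elim y)
          then show ?case using K[of "y / h"] h sinc_sq_nonneg[of y] by (auto intro: mult_left_mono)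
        qed
        show "((\<lambda>y. sinc_sq y * K) \<longlongrightarrow> 0) at_top"
          using tendsto_sinc_sq_at_top by (rule tendsto_mult_left_zero)
      qed
    qed simp
    then have "(LBINT y:{0<..}. sinc_sq y *\<^sub>R (k (y / h) /\<^sub>R h)) + (LBINT y:{0<..}. sinc_sq' y *\<^sub>R T (y / h)) = 0"
      by (simp only: interval_lebesgue_integral_0_infty set_integral_add(2)[OF intk intT[OF h]] diff_zero)
    with 1 show ?thesis by (simp add: g_def add_eq_0_iff2)
  qed
  \<comment> \<open>Now h occurs only in the argument of \<open>T\<close>, and y / h tends to
    infinity for each y > 0. The derivative integrates to -1, which the minus sign of the
    integration by parts compensates.\<close>
  have "((\<lambda>h. LBINT y:{0<..}. sinc_sq' y *\<^sub>R T (y / h)) \<longlongrightarrow> (LBINT y:{0<..}. sinc_sq' y *\<^sub>R I)) (at_right 0)"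
    unfolding set_lebesgue_integral_def
  proof (rule integral_dominated_convergence_at_within)
    show "integrable lborel (\<lambda>y. K * \<bar>indicator {0<..} y * sinc_sq' y\<bar>)"
      using sinc_sq'_integrable by (intro integrable_mult_right integrable_abs) (simp add: set_integrable_def)
    fix h :: real assume "h \<in> {0<..}"
    then have h: "0 < h" by simp
    show "AE y in lborel. norm (indicator {0<..} y *\<^sub>R sinc_sq' y *\<^sub>R T (y / h)) \<le> K * \<bar>indicator {0<..} y * sinc_sq' y\<bar>"
    proof (rule AE_I2)
      fix y :: real
      show "norm (indicator {0<..} y *\<^sub>R sinc_sq' y *\<^sub>R T (y / h)) \<le> K * \<bar>indicator {0<..} y * sinc_sq' y\<bar>"
        using K[of "y / h"] h \<open>0 \<le> K\<close> by (auto simp: indicator_def abs_mult mult.commute[of K] intro!: mult_left_mono)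
    qed
  next
    show "AE y in lborel. ((\<lambda>h. indicator {0<..} y *\<^sub>R sinc_sq' y *\<^sub>R T (y / h))
        \<longlongrightarrow> indicator {0<..} y *\<^sub>R sinc_sq' y *\<^sub>R I) (at_right 0)"
    proof (rule AE_I2)
      fix y :: real
      show "((\<lambda>h. indicator {0<..} y *\<^sub>R sinc_sq' y *\<^sub>R T (y / h))
        \<longlongrightarrow> indicator {0<..} y *\<^sub>R sinc_sq' y *\<^sub>R I) (at_right 0)"
      proof (cases "0 < y")
        case True
        have "filterlim (\<lambda>h. y / h) at_top (at_right 0)"
          using filterlim_tendsto_pos_mult_at_top[OF tendsto_const True filterlim_inverse_at_top_right]
          by (simp add: divide_inverse)
        then show ?thesis
          by (intro tendsto_intros filterlim_compose[OF T_lim])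
      qed simp
    qed
  qed (use measT' in auto)
  also have "(LBINT y:{0<..}. sinc_sq' y *\<^sub>R I) = - I"
    using sinc_sq'_integral sinc_sq'_integrable by (simp add: set_lebesgue_integral_def set_integrable_def)
  finally show ?thesis
    by (intro Lim_transform_eventually[OF tendsto_minus[of _ "-I", simplified]])
       (auto simp: eventually_at_right_field eq intro!: exI[of _ 1])
qed

lemma tendsto_sinc_sq_0: "((\<lambda>h. sinc_sq (h * x)) \<longlongrightarrow> 1) (at_right 0)"
proof -
  have "isCont (\<lambda>h. sinc_sq (h * x)) 0"
    by (intro isCont_o2[of _ "\<lambda>h. h * x" sinc_sq] isCont_sinc_sq continuous_intros)
  then show ?thesis by (simp add: isCont_def filterlim_at_split)
qed

section \<open>The twice integrated trigonometric integral\<close>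

text \<open>A second primitive in v of exp (i v x). The added terms are affine in v, so second
  differences do not see them. They remove the singularity at x = 0; the linear one is cut off at
  |x| = 1 because it would spoil the decay 1 / x^2 at infinity.\<close>

definition riemann_kernel :: "real \<Rightarrow> real \<Rightarrow> complex" where
  "riemann_kernel v x = (1 + \<i> * of_real (v * x * indicator {-1..1} x) - cis (v * x)) / of_real (x\<^sup>2)"

lemma riemann_kernel_bound: "norm (riemann_kernel v x) \<le> (4 + v\<^sup>2) * inverse (1 + x\<^sup>2)"
proof (cases "x = 0")
  case False
  show ?thesis
  proof (cases "\<bar>x\<bar> \<le> 1")
    case True
    have "norm (cis (v * x) - (1 + \<i> * of_real (v * x))) \<le> (v * x)\<^sup>2 / 2"
      using iexp_approx1[of "v * x" 1] by (simp add: cis_conv_exp numeral_2_eq_2)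
    then have "norm (riemann_kernel v x) \<le> (v * x)\<^sup>2 / 2 / x\<^sup>2"
      unfolding riemann_kernel_def norm_divide using True
      by (intro frac_le) (auto simp: norm_minus_commute norm_power indicator_def abs_le_iff False)
    also have "\<dots> = v\<^sup>2 * (1/2)" using False by (simp add: power_mult_distrib)
    also have "\<dots> \<le> (4 + v\<^sup>2) * inverse (1 + x\<^sup>2)"
      using True power_le_one[of "\<bar>x\<bar>" 2] by (intro mult_mono) (auto simp: field_simps add_pos_nonneg)
    finally show ?thesis .
  next
    case F: False
    then have "riemann_kernel v x = (1 - cis (v * x)) / of_real (x\<^sup>2)"
      by (auto simp: riemann_kernel_def indicator_def)
    then have "norm (riemann_kernel v x) \<le> 2 / x\<^sup>2"
      using norm_triangle_ineq4[of 1 "cis (v * x)"] by (auto simp: norm_divide norm_power intro!: divide_right_mono)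
    also have "\<dots> \<le> 4 * inverse (1 + x\<^sup>2)"
      using F one_le_power[of "\<bar>x\<bar>" 2] by (simp add: field_simps add_pos_nonneg)
    also have "\<dots> \<le> (4 + v\<^sup>2) * inverse (1 + x\<^sup>2)" by (intro mult_right_mono) (auto simp: add_nonneg_nonneg)
    finally show ?thesis .
  qed
qed (simp add: riemann_kernel_def)

text \<open>The affine corrections cancel and 2 - 2 cos (d x) = 4 sin^2 (d x / 2). At x = 0 the left
  side is 0 by the convention for division, while the right side is d^2.\<close>

lemma riemann_kernel_second_difference:
  assumes "x \<noteq> 0" "0 < d"
  shows "riemann_kernel (v + d) x + riemann_kernel (v - d) x - 2 * riemann_kernel v x
    = of_real (d\<^sup>2 * sinc_sq (d / 2 * x)) * cis (v * x)"
proof -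
  have "d\<^sup>2 * sinc_sq (d / 2 * x) = 4 * (sin (d * x / 2))\<^sup>2 / x\<^sup>2"
    using assms by (simp add: sinc_sq_def field_simps power2_eq_square)
  also have "4 * (sin (d * x / 2))\<^sup>2 = 2 - 2 * cos (d * x)"
    using cos_double_sin[of "d * x / 2"] by simp
  finally have 1: "d\<^sup>2 * sinc_sq (d / 2 * x) = (2 - 2 * cos (d * x)) / x\<^sup>2" .
  have "cis ((v + d) * x) + cis ((v - d) * x) = of_real (2 * cos (d * x)) * cis (v * x)"
    by (simp add: complex_eq_iff distrib_right left_diff_distrib cos_add cos_diff sin_add sin_diff)
  then have "(1 + \<i> * of_real ((v + d) * x * j) - cis ((v + d) * x)) + (1 + \<i> * of_real ((v - d) * x * j) - cis ((v - d) * x))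
      - 2 * (1 + \<i> * of_real (v * x * j) - cis (v * x)) = of_real (2 - 2 * cos (d * x)) * cis (v * x)" for j
    by (simp add: algebra_simps)
  then show ?thesis
    unfolding 1 riemann_kernel_def times_divide_eq_right add_divide_distrib[symmetric] diff_divide_distrib[symmetric]
    by simp
qed

text \<open>Riemann's theory of trigonometric series: the integrals are second difference quotients of the
  continuous function obtained by integrating the trigonometric integral twice, and these converge to
  \<open>F\<close>; so a bound on \<open>F\<close> bounds all of them by \<open>second_difference_le\<close>.\<close>

lemma sinc_sq_means_bounded:
  fixes f :: "real \<Rightarrow> real"
  assumes cont: "continuous_on UNIV f" and bound: "\<And>x. \<bar>f x\<bar> \<le> B"
    and int: "\<And>v. ((\<lambda>x. cis (v * x) * of_real (f x)) has_integral F v) UNIV"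
    and F: "\<And>v. norm (F v) \<le> C" and "0 < h"
  shows "norm (LBINT x. sinc_sq (h * x) *\<^sub>R (cis (v * x) * of_real (f x))) \<le> C"
proof -
  define q where "q h v = (LBINT x. sinc_sq (h * x) *\<^sub>R (cis (v * x) * complex_of_real (f x)))" for h v
  have [measurable]: "f \<in> borel_measurable borel" by (intro borel_measurable_continuous_onI cont)
  have [measurable]: "cis \<in> borel_measurable borel" by (intro borel_measurable_continuous_onI continuous_on_cis continuous_on_id)
  have "0 \<le> B" using bound[of 0] by linarith
  \<comment> \<open>Formally the second derivative of \<open>P\<close> is \<open>F\<close>. In
    contrast to the integral for \<open>F\<close>, this one converges absolutely.\<close>
  define P where "P v = (LBINT x. of_real (f x) * riemann_kernel v x)" for v
  have [measurable]: "riemann_kernel v \<in> borel_measurable borel" for v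
    unfolding riemann_kernel_def[abs_def] by measurable
  have kb: "norm (of_real (f x) * riemann_kernel v x) \<le> B * (4 + R\<^sup>2) * inverse (1 + x\<^sup>2)" if "\<bar>v\<bar> \<le> R" for v x R
  proof -
    have "norm (of_real (f x) * riemann_kernel v x) \<le> B * ((4 + v\<^sup>2) * inverse (1 + x\<^sup>2))"
      unfolding norm_mult using bound[of x] riemann_kernel_bound[of v x] by (intro mult_mono) auto
    also have "\<dots> \<le> B * ((4 + R\<^sup>2) * inverse (1 + x\<^sup>2))"
      using that power_mono[of "\<bar>v\<bar>" R 2] \<open>0 \<le> B\<close>
      by (intro mult_left_mono mult_right_mono) (auto simp: add_nonneg_nonneg)
    finally show ?thesis by simp
  qed
  have ib: "integrable lborel (\<lambda>x::real. B * (4 + R\<^sup>2) * inverse (1 + x\<^sup>2))" for R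
    by (intro integrable_mult_right integrable_inverse_1_plus_sq)
  have ik: "integrable lborel (\<lambda>x. of_real (f x) * riemann_kernel v x)" for v
    by (rule Bochner_Integration.integrable_bound[OF ib[of "\<bar>v\<bar>"]])
       (use kb[of v "\<bar>v\<bar>"] in \<open>auto intro: order_trans[OF _ abs_ge_self]\<close>)
  have contP: "continuous_on UNIV P"
    unfolding continuous_on_eq_continuous_at[OF open_UNIV]
  proof
    fix v0 :: real
    have "(P \<longlongrightarrow> P v0) (at v0 within ball v0 1)"
      unfolding P_def
    proof (rule integral_dominated_convergence_at_within[OF _ _ ib])
      fix v assume "v \<in> ball v0 1"
      then have "\<bar>v\<bar> \<le> \<bar>v0\<bar> + 1" by (auto simp: dist_real_def)
      then show "AE x in lborel. norm (of_real (f x) * riemann_kernel v x) \<le> B * (4 + (\<bar>v0\<bar> + 1)\<^sup>2) * inverse (1 + x\<^sup>2)"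
        by (intro AE_I2 kb)
    next
      have "continuous_on UNIV (\<lambda>v. of_real (f x) * riemann_kernel v x)" for x
        unfolding riemann_kernel_def divide_inverse by (intro continuous_intros)
      then have "((\<lambda>v. of_real (f x) * riemann_kernel v x) \<longlongrightarrow> of_real (f x) * riemann_kernel v0 x) (at v0)" for x
        unfolding continuous_on_eq_continuous_at[OF open_UNIV] by (simp add: isCont_def)
      then show "AE x in lborel. ((\<lambda>v. of_real (f x) * riemann_kernel v x) \<longlongrightarrow> of_real (f x) * riemann_kernel v0 x) (at v0 within ball v0 1)"
        by (intro AE_I2) (rule tendsto_within_subset[OF _ subset_UNIV])
    qed simp_all
    then show "isCont P v0" by (simp add: at_within_open[of _ "ball v0 1"] isCont_def)
  qed
  have diff: "P (v + d) + P (v - d) - 2 * P v = of_real (d\<^sup>2) * q (d / 2) v" if "0 < d" for v d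
  proof -
    have "P (v + d) + P (v - d) - 2 * P v =
       (LBINT x. of_real (f x) * riemann_kernel (v + d) x + of_real (f x) * riemann_kernel (v - d) x - 2 * (of_real (f x) * riemann_kernel v x))"
      unfolding P_def using ik by simp
    also have "\<dots> = (LBINT x. of_real (d\<^sup>2) * (sinc_sq (d / 2 * x) *\<^sub>R (cis (v * x) * of_real (f x))))"
    proof (rule integral_discrete_difference[of "{0}"])
      fix x :: real assume "x \<notin> {0}"
      then have "riemann_kernel (v + d) x + riemann_kernel (v - d) x - 2 * riemann_kernel v x
          = of_real (d\<^sup>2 * sinc_sq (d / 2 * x)) * cis (v * x)"
        using riemann_kernel_second_difference that by simp
      then have "of_real (f x) * (riemann_kernel (v + d) x + riemann_kernel (v - d) x - 2 * riemann_kernel v x)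
          = of_real (f x) * (of_real (d\<^sup>2 * sinc_sq (d / 2 * x)) * cis (v * x))" by simp
      then show "of_real (f x) * riemann_kernel (v + d) x + of_real (f x) * riemann_kernel (v - d) x - 2 * (of_real (f x) * riemann_kernel v x)
        = of_real (d\<^sup>2) * (sinc_sq (d / 2 * x) *\<^sub>R (cis (v * x) * of_real (f x)))"
        by (simp add: algebra_simps scaleR_conv_of_real)
    qed auto
    finally show ?thesis unfolding q_def integral_mult_right_zero .
  qed
  have lim: "((\<lambda>h. q h v) \<longlongrightarrow> F v) (at_right 0)" for v
    unfolding q_def
    by (rule sinc_sq_summation[OF _ _ int, of _ B]) (use bound in \<open>auto simp: norm_mult intro!: continuous_intros cont\<close>)
  have lim': "((\<lambda>d. q (d / 2) v) \<longlongrightarrow> F v) (at_right 0)" for v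
  proof -
    have "filterlim (\<lambda>d::real. d / 2) (at_right 0) (at_right 0)"
      by (auto simp: filterlim_at intro!: tendsto_eq_intros) (auto simp: eventually_at_right_field intro: exI[of _ 1])
    then show ?thesis by (rule filterlim_compose[OF lim])
  qed
  \<comment> \<open>The second difference bound concerns real functions; applied in every direction
    c it controls the modulus.\<close>
  have key: "Re (c * q h v) \<le> C" if "norm c = 1" for c
  proof -
    have cdiff: "Re (c * P (v + d)) + Re (c * P (v - d)) - 2 * Re (c * P v) = d\<^sup>2 * Re (c * q (d / 2) v)" if "0 < d" for v d
    proof -
      have "Re (c * P (v + d)) + Re (c * P (v - d)) - 2 * Re (c * P v) = Re (c * (P (v + d) + P (v - d) - 2 * P v))"
        by (simp add: algebra_simps)
      then show ?thesis unfolding diff[OF that] by (simp add: algebra_simps)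
    qed
    \<comment> \<open>The step is 2 h because a second difference with step d gives the mean with
      parameter d / 2.\<close>
    have "Re (c * P (v + 2 * h)) + Re (c * P (v - 2 * h)) - 2 * Re (c * P v) \<le> C * (2 * h)\<^sup>2"
    proof (rule second_difference_le[where l = "\<lambda>v. Re (c * F v)"])
      show "continuous_on UNIV (\<lambda>v. Re (c * P v))" by (intro continuous_intros contP)
      show "((\<lambda>e. (Re (c * P (v + e)) + Re (c * P (v - e)) - 2 * Re (c * P v)) / e\<^sup>2) \<longlongrightarrow> Re (c * F v)) (at_right 0)" for v
        by (rule Lim_transform_eventually[OF tendsto_Re[OF tendsto_mult_left[OF lim']]])
           (unfold eventually_at_right_field, intro exI[of _ 1] conjI allI impI, simp, subst cdiff, simp_all)
      show "Re (c * F v) \<le> C" for v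
        using complex_Re_le_cmod[of "c * F v"] F[of v] that by (simp add: norm_mult)
    qed (use \<open>0 < h\<close> in simp)
    then show ?thesis using cdiff[of "2 * h" v] \<open>0 < h\<close> by (simp add: mult.commute)
  qed
  have "norm (q h v) \<le> C"
  proof (cases "q h v = 0")
    case True
    have "0 \<le> C" using F[of 0] norm_ge_zero order_trans by blast
    with True show ?thesis by simp
  next
    case False
    \<comment> \<open>The direction that rotates \<open>q h v\<close> onto the positive real
      axis.\<close>
    have "cnj (q h v) / of_real (norm (q h v)) * q h v = of_real (norm (q h v))"
      using False complex_norm_square[of "q h v"] by (simp add: field_simps power2_eq_square)
    then show ?thesis using key[of "cnj (q h v) / of_real (norm (q h v))"] False by (simp add: norm_divide)
  qed
  then show ?thesis by (simp add: q_def)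
qed

text \<open>The Fubini steps for complex integrands below all rest on a product bound of this
  kind.\<close>

lemma (in pair_sigma_finite) integrable_product_bound:
  fixes G :: "'a \<Rightarrow> 'b \<Rightarrow> 'c::{banach, second_countable_topology}"
  assumes [measurable]: "case_prod G \<in> borel_measurable (M1 \<Otimes>\<^sub>M M2)"
    and bound: "\<And>x y. norm (G x y) \<le> a x * b y" and a: "integrable M1 a" and b: "integrable M2 b"
  shows "integrable (M1 \<Otimes>\<^sub>M M2) (case_prod G)"
proof (rule Fubini_integrable)
  have iG: "integrable M2 (G x)" if "x \<in> space M1" for x
  proof (rule Bochner_Integration.integrable_bound)
    show "integrable M2 (\<lambda>y. a x * b y)" using b by simp
    show "G x \<in> borel_measurable M2" using that by measurable
  qed (auto intro!: AE_I2 order_trans[OF bound])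
  show "integrable M1 (\<lambda>x. \<integral>y. norm (case (x, y) of (x, y) \<Rightarrow> G x y) \<partial>M2)"
  proof (rule Bochner_Integration.integrable_bound)
    show "integrable M1 (\<lambda>x. a x * (\<integral>y. b y \<partial>M2))" using a by simp
    show "AE x in M1. norm (\<integral>y. norm (case (x, y) of (x, y) \<Rightarrow> G x y) \<partial>M2) \<le> norm (a x * (\<integral>y. b y \<partial>M2))"
    proof (rule AE_I2)
      fix x assume x: "x \<in> space M1"
      have "(\<integral>y. norm (G x y) \<partial>M2) \<le> (\<integral>y. a x * b y \<partial>M2)"
        using b by (intro integral_mono integrable_norm iG x bound) simp
      then show "norm (\<integral>y. norm (case (x, y) of (x, y) \<Rightarrow> G x y) \<partial>M2) \<le> norm (a x * (\<integral>y. b y \<partial>M2))"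
        by simp
    qed
  qed measurable
  show "AE x in M1. integrable M2 (\<lambda>y. case (x, y) of (x, y) \<Rightarrow> G x y)"
    using iG by (intro AE_I2) simp
qed measurable

section \<open>Gaussian means computed on the frequency side\<close>

abbreviation (input) gauss :: "real measure" where "gauss \<equiv> std_normal_distribution"

lemma prob_space_std_normal: "prob_space gauss"
  using real_dist_normal_dist by (simp add: real_distribution_def)

lemma borel_measurable_cis [measurable]: "cis \<in> borel_measurable borel"
  by (intro borel_measurable_continuous_onI continuous_on_cis continuous_on_id)

lemma integral_std_normal_cis:
  "(\<integral>w. cis (w * t) \<partial>gauss) = of_real (exp (- t\<^sup>2 / 2))"
  using fun_cong[OF char_std_normal_distribution, of t] by (simp add: char_def cis_conv_exp mult.commute)

text \<open>Parseval's formula against a Gaussian. With h > 0 the x-integral converges absolutely,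
  so w may be integrated first; the characteristic function of the normal law then yields a Gaussian
  in (x - a) / r, and x = a + r y produces the factor r sqrt (2 pi).\<close>

lemma sinc_sq_mean_gaussian:
  fixes f :: "real \<Rightarrow> real"
  assumes [measurable]: "f \<in> borel_measurable borel" and bound: "\<And>x. \<bar>f x\<bar> \<le> B"
    and h: "0 < h" and r: "0 < r"
  shows "(\<integral>w. (LBINT x. sinc_sq (h * x) *\<^sub>R (cis (w / r * x) * of_real (f x))) * cis (- (w * a / r)) \<partial>gauss)
     = of_real (r * sqrt (2 * pi) * (\<integral>y. sinc_sq (h * (a + r * y)) * f (a + r * y) \<partial>gauss))"
proof -
  interpret N: prob_space gauss by (rule prob_space_std_normal)
  interpret P: pair_sigma_finite gauss lborel ..
  define G where "G w x = sinc_sq (h * x) *\<^sub>R (cis (w / r * x) * complex_of_real (f x)) * cis (- (w * a / r))" for w x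
  have Gm: "case_prod G \<in> borel_measurable (gauss \<Otimes>\<^sub>M lborel)"
    unfolding G_def[abs_def] by measurable
  have iS: "integrable lborel (\<lambda>x. sinc_sq (h * x) *\<^sub>R \<bar>f x\<bar>)"
    by (rule integrable_sinc_sq_mult[OF _ _ h, of _ B]) (use bound in auto)
  have normG: "norm (G w x) = sinc_sq (h * x) *\<^sub>R \<bar>f x\<bar>" for w x
    by (simp add: G_def norm_mult sinc_sq_nonneg)
  have iG: "integrable (gauss \<Otimes>\<^sub>M lborel) (case_prod G)"
    by (rule P.integrable_product_bound[OF Gm, of "\<lambda>_. 1", OF _ _ iS]) (auto simp: normG)
  have "(\<integral>w. (LBINT x. sinc_sq (h * x) *\<^sub>R (cis (w / r * x) * of_real (f x))) * cis (- (w * a / r)) \<partial>gauss)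
     = (\<integral>w. (LBINT x. G w x) \<partial>gauss)"
    by (simp only: G_def integral_mult_left_zero)
  also have "\<dots> = (LBINT x. (\<integral>w. G w x \<partial>gauss))"
    by (rule P.Fubini_integral[OF iG, symmetric])
  also have "\<dots> = (LBINT x. of_real (sinc_sq (h * x) * f x * exp (- ((x - a) / r)\<^sup>2 / 2)))"
  proof (rule Bochner_Integration.integral_cong[OF refl])
    fix x
    have "G w x = of_real (sinc_sq (h * x) * f x) * cis (w * ((x - a) / r))" for w
      using cis_mult[of "w / r * x" "- (w * a / r)"]
      by (simp add: G_def scaleR_conv_of_real right_diff_distrib diff_divide_distrib mult.assoc mult.left_commute[of "cis _"] mult.commute[of "cis _" "of_real _"])
    then have "(\<integral>w. G w x \<partial>gauss) = of_real (sinc_sq (h * x) * f x) * (\<integral>w. cis (w * ((x - a) / r)) \<partial>gauss)"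
      by (simp only: integral_mult_right_zero)
    also have "\<dots> = of_real (sinc_sq (h * x) * f x * exp (- ((x - a) / r)\<^sup>2 / 2))"
      by (simp only: integral_std_normal_cis of_real_mult)
    finally show "(\<integral>w. G w x \<partial>gauss) = of_real (sinc_sq (h * x) * f x * exp (- ((x - a) / r)\<^sup>2 / 2))" .
  qed
  also have "\<dots> = of_real (LBINT x. sinc_sq (h * x) * f x * exp (- ((x - a) / r)\<^sup>2 / 2))"
    by (rule integral_complex_of_real)
  also have "(LBINT x. sinc_sq (h * x) * f x * exp (- ((x - a) / r)\<^sup>2 / 2))
      = r * (LBINT y. sinc_sq (h * (a + r * y)) * f (a + r * y) * exp (- y\<^sup>2 / 2))"
    using r lborel_integral_real_affine[of r "\<lambda>x. sinc_sq (h * x) * f x * exp (- ((x - a) / r)\<^sup>2 / 2)" a] by simp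
  also have "(LBINT y. sinc_sq (h * (a + r * y)) * f (a + r * y) * exp (- y\<^sup>2 / 2))
      = sqrt (2 * pi) * (LBINT y. std_normal_density y * (sinc_sq (h * (a + r * y)) * f (a + r * y)))"
    unfolding integral_mult_right_zero[symmetric] std_normal_density_def
    by (intro Bochner_Integration.integral_cong) simp_all
  also have "(LBINT y. std_normal_density y * (sinc_sq (h * (a + r * y)) * f (a + r * y)))
     = (\<integral>y. sinc_sq (h * (a + r * y)) * f (a + r * y) \<partial>gauss)"
    by (subst integral_density) auto
  finally show ?thesis by (simp add: mult.assoc)
qed

text \<open>Both sides of \<open>sinc_sq_mean_gaussian\<close> are followed as h tends to 0. On the
  frequency side \<open>sinc_sq_means_bounded\<close> supplies the constant dominating function, on
  the space side the bound on f does.\<close>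

lemma fourier_gaussian_mean:
  fixes f :: "real \<Rightarrow> real"
  assumes cont: "continuous_on UNIV f" and bound: "\<And>x. \<bar>f x\<bar> \<le> B"
    and int: "\<And>\<omega>. ((\<lambda>x. cis (\<omega> * x) * of_real (f x)) has_integral F \<omega>) UNIV"
    and F: "\<And>\<omega>. norm (F \<omega>) \<le> C" and [measurable]: "F \<in> borel_measurable borel" and r: "0 < r"
  shows "(\<integral>w. F (w / r) * cis (- (w * a / r)) \<partial>gauss)
     = of_real (r * sqrt (2 * pi) * (\<integral>y. f (a + r * y) \<partial>gauss))"
proof (rule tendsto_unique[OF trivial_limit_at_right_real[of 0]])
  interpret N: prob_space gauss by (rule prob_space_std_normal)
  have [measurable]: "f \<in> borel_measurable borel" by (intro borel_measurable_continuous_onI cont)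
  define q where "q h \<omega> = (LBINT x. sinc_sq (h * x) *\<^sub>R (cis (\<omega> * x) * complex_of_real (f x)))" for h \<omega>
  have [measurable]: "q h \<in> borel_measurable borel" for h
    unfolding q_def[abs_def] by measurable
  show "((\<lambda>h. (\<integral>w. q h (w / r) * cis (- (w * a / r)) \<partial>gauss))
      \<longlongrightarrow> (\<integral>w. F (w / r) * cis (- (w * a / r)) \<partial>gauss)) (at_right 0)"
  proof (rule integral_dominated_convergence_at_within[where w = "\<lambda>_. C"])
    fix h :: real assume "h \<in> {0<..}"
    then have "norm (q h \<omega>) \<le> C" for \<omega>
      unfolding q_def by (intro sinc_sq_means_bounded[OF cont bound int F]) simp
    then show "AE w in gauss. norm (q h (w / r) * cis (- (w * a / r))) \<le> C"
      by (intro AE_I2) (simp add: norm_mult)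
  next
    have "((\<lambda>h. q h \<omega>) \<longlongrightarrow> F \<omega>) (at_right 0)" for \<omega>
      unfolding q_def
      by (rule sinc_sq_summation[OF _ _ int, of _ B]) (use bound in \<open>auto simp: norm_mult intro!: continuous_intros cont\<close>)
    then show "AE w in gauss. ((\<lambda>h. q h (w / r) * cis (- (w * a / r))) \<longlongrightarrow> F (w / r) * cis (- (w * a / r))) (at_right 0)"
      by (intro AE_I2 tendsto_mult_right)
  qed auto
  have "((\<lambda>h. \<integral>y. sinc_sq (h * (a + r * y)) * f (a + r * y) \<partial>gauss)
    \<longlongrightarrow> (\<integral>y. f (a + r * y) \<partial>gauss)) (at_right 0)"
  proof (rule integral_dominated_convergence_at_within[where w = "\<lambda>_. B"])
    fix h :: real
    show "AE y in gauss. norm (sinc_sq (h * (a + r * y)) * f (a + r * y)) \<le> B"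
      using mult_mono[OF sinc_sq_le_1 bound] sinc_sq_nonneg by (auto simp: abs_mult)
  next
    show "AE y in gauss. ((\<lambda>h. sinc_sq (h * (a + r * y)) * f (a + r * y)) \<longlongrightarrow> f (a + r * y)) (at_right 0)"
      using tendsto_mult_right[OF tendsto_sinc_sq_0] by (intro AE_I2) force
  qed auto
  then have "((\<lambda>h. of_real (r * sqrt (2 * pi) * (\<integral>y. sinc_sq (h * (a + r * y)) * f (a + r * y) \<partial>gauss)))
    \<longlongrightarrow> complex_of_real (r * sqrt (2 * pi) * (\<integral>y. f (a + r * y) \<partial>gauss))) (at_right 0)"
    by (intro tendsto_of_real tendsto_mult_left)
  then show "((\<lambda>h. (\<integral>w. q h (w / r) * cis (- (w * a / r)) \<partial>gauss))
    \<longlongrightarrow> complex_of_real (r * sqrt (2 * pi) * (\<integral>y. f (a + r * y) \<partial>gauss))) (at_right 0)"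
  proof (rule Lim_transform_eventually)
    show "\<forall>\<^sub>F h in at_right 0. complex_of_real (r * sqrt (2 * pi) * (\<integral>y. sinc_sq (h * (a + r * y)) * f (a + r * y) \<partial>gauss))
      = (\<integral>w. q h (w / r) * cis (- (w * a / r)) \<partial>gauss)"
      using sinc_sq_mean_gaussian[OF _ bound _ r]
      by (auto simp: eventually_at_right_field q_def intro!: exI[of _ 1])
  qed
qed

section \<open>The fundamental solution at a random time\<close>

lemma gaussian_mean_tendsto:
  fixes f :: "real \<Rightarrow> real"
  assumes cont: "continuous_on UNIV f" and bound: "\<And>x. \<bar>f x\<bar> \<le> B"
  shows "((\<lambda>r. \<integral>y. f (a + r * y) \<partial>gauss) \<longlongrightarrow> f a) (at_right 0)"
proof -
  interpret N: prob_space gauss by (rule prob_space_std_normal)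
  have [measurable]: "f \<in> borel_measurable borel" by (intro borel_measurable_continuous_onI cont)
  have "((\<lambda>r. \<integral>y. f (a + r * y) \<partial>gauss) \<longlongrightarrow> (\<integral>y. f a \<partial>gauss)) (at_right 0)"
  proof (rule integral_dominated_convergence_at_within[where w = "\<lambda>_. B"])
    have "continuous_on UNIV (\<lambda>r. f (a + r * y))" for y
      by (intro continuous_on_compose2[OF cont] continuous_intros) auto
    then have "((\<lambda>r. f (a + r * y)) \<longlongrightarrow> f (a + 0 * y)) (at 0)" for y
      unfolding continuous_on_eq_continuous_at[OF open_UNIV] isCont_def by blast
    then show "AE y in gauss. ((\<lambda>r. f (a + r * y)) \<longlongrightarrow> f a) (at_right 0)"
      by (intro AE_I2) (simp add: filterlim_at_split)
  qed (use bound in auto)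
  then show ?thesis using N.prob_space by simp
qed

lemma abs_gaussian_mean_le:
  fixes f :: "real \<Rightarrow> real"
  assumes [measurable]: "f \<in> borel_measurable borel" and bound: "\<And>x. \<bar>f x\<bar> \<le> B"
  shows "\<bar>\<integral>y. f (a + r * y) \<partial>gauss\<bar> \<le> B"
proof -
  interpret N: prob_space gauss by (rule prob_space_std_normal)
  have "0 \<le> B" using bound[of 0] by linarith
  have "\<bar>\<integral>y. f (a + r * y) \<partial>gauss\<bar> \<le> (\<integral>y. \<bar>f (a + r * y)\<bar> \<partial>gauss)"
    by (rule integral_abs_bound)
  also have "\<dots> \<le> (\<integral>y. B \<partial>gauss)"
    by (intro integral_mono N.integrable_const_bound[of _ B]) (use bound \<open>0 \<le> B\<close> in auto)
  finally show ?thesis using N.prob_space by simp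
qed

text \<open>A crude bound on \<open>s\<close> to the power -1/n: with it the moments of order 0 and
  -1 of the subordinator suffice for every n.\<close>

lemma inverse_root_le:
  assumes "0 < n" "0 < s"
  shows "1 / root n s \<le> 1 + 1 / s"
proof (cases "1 \<le> s")
  case True
  then have "1 \<le> root n s" using assms by simp
  then have "1 / root n s \<le> 1" by simp
  then show ?thesis using assms by (simp add: add_increasing2)
next
  case False
  have "s \<le> root n s"
    using assms False real_root_le_iff[of n "s ^ n" s] power_le_one_iff[of s n] power_decreasing[of 1 n s]
    by (simp add: real_root_power_cancel)
  then have "1 / root n s \<le> 1 / s" using assms by (intro divide_left_mono) auto
  then show ?thesis by simp
qed

section \<open>Scaling of the kernel and integration against a time density\<close>

text \<open>Boundedness in space is assumed at each time separately, with no control as time tends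
  to 0. That control is derived from the transform in \<open>mean_bound\<close>.\<close>

locale odd_order_kernel =
  fixes n :: nat and u :: "real \<Rightarrow> real \<Rightarrow> real"
  assumes n_pos: "0 < n"
    and cont_space: "\<And>s. 0 < s \<Longrightarrow> continuous_on UNIV (\<lambda>x. u x s)"
    and bounded_space: "\<And>s. 0 < s \<Longrightarrow> bounded (range (\<lambda>x. u x s))"
    and cont_time: "\<And>x. continuous_on {0<..} (\<lambda>s. u x s)"
    and transform: "\<And>s \<xi>. 0 < s \<Longrightarrow> ((\<lambda>x. cis (\<xi> * x) * complex_of_real (u x s)) has_integral
                    exp (- (\<i> * complex_of_real (s * \<xi> ^ n)))) UNIV"
begin

definition mean :: "real \<Rightarrow> real \<Rightarrow> real \<Rightarrow> real" where
  "mean r a s = (\<integral>y. u (a + r * y) s \<partial>gauss)"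

text \<open>The frequency side of \<open>mean\<close>, up to the constant in \<open>mean_eq\<close>.
  Here s occurs explicitly, which gives both the scaling law and measurability in s.\<close>

definition mean_transform :: "real \<Rightarrow> real \<Rightarrow> real \<Rightarrow> complex" where
  "mean_transform r a s =
     (\<integral>w. exp (- (\<i> * of_real (s * (w / r) ^ n))) * cis (- (w * a / r)) \<partial>gauss)"

lemma space_bound: "0 < s \<Longrightarrow> \<exists>B. \<forall>x. \<bar>u x s\<bar> \<le> B"
  using bounded_space[of s] by (auto simp: bounded_iff)

lemma mean_eq:
  assumes "0 < s" "0 < r"
  shows "of_real (r * sqrt (2 * pi) * mean r a s) = mean_transform r a s"
proof -
  obtain B where "\<And>x. \<bar>u x s\<bar> \<le> B" using space_bound[OF assms(1)] by blast
  then show ?thesis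
    unfolding mean_def mean_transform_def
    by (intro fourier_gaussian_mean[OF cont_space[OF assms(1)] _ transform[OF assms(1)], symmetric, of B 1])
       (use assms in auto)
qed

text \<open>Writing s = c^n, the integrand of \<open>mean_transform\<close> depends on s, r, a only
  through r / c and a / c. Self-similarity is thus read off the transform, for the means, and not
  from uniqueness for the equation.\<close>

lemma mean_scaling:
  assumes "0 < s" "0 < r"
  shows "mean r a s = mean (r / root n s) (a / root n s) 1 / root n s"
proof -
  define c where "c = root n s"
  have c: "0 < c" "s = c ^ n" using assms n_pos by (simp_all add: c_def)
  have "mean_transform r a s = mean_transform (r / c) (a / c) 1"
    unfolding mean_transform_def using c by (simp add: power_mult_distrib power_divide mult.commute)
  then have "complex_of_real (r * sqrt (2 * pi) * mean r a s) = of_real (r / c * sqrt (2 * pi) * mean (r / c) (a / c) 1)"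
    using mean_eq[OF assms] mean_eq[of 1 "r / c"] c assms by simp
  then have "r * sqrt (2 * pi) * mean r a s = r / c * sqrt (2 * pi) * mean (r / c) (a / c) 1"
    by (simp only: of_real_eq_iff)
  then show ?thesis using assms c(1) by (simp add: c_def field_simps)
qed

text \<open>Scaling reduces every time to time 1, where averaging does not exceed the supremum of
  |u|. Hence the constant is independent of the variance and the centre, as domination for r tending
  to 0 requires.\<close>

lemma mean_bound: "\<exists>C\<ge>0. \<forall>r>0. \<forall>a. \<forall>s>0. \<bar>mean r a s\<bar> \<le> C * (1 + 1 / s)"
proof -
  obtain C where C: "\<And>x. \<bar>u x 1\<bar> \<le> C" using space_bound[of 1] by auto
  have "0 \<le> C" using C[of 0] by linarith
  moreover have "\<bar>mean r a s\<bar> \<le> C * (1 + 1 / s)" if "0 < r" "0 < s" for r a s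
  proof -
    have m: "\<bar>mean (r / root n s) (a / root n s) 1\<bar> \<le> C"
      unfolding mean_def by (intro abs_gaussian_mean_le borel_measurable_continuous_onI cont_space C) simp
    have "\<bar>mean r a s\<bar> = \<bar>mean (r / root n s) (a / root n s) 1\<bar> * (1 / root n s)"
      using that n_pos by (subst mean_scaling) (auto simp: abs_mult)
    also have "\<dots> \<le> C * (1 + 1 / s)"
      using m \<open>0 \<le> C\<close> inverse_root_le[OF n_pos that(2)] that n_pos by (intro mult_mono) auto
    finally show ?thesis .
  qed
  ultimately show ?thesis by blast
qed

lemma mean_tendsto: "0 < s \<Longrightarrow> ((\<lambda>r. mean r a s) \<longlongrightarrow> u a s) (at_right 0)"
  unfolding mean_def using space_bound[of s] gaussian_mean_tendsto[OF cont_space[of s]] by blast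

lemma borel_measurable_mean_transform [measurable]: "mean_transform r a \<in> borel_measurable borel"
proof -
  interpret N: prob_space gauss by (rule prob_space_std_normal)
  show ?thesis unfolding mean_transform_def[abs_def] by measurable
qed

text \<open>With u replaced by its Gaussian mean, the integrals over s and frequency may be
  exchanged, giving the inverse Fourier integral of \<Psi> damped by a Gaussian. Then r tends to 0
  on both sides, dominated by C (|g| + |g / s|) in time and by |\<Psi>| in frequency.\<close>

lemma subordinated_density_inversion:
  assumes [measurable]: "g \<in> borel_measurable borel" and g: "integrable lborel g"
    and g_inv: "integrable lborel (\<lambda>s. g s / s)"
    and \<Psi>: "integrable lborel (\<lambda>v. LBINT s:{0<..}. exp (- (\<i> * of_real (s * v ^ n))) * of_real (g s))" (is "integrable _ ?\<Psi>")
  shows "of_real (LBINT s:{0<..}. u a s * g s) = (LBINT v. ?\<Psi> v * cis (- (v * a))) / (2 * pi)"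
proof (rule tendsto_unique[OF trivial_limit_at_right_real[of 0]])
  interpret N: prob_space gauss by (rule prob_space_std_normal)
  interpret P: pair_sigma_finite gauss lborel ..
  let ?I = "\<lambda>r v. complex_of_real (exp (- (r * v)\<^sup>2 / 2)) * (?\<Psi> v * cis (- (v * a)))"
  have \<Psi>m [measurable]: "?\<Psi> \<in> borel_measurable borel"
    using borel_measurable_integrable[OF \<Psi>] by simp
  \<comment> \<open>Continuity of u in each variable separately does not directly make the mean
    measurable in s; its frequency side does.\<close>
  have meas_mean: "(\<lambda>s. indicator {0<..} s *\<^sub>R (mean r a s * g s)) \<in> borel_measurable borel" if "0 < r" for r
  proof -
    have "(\<lambda>s. indicator {0<..} s *\<^sub>R (Re (mean_transform r a s) / (r * sqrt (2 * pi)) * g s)) \<in> borel_measurable borel"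
      by measurable
    also have "(\<lambda>s. indicator {0<..} s *\<^sub>R (Re (mean_transform r a s) / (r * sqrt (2 * pi)) * g s))
      = (\<lambda>s. indicator {0<..} s *\<^sub>R (mean r a s * g s))"
      using that by (auto simp: fun_eq_iff indicator_def simp flip: mean_eq)
    finally show ?thesis .
  qed
  obtain C where C: "0 \<le> C" "\<And>r a s. 0 < r \<Longrightarrow> 0 < s \<Longrightarrow> \<bar>mean r a s\<bar> \<le> C * (1 + 1 / s)"
    using mean_bound by blast
  have lim1: "((\<lambda>r. LBINT s:{0<..}. mean r a s * g s) \<longlongrightarrow> (LBINT s:{0<..}. u a s * g s)) (at_right 0)"
    unfolding set_lebesgue_integral_def
  proof (rule integral_dominated_convergence_at_within)
    show "(\<lambda>s. indicator {0<..} s *\<^sub>R (u a s * g s)) \<in> borel_measurable lborel"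
      using borel_measurable_times[OF borel_measurable_continuous_on_indicator[OF _ cont_time[of a]], of g] by (simp add: mult.assoc)
    show "integrable lborel (\<lambda>s. C * (\<bar>g s\<bar> + \<bar>g s / s\<bar>))"
      using g g_inv by (intro integrable_mult_right Bochner_Integration.integrable_add integrable_abs)
    fix r :: real assume "r \<in> {0<..}"
    then have r: "0 < r" by simp
    show "AE s in lborel. norm (indicator {0<..} s *\<^sub>R (mean r a s * g s)) \<le> C * (\<bar>g s\<bar> + \<bar>g s / s\<bar>)"
    proof (rule AE_I2)
      fix s :: real
      show "norm (indicator {0<..} s *\<^sub>R (mean r a s * g s)) \<le> C * (\<bar>g s\<bar> + \<bar>g s / s\<bar>)"
      proof (cases "0 < s")
        case True
        then have "\<bar>mean r a s\<bar> * \<bar>g s\<bar> \<le> C * (1 + 1 / s) * \<bar>g s\<bar>"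
          using C(2)[OF r] by (intro mult_right_mono) auto
        then show ?thesis using True by (simp add: abs_mult algebra_simps)
      qed (use C(1) in \<open>simp add: mult_nonneg_nonneg del: abs_divide\<close>)
    qed
  next
    show "AE s in lborel. ((\<lambda>r. indicator {0<..} s *\<^sub>R (mean r a s * g s)) \<longlongrightarrow> indicator {0<..} s *\<^sub>R (u a s * g s)) (at_right 0)"
    proof (rule AE_I2)
      fix s :: real
      show "((\<lambda>r. indicator {0<..} s *\<^sub>R (mean r a s * g s)) \<longlongrightarrow> indicator {0<..} s *\<^sub>R (u a s * g s)) (at_right 0)"
        by (cases "0 < s") (auto intro!: tendsto_mult_right mean_tendsto)
    qed
  qed (use meas_mean in auto)
  show "((\<lambda>r. of_real (LBINT s:{0<..}. mean r a s * g s)) \<longlongrightarrow> complex_of_real (LBINT s:{0<..}. u a s * g s)) (at_right 0)"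
    by (rule tendsto_of_real[OF lim1])
  have eq: "complex_of_real (LBINT s:{0<..}. mean r a s * g s)
      = (LBINT v. ?I r v) / (2 * pi)" if r: "0 < r" for r
  proof -
    define G where "G w s = exp (- (\<i> * of_real (s * (w / r) ^ n))) * cis (- (w * a / r)) * (indicator {0<..} s *\<^sub>R complex_of_real (g s))" for w s
    have iG: "integrable (gauss \<Otimes>\<^sub>M lborel) (case_prod G)"
    proof (rule P.integrable_product_bound)
      show "integrable lborel (\<lambda>s. \<bar>g s\<bar>)" using g by simp
      show "integrable gauss (\<lambda>_. 1::real)" by simp
      show "case_prod G \<in> borel_measurable (gauss \<Otimes>\<^sub>M lborel)"
        unfolding G_def[abs_def] by measurable
      show "norm (G w s) \<le> 1 * \<bar>g s\<bar>" for w s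
        by (simp add: G_def norm_mult indicator_def)
    qed
    have "of_real (r * sqrt (2 * pi)) * complex_of_real (LBINT s:{0<..}. mean r a s * g s)
       = (LBINT s. of_real (r * sqrt (2 * pi)) * of_real (indicator {0<..} s * (mean r a s * g s)))"
      unfolding set_lebesgue_integral_def integral_mult_right_zero integral_complex_of_real by simp
    also have "\<dots> = (LBINT s. (\<integral>w. G w s \<partial>gauss))"
    proof (rule Bochner_Integration.integral_cong[OF refl])
      fix s
      show "of_real (r * sqrt (2 * pi)) * of_real (indicator {0<..} s * (mean r a s * g s)) = (\<integral>w. G w s \<partial>gauss)"
      proof (cases "0 < s")
        case True
        have "(\<integral>w. G w s \<partial>gauss) = mean_transform r a s * of_real (g s)"
          unfolding G_def integral_mult_left_zero mean_transform_def using True by simp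
        then show ?thesis using True by (simp flip: mean_eq[OF True r])
      qed (simp add: G_def)
    qed
    also have "\<dots> = (\<integral>w. (LBINT s. G w s) \<partial>gauss)"
      by (rule P.Fubini_integral[OF iG])
    also have "\<dots> = (\<integral>w. ?\<Psi> (w / r) * cis (- (w * a / r)) \<partial>gauss)"
    proof (rule Bochner_Integration.integral_cong[OF refl])
      fix w
      have "(LBINT s. G w s) = (LBINT s. indicator {0<..} s *\<^sub>R (exp (- (\<i> * of_real (s * (w / r) ^ n))) * of_real (g s)) * cis (- (w * a / r)))"
        by (rule Bochner_Integration.integral_cong) (auto simp: G_def indicator_def)
      then show "(LBINT s. G w s) = ?\<Psi> (w / r) * cis (- (w * a / r))"
        by (simp only: integral_mult_left_zero set_lebesgue_integral_def)
    qed
    also have "\<dots> = (LBINT w. std_normal_density w *\<^sub>R (?\<Psi> (w / r) * cis (- (w * a / r))))"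
    proof (rule integral_density)
      have "(\<lambda>w. ?\<Psi> (w / r)) \<in> borel_measurable borel"
        by (rule measurable_compose[OF _ \<Psi>m]) measurable
      from borel_measurable_times[OF this, of "\<lambda>w. cis (- (w * a / r))"]
      show "(\<lambda>w. ?\<Psi> (w / r) * cis (- (w * a / r))) \<in> borel_measurable lborel"
        unfolding measurable_lborel1 by measurable
    qed auto
    also have "\<dots> = r *\<^sub>R (LBINT v. std_normal_density (r * v) *\<^sub>R (?\<Psi> v * cis (- (v * a))))"
      using lborel_integral_real_affine[of r "\<lambda>w. std_normal_density w *\<^sub>R (?\<Psi> (w / r) * cis (- (w * a / r)))" 0] r by simp
    also have "(LBINT v. std_normal_density (r * v) *\<^sub>R (?\<Psi> v * cis (- (v * a))))
        = of_real (1 / sqrt (2 * pi)) * (LBINT v. ?I r v)"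
      unfolding integral_mult_right_zero[symmetric] std_normal_density_def
      by (intro Bochner_Integration.integral_cong) (simp_all add: scaleR_conv_of_real mult.assoc)
    finally have "of_real (r * sqrt (2 * pi)) * complex_of_real (LBINT s:{0<..}. mean r a s * g s)
       = r *\<^sub>R (of_real (1 / sqrt (2 * pi)) * (LBINT v. ?I r v))" .
    \<comment> \<open>One square root of 2 pi comes from Parseval's formula and the other from the
      normal density; together they form the constant of Fourier inversion.\<close>
    moreover have "a = b / (2 * pi)" if "of_real (r * sqrt (2 * pi)) * a = r *\<^sub>R (of_real (1 / sqrt (2 * pi)) * b)" for a b :: complex
    proof -
      have "of_real (sqrt (2 * pi)) * a = of_real (1 / sqrt (2 * pi)) * b"
        using that r mult_left_cancel[of "complex_of_real r" "of_real (sqrt (2 * pi)) * a" "of_real (1 / sqrt (2 * pi)) * b"]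
        by (simp add: scaleR_conv_of_real mult.assoc)
      moreover have sq: "complex_of_real (sqrt (2 * pi)) * of_real (sqrt (2 * pi)) = of_real (2 * pi)"
        unfolding of_real_mult[symmetric] by simp
      moreover have "x * a = inverse x * b \<Longrightarrow> x \<noteq> 0 \<Longrightarrow> x * x * a = b" for x :: complex
        by (simp add: field_simps)
      ultimately have "of_real (2 * pi) * a = b"
        unfolding sq[symmetric] by (simp add: inverse_eq_divide)
      then show ?thesis by (simp add: field_simps)
    qed
    ultimately show ?thesis by blast
  qed
  have lim2: "((\<lambda>r. LBINT v. ?I r v) \<longlongrightarrow> (LBINT v. ?\<Psi> v * cis (- (v * a)))) (at_right 0)"
  proof (rule integral_dominated_convergence_at_within)
    show "integrable lborel (\<lambda>v. norm (?\<Psi> v))" using \<Psi> by (rule integrable_norm)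
    show "AE v in lborel. norm (?I r v) \<le> norm (?\<Psi> v)" for r :: real
      by (intro AE_I2) (simp add: norm_mult mult_left_le_one_le)
    show "AE v in lborel. ((\<lambda>r. ?I r v) \<longlongrightarrow> ?\<Psi> v * cis (- (v * a))) (at_right 0)"
    proof (rule AE_I2)
      fix v :: real
      have "((\<lambda>r. ?I r v) \<longlongrightarrow> of_real (exp (- (0 * v)\<^sup>2 / 2)) * (?\<Psi> v * cis (- (v * a)))) (at_right 0)"
        by (intro tendsto_intros) auto
      then show "((\<lambda>r. ?I r v) \<longlongrightarrow> ?\<Psi> v * cis (- (v * a))) (at_right 0)"
        by simp
    qed
  qed measurable
  show "((\<lambda>r. of_real (LBINT s:{0<..}. mean r a s * g s)) \<longlongrightarrow> (LBINT v. ?\<Psi> v * cis (- (v * a))) / (2 * pi)) (at_right 0)"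
    by (rule Lim_transform_eventually[OF tendsto_divide[OF lim2 tendsto_const]])
       (auto simp: eventually_at_right_field eq intro!: exI[of _ 1])
qed

end

section \<open>Pointwise Fourier inversion\<close>

text \<open>The conclusion of the Riemann-Lebesgue lemma as a predicate, so that it can be carried
  through inductions on sets and on integrable functions.\<close>

definition fourier_vanishes :: "(real \<Rightarrow> complex) \<Rightarrow> bool" where
  "fourier_vanishes f \<longleftrightarrow> ((\<lambda>b. LBINT x. f x * cis (b * x)) \<longlongrightarrow> 0) at_infinity"

lemma integrable_mult_cis:
  assumes "integrable lborel f"
  shows "integrable lborel (\<lambda>x. f x * cis (b * x))"
  using assms by (rule Bochner_Integration.integrable_bound) (use assms in \<open>auto simp: norm_mult\<close>)

text \<open>Two transforms differ by at most the L1 distance of the functions, uniformly in b, and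
  that distance tends to 0 by domination.\<close>

lemma fourier_vanishes_limit:
  assumes s: "\<And>i. integrable lborel (s i)" "\<And>i. fourier_vanishes (s i)"
    and [measurable]: "f \<in> borel_measurable borel" and w: "integrable lborel w"
    and bound: "\<And>i x. norm (s i x) \<le> w x" and lim: "\<And>x. (\<lambda>i. s i x) \<longlonglongrightarrow> f x"
  shows "fourier_vanishes f"
  unfolding fourier_vanishes_def
proof (rule tendstoI)
  fix e :: real assume "0 < e"
  have fw: "norm (f x) \<le> w x" for x
    using bound by (intro Lim_bounded[OF tendsto_norm[OF lim]]) auto
  have f: "integrable lborel f"
    by (rule Bochner_Integration.integrable_bound[OF w]) (auto intro!: AE_I2 order_trans[OF fw abs_ge_self])
  have "(\<lambda>i. LBINT x. norm (s i x - f x)) \<longlonglongrightarrow> (LBINT x::real. 0)"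
  proof (rule integral_dominated_convergence)
    show "integrable lborel (\<lambda>x. 2 * w x)" using w by simp
    show "AE x in lborel. norm (norm (s i x - f x)) \<le> 2 * w x" for i
    proof (rule AE_I2)
      fix x
      show "norm (norm (s i x - f x)) \<le> 2 * w x"
        using norm_triangle_ineq4[of "s i x" "f x"] bound[of i x] fw[of x] by simp
    qed
    show "AE x in lborel. (\<lambda>i. norm (s i x - f x)) \<longlonglongrightarrow> 0"
      using lim by (intro AE_I2) (simp add: tendsto_norm_zero_iff LIM_zero)
  qed (use s(1) in auto)
  then have "\<forall>\<^sub>F i in sequentially. (LBINT x. norm (s i x - f x)) < e / 2"
    using \<open>0 < e\<close> by (intro order_tendstoD(2)[where y = "LBINT x::real. 0"]) auto
  then obtain i where i: "(LBINT x. norm (s i x - f x)) < e / 2"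
    unfolding eventually_sequentially by blast
  have "\<forall>\<^sub>F b in at_infinity. norm (LBINT x. s i x * cis (b * x)) < e / 2"
    using tendstoD[OF s(2)[of i, unfolded fourier_vanishes_def], of "e/2"] \<open>0 < e\<close> by simp
  then show "\<forall>\<^sub>F b in at_infinity. dist (LBINT x. f x * cis (b * x)) 0 < e"
  proof eventually_elim
    case (elim b)
    have "(LBINT x. s i x * cis (b * x)) - (LBINT x. f x * cis (b * x)) = (LBINT x. (s i x - f x) * cis (b * x))"
      using integrable_mult_cis[OF s(1), of i b] integrable_mult_cis[OF f, of b] by (simp add: left_diff_distrib)
    also have "norm \<dots> \<le> (LBINT x. norm ((s i x - f x) * cis (b * x)))" by (rule integral_norm_bound)
    also have "\<dots> < e / 2" using i by (simp add: norm_mult)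
    finally show ?case
      using elim norm_triangle_ineq2[of "LBINT x. f x * cis (b * x)" "LBINT x. s i x * cis (b * x)"]
      by (simp add: norm_minus_commute)
  qed
qed

lemma fourier_vanishes_add:
  assumes "integrable lborel f" "integrable lborel g" "fourier_vanishes f" "fourier_vanishes g"
  shows "fourier_vanishes (\<lambda>x. f x + g x)"
  using tendsto_add[OF assms(3,4)[unfolded fourier_vanishes_def]] integrable_mult_cis[OF assms(1)] integrable_mult_cis[OF assms(2)]
  by (simp add: fourier_vanishes_def distrib_right)

lemma fourier_vanishes_cmult: "fourier_vanishes f \<Longrightarrow> fourier_vanishes (\<lambda>x. c * f x)"
  unfolding fourier_vanishes_def mult.assoc integral_mult_right_zero by (rule tendsto_mult_right_zero)

lemma integral_cis_Icc:
  assumes "\<alpha> \<le> \<beta>" "b \<noteq> 0"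
  shows "(LBINT x:{\<alpha>..\<beta>}. cis (b * x)) = (cis (b * \<beta>) - cis (b * \<alpha>)) / (\<i> * of_real b)"
proof -
  have "(LBINT x:{\<alpha>..\<beta>}. cis (b * x)) = (LBINT x. indicator {\<alpha>..\<beta>} x *\<^sub>R cis (b * x))"
    by (simp add: set_lebesgue_integral_def)
  also have "\<dots> = cis (b * \<beta>) / (\<i> * of_real b) - cis (b * \<alpha>) / (\<i> * of_real b)"
  proof (rule integral_FTC_atLeastAtMost[OF assms(1)])
    show "continuous_on {\<alpha>..\<beta>} (\<lambda>x. cis (b * x))" by (intro continuous_intros)
    fix x
    have "((\<lambda>x. exp (\<i> * of_real b * of_real x) / (\<i> * of_real b)) has_vector_derivative exp (\<i> * of_real b * of_real x)) (at x within {\<alpha>..\<beta>})"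
      by (rule has_vector_derivative_real_field) (use assms in \<open>auto intro!: derivative_eq_intros\<close>)
    then show "((\<lambda>x. cis (b * x) / (\<i> * of_real b)) has_vector_derivative cis (b * x)) (at x within {\<alpha>..\<beta>})"
      by (simp add: cis_conv_exp mult.assoc)
  qed
  finally show ?thesis by (simp add: diff_divide_distrib)
qed

lemma fourier_vanishes_Icc: "fourier_vanishes (\<lambda>x. of_real (indicator {\<alpha>..\<beta>} x))"
proof (cases "\<alpha> \<le> \<beta>")
  case True
  show ?thesis unfolding fourier_vanishes_def
  proof (rule Lim_null_comparison)
    show "((\<lambda>b::real. 2 / \<bar>b\<bar>) \<longlongrightarrow> 0) at_infinity"
      using tendsto_mult_right_zero[OF tendsto_norm_zero[OF tendsto_inverse_0[where 'a = real]], of 2]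
      by (simp add: divide_inverse)
    show "\<forall>\<^sub>F b in at_infinity. norm (LBINT x. of_real (indicator {\<alpha>..\<beta>} x) * cis (b * x)) \<le> 2 / \<bar>b\<bar>"
    proof (rule eventually_mono)
      show "\<forall>\<^sub>F b::real in at_infinity. b \<noteq> 0" by (rule eventually_not_equal_at_infinity)
      fix b :: real assume "b \<noteq> 0"
      have "(LBINT x. of_real (indicator {\<alpha>..\<beta>} x) * cis (b * x)) = (cis (b * \<beta>) - cis (b * \<alpha>)) / (\<i> * of_real b)"
        using integral_cis_Icc[OF True \<open>b \<noteq> 0\<close>] by (simp add: set_lebesgue_integral_def scaleR_conv_of_real)
      also have "norm \<dots> \<le> 2 / \<bar>b\<bar>"
        using norm_triangle_ineq4[of "cis (b * \<beta>)" "cis (b * \<alpha>)"]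
        by (auto simp: norm_divide norm_mult intro!: divide_right_mono)
      finally show "norm (LBINT x. of_real (indicator {\<alpha>..\<beta>} x) * cis (b * x)) \<le> 2 / \<bar>b\<bar>" .
    qed
  qed
qed (simp add: fourier_vanishes_def)

lemma integrable_indicator_Icc:
  assumes "A \<in> sets borel"
  shows "integrable lborel (\<lambda>x::real. complex_of_real (indicator (A \<inter> {-R..R}) x))"
proof (rule integrable_of_real, rule integrable_real_indicator)
  have "emeasure lborel (A \<inter> {-R..R}) \<le> emeasure lborel {-R..R}" by (intro emeasure_mono) auto
  also have "\<dots> < \<infinity>" by (simp add: emeasure_lborel_Icc_eq)
  finally show "emeasure lborel (A \<inter> {-R..R}) < \<infinity>" .
qed (use assms in simp)

text \<open>A Dynkin argument starting from half-lines. Intersecting with a fixed interval keeps all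
  indicators integrable, so complements become differences and disjoint unions become dominated
  limits of finite sums.\<close>

lemma fourier_vanishes_bounded_set:
  assumes "A \<in> sets borel"
  shows "fourier_vanishes (\<lambda>x. of_real (indicator (A \<inter> {-R..R}) x))"
proof -
  have A: "A \<in> sigma_sets UNIV (range (\<lambda>a::real. {..a}))"
    using assms by (simp add: borel_eq_atMost)
  have Int: "Int_stable (range (\<lambda>a::real. {..a}))"
    by (auto simp: Int_stable_def)
  have sub: "range (\<lambda>a::real. {..a}) \<subseteq> Pow UNIV" by simp
  have borel: "B \<in> sets borel" if "B \<in> sigma_sets UNIV (range (\<lambda>a::real. {..a}))" for B
    using that by (simp add: borel_eq_atMost)
  show ?thesis using A
  proof (induction rule: sigma_sets_induct_disjoint[OF Int sub, consumes 1, case_names basic empty compl union])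
    case (basic B)
    then obtain a where "B = {..a}" by auto
    then have "B \<inter> {-R..R} = {-R..min a R}" by auto
    then show ?case using fourier_vanishes_Icc[of "-R" "min a R"] by simp
  next
    case empty
    then show ?case by (simp add: fourier_vanishes_def)
  next
    case (compl B)
    have "fourier_vanishes (\<lambda>x. of_real (indicator {-R..R} x) + (-1) * of_real (indicator (B \<inter> {-R..R}) x))"
      using integrable_indicator_Icc[of UNIV R] integrable_indicator_Icc[OF borel[OF compl(1)], of R]
      by (intro fourier_vanishes_add fourier_vanishes_cmult fourier_vanishes_Icc compl) (simp_all del: of_real_indicator)
    also have "(\<lambda>x. complex_of_real (indicator {-R..R} x) + (-1) * of_real (indicator (B \<inter> {-R..R}) x)) = (\<lambda>x. of_real (indicator ((UNIV - B) \<inter> {-R..R}) x))"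
      by (auto simp: fun_eq_iff indicator_def)
    finally show ?case .
  next
    case (union B)
    have B: "B i \<in> sets borel" for i using union(2) borel by auto
    let ?s = "\<lambda>m x. complex_of_real (indicator ((\<Union>i<m. B i) \<inter> {-R..R}) x)"
    show ?case
    proof (rule fourier_vanishes_limit)
      show "integrable lborel (?s m)" for m by (intro integrable_indicator_Icc) (use B in auto)
      show "fourier_vanishes (?s m)" for m
      proof (induction m)
        case (Suc m)
        have "fourier_vanishes (\<lambda>x. ?s m x + of_real (indicator (B m \<inter> {-R..R}) x))"
          by (intro fourier_vanishes_add Suc integrable_indicator_Icc union(3)) (use B in auto)
        also have "(\<lambda>x. ?s m x + of_real (indicator (B m \<inter> {-R..R}) x)) = ?s (Suc m)"
        proof
          fix x
          have "x \<notin> B i" if "x \<in> B m" "i < m" for i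
            using union(1) that unfolding disjoint_family_on_def by (metis UNIV_I disjoint_iff less_irrefl)
          then show "?s m x + of_real (indicator (B m \<inter> {-R..R}) x) = ?s (Suc m) x"
            by (auto simp: indicator_def less_Suc_eq)
        qed
        finally show ?case .
      qed (simp add: fourier_vanishes_def)
      show "integrable lborel (\<lambda>x::real. indicator {-R..R} x :: real)"
        by (intro integrable_real_indicator) (auto simp: emeasure_lborel_Icc_eq)
      show "norm (?s m x) \<le> indicator {-R..R} x" for m x by (auto simp: indicator_def)
      show "(\<lambda>m. ?s m x) \<longlonglongrightarrow> of_real (indicator ((\<Union>i. B i) \<inter> {-R..R}) x)" for x
      proof (cases "x \<in> (\<Union>i. B i)")
        case True
        then obtain i where "x \<in> B i" by blast
        then have "?s m x = of_real (indicator ((\<Union>i. B i) \<inter> {-R..R}) x)" if "Suc i \<le> m" for m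
          using that by (auto simp: indicator_def)
        then show ?thesis by (intro tendsto_eventually) (auto simp: eventually_sequentially)
      next
        case False
        then have "?s m x = of_real (indicator ((\<Union>i. B i) \<inter> {-R..R}) x)" for m
          by (auto simp: indicator_def)
        then show ?thesis by simp
      qed
    qed (use B in measurable)
  qed
qed

text \<open>Indicators of sets of finite measure are first cut to [-m, m], where
  \<open>fourier_vanishes_bounded_set\<close> applies; sums and dominated limits then reach all
  integrable functions.\<close>

theorem Riemann_Lebesgue:
  assumes "integrable lborel f"
  shows "((\<lambda>b. LBINT x. f x * cis (b * x)) \<longlongrightarrow> 0) at_infinity"
proof -
  have "fourier_vanishes f"
    using assms
  proof (induction rule: integrable_induct)
    case (base A c)
    let ?s = "\<lambda>m::nat. \<lambda>x. complex_of_real (indicator (A \<inter> {-real m..real m}) x)"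
    have A: "A \<in> sets borel" using base by simp
    have "fourier_vanishes (\<lambda>x. of_real (indicator A x))"
    proof (rule fourier_vanishes_limit)
      show "integrable lborel (?s m)" "fourier_vanishes (?s m)" for m
        by (intro integrable_indicator_Icc fourier_vanishes_bounded_set A)+
      show "integrable lborel (\<lambda>x. indicator A x :: real)" using base by (intro integrable_real_indicator) auto
      show "(\<lambda>m. ?s m x) \<longlonglongrightarrow> of_real (indicator A x)" for x
      proof (rule tendsto_eventually)
        have "?s m x = of_real (indicator A x)" if "nat \<lceil>\<bar>x\<bar>\<rceil> \<le> m" for m
          using that by (auto simp: indicator_def)
        then show "\<forall>\<^sub>F m in sequentially. ?s m x = of_real (indicator A x)"
          unfolding eventually_sequentially by blast
      qed
    qed (use A in \<open>auto simp: indicator_def\<close>)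
    then show ?case
      using fourier_vanishes_cmult[of _ c] by (simp add: scaleR_conv_of_real mult.commute)
  next
    case (add f g)
    then show ?case by (intro fourier_vanishes_add)
  next
    case (lim f s)
    show ?case
      by (rule fourier_vanishes_limit[of s f "\<lambda>x. 2 * norm (f x)"]) (use lim in auto)
  qed
  then show ?thesis by (simp add: fourier_vanishes_def)
qed

section \<open>Dini's test\<close>

lemma Si_at_bot: "(Si \<longlongrightarrow> - (pi / 2)) at_bot"
proof -
  have "((\<lambda>x. Si (- x)) \<longlongrightarrow> - (pi / 2)) at_top"
    by (rule Lim_transform_eventually[OF tendsto_minus[OF Si_at_top]])
       (auto simp: Si_neg intro!: eventually_at_top_linorderI[of 0])
  then show ?thesis by (simp add: filterlim_at_bot_mirror)
qed

lemma integral_cis_symmetric: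
  assumes "0 < d"
  shows "(LBINT v:{-d..d}. cis (v * x)) = of_real (2 * d * sinc (d * x))"
proof (cases "x = 0")
  case True
  then show ?thesis using assms by (simp add: set_lebesgue_integral_def scaleR_conv_of_real)
next
  case False
  have "(LBINT v:{-d..d}. cis (v * x)) = (LBINT v:{-d..d}. cis (x * v))" by (simp add: mult.commute)
  also have "\<dots> = (cis (x * d) - cis (x * (-d))) / (\<i> * of_real x)"
    using integral_cis_Icc[of "-d" d x] assms False by simp
  also have "\<dots> = of_real (2 * d * sinc (d * x))"
    using False assms by (simp add: complex_eq_iff Re_divide Im_divide power2_eq_square mult.commute)
  finally show ?thesis .
qed

lemma integral_Si_scaled:
  assumes "a \<le> b" "0 < d"
  shows "(LBINT x:{a..b}. complex_of_real (2 * d * sinc (d * x))) = of_real (2 * (Si (d * b) - Si (d * a)))"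
proof -
  have "(LBINT x:{a..b}. complex_of_real (2 * d * sinc (d * x))) = (LBINT x. indicator {a..b} x *\<^sub>R complex_of_real (2 * d * sinc (d * x)))"
    by (simp only: set_lebesgue_integral_def)
  also have "\<dots> = complex_of_real (2 * Si (d * b)) - of_real (2 * Si (d * a))"
  proof (rule integral_FTC_atLeastAtMost[OF assms(1)])
    show "continuous_on {a..b} (\<lambda>x. complex_of_real (2 * d * sinc (d * x)))" by (intro continuous_intros)
    fix x
    have "((\<lambda>x. Si (d * x)) has_real_derivative sinc (d * x) * d) (at x within {a..b})"
      by (rule DERIV_chain2[OF DERIV_Si]) (auto intro!: derivative_eq_intros)
    then have "((\<lambda>x. 2 * Si (d * x)) has_real_derivative 2 * d * sinc (d * x)) (at x within {a..b})"
      using DERIV_cmult[of "\<lambda>x. Si (d * x)" "sinc (d * x) * d" x "{a..b}" 2] by (simp add: mult_ac)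
    then show "((\<lambda>x. complex_of_real (2 * Si (d * x))) has_vector_derivative complex_of_real (2 * d * sinc (d * x))) (at x within {a..b})"
      by (intro has_vector_derivative_of_real) (simp add: has_real_derivative_iff_has_vector_derivative)
  qed
  finally show ?thesis by simp
qed

text \<open>After translation to \<xi>, split off the constant \<Psi> \<xi> on [-d, d]. That part
  integrates to sine integrals, with total 2 pi. Dini's condition makes the rest divided by v
  integrable, so its contribution consists of values of a Fourier transform at the endpoints, which
  vanish by Riemann-Lebesgue.\<close>

theorem fourier_inversion_Dini:
  fixes \<Psi> :: "real \<Rightarrow> complex"
  assumes \<Psi>: "integrable lborel \<Psi>" and "0 < d"
    and Dini: "set_integrable lborel {-d..d} (\<lambda>v. (\<Psi> (\<xi> - v) - \<Psi> \<xi>) / of_real v)"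
  shows "((\<lambda>x. cis (\<xi> * x) * ((LBINT v. \<Psi> v * cis (- (v * x))) / (2 * pi))) has_integral \<Psi> \<xi>) UNIV"
proof -
  have [measurable]: "\<Psi> \<in> borel_measurable borel" using borel_measurable_integrable[OF \<Psi>] by simp
  define W where "W x = (LBINT v. \<Psi> v * cis (- (v * x)))" for x
  define g where "g v = \<Psi> (\<xi> - v) - \<Psi> \<xi> * of_real (indicator {-d..d} v)" for v
  have shift: "integrable lborel (\<lambda>v. \<Psi> (\<xi> - v))"
    using lborel_integrable_real_affine[OF \<Psi>, of "-1" \<xi>] by simp
  have ind: "integrable lborel (\<lambda>v. \<Psi> \<xi> * of_real (indicator {-d..d} v))"
    using integrable_indicator_Icc[of UNIV d] by (intro integrable_mult_right) simp
  have g: "integrable lborel g" unfolding g_def by (intro Bochner_Integration.integrable_diff shift ind)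
  have [measurable]: "g \<in> borel_measurable borel" using borel_measurable_integrable[OF g] by simp
  \<comment> \<open>Division by i v comes from integrating cis (v x) over x. It is controlled by
    Dini's condition on [-d, d] and by |v| \<ge> d outside.\<close>
  define G where "G v = g v / (\<i> * of_real v)" for v
  have G: "integrable lborel G"
  proof (rule Bochner_Integration.integrable_bound)
    show "integrable lborel (\<lambda>v. norm (indicator {-d..d} v *\<^sub>R ((\<Psi> (\<xi> - v) - \<Psi> \<xi>) / of_real v)) + norm (\<Psi> (\<xi> - v)) / d)"
      using Dini shift \<open>0 < d\<close> by (intro Bochner_Integration.integrable_add integrable_norm integrable_divide) (auto simp: set_integrable_def)
    show "AE v in lborel. norm (G v) \<le> norm (norm (indicator {-d..d} v *\<^sub>R ((\<Psi> (\<xi> - v) - \<Psi> \<xi>) / of_real v)) + norm (\<Psi> (\<xi> - v)) / d)"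
    proof (rule AE_I2)
      fix v :: real
      show "norm (G v) \<le> norm (norm (indicator {-d..d} v *\<^sub>R ((\<Psi> (\<xi> - v) - \<Psi> \<xi>) / of_real v)) + norm (\<Psi> (\<xi> - v)) / d)"
      proof (cases "v \<in> {-d..d}")
        case True
        then show ?thesis using \<open>0 < d\<close> by (simp add: G_def g_def norm_divide norm_mult)
      next
        case False
        then have "d \<le> \<bar>v\<bar>" using \<open>0 < d\<close> by auto
        then have "norm (\<Psi> (\<xi> - v)) / \<bar>v\<bar> \<le> norm (\<Psi> (\<xi> - v)) / d"
          using \<open>0 < d\<close> by (intro divide_left_mono mult_pos_pos) auto
        then show ?thesis using False \<open>0 < d\<close> by (simp add: G_def g_def norm_divide norm_mult)
      qed
    qed
  qed (simp add: G_def[abs_def])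
  define R where "R b = (LBINT v. G v * cis (b * v))" for b
  have split: "cis (\<xi> * x) * W x = (LBINT v. g v * cis (v * x)) + \<Psi> \<xi> * of_real (2 * d * sinc (d * x))" for x
  proof -
    have "W x = (LBINT v. \<Psi> (\<xi> - v) * cis (- ((\<xi> - v) * x)))"
      unfolding W_def using lborel_integral_real_affine[of "-1" "\<lambda>v. \<Psi> v * cis (- (v * x))" \<xi>] by simp
    then have "cis (\<xi> * x) * W x = (LBINT v. cis (\<xi> * x) * (\<Psi> (\<xi> - v) * cis (- ((\<xi> - v) * x))))"
      by (simp only: integral_mult_right_zero)
    also have "\<dots> = (LBINT v. g v * cis (v * x) + \<Psi> \<xi> * (indicator {-d..d} v *\<^sub>R cis (v * x)))"
    proof (rule Bochner_Integration.integral_cong[OF refl])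
      fix v
      have "cis (\<xi> * x) * cis (- ((\<xi> - v) * x)) = cis (v * x)"
        unfolding cis_mult by (simp add: algebra_simps)
      then have "cis (\<xi> * x) * (\<Psi> (\<xi> - v) * cis (- ((\<xi> - v) * x))) = \<Psi> (\<xi> - v) * cis (v * x)"
        by (simp add: mult.left_commute)
      then show "cis (\<xi> * x) * (\<Psi> (\<xi> - v) * cis (- ((\<xi> - v) * x))) = g v * cis (v * x) + \<Psi> \<xi> * (indicator {-d..d} v *\<^sub>R cis (v * x))"
        by (simp add: g_def indicator_def algebra_simps)
    qed
    also have "\<dots> = (LBINT v. g v * cis (v * x)) + (LBINT v. \<Psi> \<xi> * (indicator {-d..d} v *\<^sub>R cis (v * x)))"
    proof (rule Bochner_Integration.integral_add)
      show "integrable lborel (\<lambda>v. g v * cis (v * x))"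
        using integrable_mult_cis[OF g, of x] by (simp add: mult.commute)
      show "integrable lborel (\<lambda>v. \<Psi> \<xi> * (indicator {-d..d} v *\<^sub>R cis (v * x)))"
        by (intro integrable_mult_right borel_integrable_compact continuous_intros) auto
    qed
    also have "(LBINT v. \<Psi> \<xi> * (indicator {-d..d} v *\<^sub>R cis (v * x))) = \<Psi> \<xi> * of_real (2 * d * sinc (d * x))"
      using integral_cis_symmetric[OF \<open>0 < d\<close>, of x] unfolding set_lebesgue_integral_def integral_mult_right_zero by simp
    finally show ?thesis .
  qed
  have contW: "continuous_on S (\<lambda>x. cis (\<xi> * x) * W x)" for S
  proof (intro continuous_intros continuous_at_imp_continuous_on ballI)
    fix x0
    show "isCont W x0" unfolding isCont_def W_def
    proof (rule integral_dominated_convergence_at_within)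
      show "integrable lborel (\<lambda>v. norm (\<Psi> v))" using \<Psi> by (rule integrable_norm)
      have "continuous_on UNIV (\<lambda>x. \<Psi> v * cis (- (v * x)))" for v by (intro continuous_intros)
      then show "AE v in lborel. (\<lambda>x. \<Psi> v * cis (- (v * x))) \<midarrow>x0\<rightarrow> \<Psi> v * cis (- (v * x0))"
        unfolding continuous_on_eq_continuous_at[OF open_UNIV] isCont_def by blast
    qed (auto simp: norm_mult)
  qed
  \<comment> \<open>Over a bounded interval Fubini is available because \<open>g\<close> is
    integrable. The endpoints stay separate, since the integral over the line lets them tend to
    infinity independently.\<close>
  have J: "integral {a..b} (\<lambda>x. cis (\<xi> * x) * W x) = R b - R a + \<Psi> \<xi> * of_real (2 * (Si (d * b) - Si (d * a)))" if "a \<le> b" for a b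
  proof -
    define H where "H x v = indicator {a..b} x *\<^sub>R (g v * cis (v * x))" for x v
    have iH: "integrable (lborel \<Otimes>\<^sub>M lborel) (case_prod H)"
    proof (rule lborel_pair.integrable_product_bound)
      show "norm (H x v) \<le> indicator {a..b} x * norm (g v)" for x v by (simp add: H_def norm_mult)
      show "integrable lborel (\<lambda>v. norm (g v))" using g by (rule integrable_norm)
      show "integrable lborel (\<lambda>x. indicator {a..b} x :: real)"
        by (intro integrable_real_indicator) (auto simp: emeasure_lborel_Icc_eq)
      show "case_prod H \<in> borel_measurable (lborel \<Otimes>\<^sub>M lborel)" unfolding H_def[abs_def] by measurable
    qed
    have H_int: "(LBINT v. H x v) = indicator {a..b} x *\<^sub>R (LBINT v. g v * cis (v * x))" for x
      unfolding H_def by (simp add: indicator_def)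
    have "(LBINT x:{a..b}. (LBINT v. g v * cis (v * x))) = (LBINT x. (LBINT v. H x v))"
      unfolding H_int set_lebesgue_integral_def ..
    also have "\<dots> = (LBINT v. (LBINT x. H x v))"
      by (rule lborel_pair.Fubini_integral[OF iH, symmetric])
    also have "\<dots> = (LBINT v. G v * cis (b * v) - G v * cis (a * v))"
    proof (rule integral_discrete_difference[of "{0}"])
      fix v :: real assume "v \<notin> {0}"
      have "(LBINT x. H x v) = (LBINT x. g v * (indicator {a..b} x *\<^sub>R cis (v * x)))"
        by (simp add: H_def)
      also have "\<dots> = g v * ((cis (v * b) - cis (v * a)) / (\<i> * of_real v))"
        using integral_cis_Icc[OF that, of v] \<open>v \<notin> {0}\<close> unfolding integral_mult_right_zero set_lebesgue_integral_def by simp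
      also have "\<dots> = G v * cis (b * v) - G v * cis (a * v)"
        by (simp add: G_def mult.commute diff_divide_distrib right_diff_distrib)
      finally show "(LBINT x. H x v) = G v * cis (b * v) - G v * cis (a * v)" .
    qed auto
    also have "\<dots> = R b - R a"
      unfolding R_def by (intro Bochner_Integration.integral_diff integrable_mult_cis G)
    finally have 1: "(LBINT x:{a..b}. (LBINT v. g v * cis (v * x))) = R b - R a" .
    have i1: "set_integrable lborel {a..b} (\<lambda>x. (LBINT v. g v * cis (v * x)))"
      using lborel_pair.integrable_fst'[OF iH] by (simp add: set_integrable_def H_int)
    have i2: "set_integrable lborel {a..b} (\<lambda>x. \<Psi> \<xi> * of_real (2 * d * sinc (d * x)))"
      by (intro borel_integrable_atLeastAtMost' continuous_intros)
    have "integral {a..b} (\<lambda>x. cis (\<xi> * x) * W x) = (LBINT x:{a..b}. cis (\<xi> * x) * W x)"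
      by (rule set_borel_integral_eq_integral(2)[symmetric, OF borel_integrable_atLeastAtMost'[OF contW]])
    also have "\<dots> = (LBINT x:{a..b}. (LBINT v. g v * cis (v * x))) + (LBINT x:{a..b}. \<Psi> \<xi> * of_real (2 * d * sinc (d * x)))"
      unfolding split by (rule set_integral_add(2)[OF i1 i2])
    also have "(LBINT x:{a..b}. \<Psi> \<xi> * of_real (2 * d * sinc (d * x))) = \<Psi> \<xi> * (LBINT x:{a..b}. of_real (2 * d * sinc (d * x)))"
      by (rule set_integral_mult_right)
    finally show ?thesis unfolding 1 integral_Si_scaled[OF that \<open>0 < d\<close>] .
  qed
  have R0: "(R \<longlongrightarrow> 0) at_top" "(R \<longlongrightarrow> 0) at_bot"
    using Riemann_Lebesgue[OF G] unfolding R_def[abs_def]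
    by (auto intro: tendsto_mono[OF at_top_le_at_infinity] tendsto_mono[OF at_bot_le_at_infinity])
  have Sid: "((\<lambda>b. Si (d * b)) \<longlongrightarrow> pi / 2) at_top" "((\<lambda>b. Si (d * b)) \<longlongrightarrow> - (pi / 2)) at_bot"
    using \<open>0 < d\<close>
    by (auto intro!: filterlim_compose[OF Si_at_top] filterlim_compose[OF Si_at_bot]
        filterlim_tendsto_pos_mult_at_top[OF tendsto_const] filterlim_tendsto_pos_mult_at_bot[OF tendsto_const] filterlim_ident)
  define L where "L b = R b + \<Psi> \<xi> * of_real (2 * Si (d * b))" for b
  have L_top: "(L \<longlongrightarrow> \<Psi> \<xi> * pi) at_top"
    unfolding L_def by (rule tendsto_eq_intros R0 Sid refl | simp)+
  have L_bot: "(L \<longlongrightarrow> - (\<Psi> \<xi> * pi)) at_bot"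
    unfolding L_def by (rule tendsto_eq_intros R0 Sid refl | simp)+
  have "((\<lambda>x. cis (\<xi> * x) * W x) has_integral (\<Psi> \<xi> * (2 * pi))) UNIV"
    unfolding has_integral_alt'
  proof (intro conjI allI impI)
    show "(\<lambda>x. if x \<in> UNIV then cis (\<xi> * x) * W x else 0) integrable_on cbox a b" for a b
      using integrable_continuous_interval[OF contW] by simp
    fix e :: real assume "0 < e"
    obtain B1 where B1: "\<And>b. B1 \<le> b \<Longrightarrow> dist (L b) (\<Psi> \<xi> * pi) < e / 2"
      using tendstoD[OF L_top, of "e/2"] \<open>0 < e\<close> by (auto simp: eventually_at_top_linorder)
    obtain B2 where B2: "\<And>a. a \<le> B2 \<Longrightarrow> dist (L a) (- (\<Psi> \<xi> * pi)) < e / 2"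
      using tendstoD[OF L_bot, of "e/2"] \<open>0 < e\<close> by (auto simp: eventually_at_bot_linorder)
    \<comment> \<open>The factor 2 puts the points B / 2 and -B / 2 inside the open ball, and hence
      inside [a, b].\<close>
    define B where "B = 2 * (\<bar>B1\<bar> + \<bar>B2\<bar> + 1)"
    show "\<exists>B>0. \<forall>a b. ball 0 B \<subseteq> cbox a b \<longrightarrow>
        norm (integral (cbox a b) (\<lambda>x. if x \<in> UNIV then cis (\<xi> * x) * W x else 0) - \<Psi> \<xi> * (2 * pi)) < e"
    proof (intro exI[of _ B] conjI allI impI)
      fix a b :: real assume sub: "ball 0 B \<subseteq> cbox a b"
      have "B / 2 \<in> ball 0 B" "- (B / 2) \<in> ball 0 B" by (auto simp: B_def dist_real_def)
      then have "B / 2 \<in> cbox a b" "- (B / 2) \<in> cbox a b" using sub by blast+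
      then have "B / 2 \<le> b" "a \<le> - (B / 2)" by simp_all
      moreover have "B / 2 = \<bar>B1\<bar> + \<bar>B2\<bar> + 1" by (simp add: B_def)
      ultimately have ab: "B1 \<le> b" "a \<le> B2" "a \<le> b" by linarith+
      have "integral {a..b} (\<lambda>x. cis (\<xi> * x) * W x) - \<Psi> \<xi> * (2 * pi) = (L b - \<Psi> \<xi> * pi) - (L a - - (\<Psi> \<xi> * pi))"
        unfolding J[OF ab(3)] L_def by (simp add: algebra_simps)
      also have "norm \<dots> \<le> norm (L b - \<Psi> \<xi> * pi) + norm (L a - - (\<Psi> \<xi> * pi))"
        by (rule norm_triangle_ineq4)
      also have "\<dots> < e" using B1[OF ab(1)] B2[OF ab(2)] by (simp add: dist_norm)
      finally show "norm (integral (cbox a b) (\<lambda>x. if x \<in> UNIV then cis (\<xi> * x) * W x else 0) - \<Psi> \<xi> * (2 * pi)) < e"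
        by simp
    qed (simp add: B_def)
  qed
  from has_integral_divide[OF this, of "2 * pi"] show ?thesis
    by (simp add: W_def)
qed

section \<open>Stable laws and their Levy measure\<close>

lemma norm_one_minus_exp_le:
  assumes "0 \<le> Re w"
  shows "norm (1 - exp (- w)) \<le> norm w" "norm (1 - exp (- w)) \<le> 2"
proof -
  have "norm (exp (- 0) - exp (- w)) \<le> 1 * norm (0 - w)"
  proof (rule field_differentiable_bound[where S = "{z. 0 \<le> Re z}" and f' = "\<lambda>z. - exp (- z)"])
    show "((\<lambda>z. exp (- z)) has_field_derivative - exp (- z)) (at z within {z. 0 \<le> Re z})" for z :: complex
      by (auto intro!: derivative_eq_intros)
  qed (use assms in \<open>auto simp: convex_halfspace_Re_ge\<close>)
  then show "norm (1 - exp (- w)) \<le> norm w" by simp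
  show "norm (1 - exp (- w)) \<le> 2"
    using norm_triangle_ineq4[of 1 "exp (- w)"] assms by (simp add: order_trans)
qed

lemma norm_one_minus_exp_le_min:
  assumes "0 \<le> Re z" "0 \<le> x"
  shows "norm (1 - exp (- (z * of_real x))) \<le> (2 + norm z) * min 1 x"
proof -
  have "norm (1 - exp (- (z * of_real x))) \<le> norm z * x" "norm (1 - exp (- (z * of_real x))) \<le> 2"
    using norm_one_minus_exp_le[of "z * of_real x"] assms by (auto simp: norm_mult)
  moreover have "0 \<le> norm z" "(2 + norm z) * x = 2 * x + norm z * x" by (simp_all add: algebra_simps)
  ultimately show ?thesis using assms(2)
    unfolding min_def by (cases "1 \<le> x"; simp only: if_True if_False mult_1_right; linarith)
qed

text \<open>The integrability condition covers two cases at once: a law on the half-line, where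
  \<open>exponent\<close> is 1 minus the Laplace transform, and the infinite Levy measure of a
  subordinator, where it is the Laplace exponent.\<close>

locale laplace_exponent =
  fixes \<nu> :: "real measure"
  assumes sets_\<nu> [measurable_cong, simp]: "sets \<nu> = sets borel"
    and nonneg: "AE x in \<nu>. 0 \<le> x"
    and integrable_min: "integrable \<nu> (\<lambda>x. min 1 x)"
begin

definition exponent :: "complex \<Rightarrow> complex" where
  "exponent z = (\<integral>x. 1 - exp (- (z * of_real x)) \<partial>\<nu>)"

lemma integrable_exponent:
  assumes "0 \<le> Re z"
  shows "integrable \<nu> (\<lambda>x. 1 - exp (- (z * complex_of_real x)))"
proof (rule Bochner_Integration.integrable_bound)
  show "integrable \<nu> (\<lambda>x. (2 + norm z) * min 1 x)" using integrable_min by (rule integrable_mult_right)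
  show "AE x in \<nu>. norm (1 - exp (- (z * complex_of_real x))) \<le> norm ((2 + norm z) * min 1 x)"
    using nonneg by eventually_elim (metis norm_one_minus_exp_le_min[OF assms] abs_ge_self order_trans real_norm_def)
qed measurable

lemma exponent_tendsto_boundary:
  "((\<lambda>e. exponent (\<i> * of_real y + of_real e)) \<longlongrightarrow> exponent (\<i> * of_real y)) (at_right 0)"
proof -
  \<comment> \<open>Restricting to e < 1 bounds the modulus of the argument and thereby gives one
    dominating function.\<close>
  have "((\<lambda>e. exponent (\<i> * of_real y + of_real e)) \<longlongrightarrow> exponent (\<i> * of_real y)) (at 0 within {0<..<1})"
    unfolding exponent_def
  proof (rule integral_dominated_convergence_at_within)
    show "integrable \<nu> (\<lambda>x. (3 + \<bar>y\<bar>) * min 1 x)" using integrable_min by (rule integrable_mult_right)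
    fix e :: real assume e: "e \<in> {0<..<1}"
    have *: "2 + norm (\<i> * of_real y + of_real e) \<le> 3 + \<bar>y\<bar>"
      using norm_triangle_ineq[of "\<i> * of_real y" "of_real e"] e by (simp add: norm_mult)
    show "AE x in \<nu>. norm (1 - exp (- ((\<i> * of_real y + of_real e) * complex_of_real x))) \<le> (3 + \<bar>y\<bar>) * min 1 x"
      using nonneg
    proof eventually_elim
      case (elim x)
      have "norm (1 - exp (- ((\<i> * of_real y + of_real e) * complex_of_real x))) \<le> (2 + norm (\<i> * of_real y + of_real e)) * min 1 x"
        by (rule norm_one_minus_exp_le_min) (use e elim in auto)
      also have "\<dots> \<le> (3 + \<bar>y\<bar>) * min 1 x" using * elim by (intro mult_right_mono) auto
      finally show ?case .
    qed
  next
    show "AE x in \<nu>. ((\<lambda>e. 1 - exp (- ((\<i> * of_real y + of_real e) * complex_of_real x))) \<longlongrightarrow> 1 - exp (- (\<i> * of_real y * complex_of_real x))) (at 0 within {0<..<1})"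
    proof (rule AE_I2)
      fix x
      have "((\<lambda>e. 1 - exp (- ((\<i> * of_real y + of_real e) * complex_of_real x))) \<longlongrightarrow> 1 - exp (- ((\<i> * of_real y + of_real 0) * complex_of_real x))) (at 0 within {0<..<1})"
        by (intro tendsto_intros)
      then show "((\<lambda>e. 1 - exp (- ((\<i> * of_real y + of_real e) * complex_of_real x))) \<longlongrightarrow> 1 - exp (- (\<i> * of_real y * complex_of_real x))) (at 0 within {0<..<1})"
        by simp
    qed
  qed measurable
  moreover have "at 0 within {0<..<1} = at_right (0::real)"
    by (rule at_within_nhd[of _ "{..<1}"]) auto
  ultimately show ?thesis by simp
qed

text \<open>Differentiation under the integral. On the half-plane Re z > a with a = Re z0 / 2,
  difference quotients are bounded by x exp (-a x), which is at most both x and 1 / a, hence at most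
  a multiple of min 1 x.\<close>

lemma exponent_holomorphic: "exponent holomorphic_on {z. 0 < Re z}"
  unfolding holomorphic_on_open[OF open_halfspace_Re_gt]
proof (intro ballI)
  fix z0 assume "z0 \<in> {z. 0 < Re z}"
  then have z0: "0 < Re z0" by simp
  define a where "a = Re z0 / 2"
  have a: "0 < a" using z0 by (simp add: a_def)
  define S where "S = {z. a < Re z}"
  have "((\<lambda>z. (exponent z - exponent z0) / (z - z0)) \<longlongrightarrow> (\<integral>x. of_real x * exp (- (z0 * of_real x)) \<partial>\<nu>)) (at z0 within S)"
  proof (rule Lim_transform_eventually)
    show "((\<lambda>z. \<integral>x. (exp (- (z0 * of_real x)) - exp (- (z * of_real x))) / (z - z0) \<partial>\<nu>) \<longlongrightarrow> (\<integral>x. of_real x * exp (- (z0 * of_real x)) \<partial>\<nu>)) (at z0 within S)"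
    proof (rule integral_dominated_convergence_at_within)
      show "integrable \<nu> (\<lambda>x. (1 + 1 / a) * min 1 x)" using integrable_min by (rule integrable_mult_right)
      fix z assume z: "z \<in> S" "z \<noteq> z0"
      show "AE x in \<nu>. norm ((exp (- (z0 * complex_of_real x)) - exp (- (z * of_real x))) / (z - z0)) \<le> (1 + 1 / a) * min 1 x"
        using nonneg
      proof eventually_elim
        case (elim x)
        have "norm (exp (- (z0 * complex_of_real x)) - exp (- (z * of_real x))) \<le> (x * exp (- (a * x))) * norm (z0 - z)"
        proof (rule field_differentiable_bound[where S = S and f' = "\<lambda>z. - of_real x * exp (- (z * of_real x))"])
          show "((\<lambda>z. exp (- (z * complex_of_real x))) has_field_derivative - of_real x * exp (- (w * of_real x))) (at w within S)" for w
            by (auto intro!: derivative_eq_intros)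
          show "norm (- of_real x * exp (- (w * complex_of_real x))) \<le> x * exp (- (a * x))" if "w \<in> S" for w
            using that elim by (auto simp: norm_mult S_def intro!: mult_left_mono mult_right_mono)
          show "convex S" unfolding S_def by (rule convex_halfspace_Re_gt)
        qed (use z z0 in \<open>auto simp: S_def a_def\<close>)
        then have "norm ((exp (- (z0 * complex_of_real x)) - exp (- (z * of_real x))) / (z - z0)) \<le> x * exp (- (a * x))"
          using z by (simp add: norm_divide divide_le_eq norm_minus_commute)
        also have "\<dots> \<le> (1 + 1 / a) * min 1 x"
        proof -
          have "x * exp (- (a * x)) \<le> x * 1" using elim a by (intro mult_left_mono) auto
          moreover have "a * x \<le> exp (a * x)" using exp_ge_add_one_self[of "a * x"] by linarith
          with a have "x * exp (- (a * x)) \<le> 1 / a" using a by (simp add: exp_minus field_simps)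
          moreover have "0 \<le> x / a" "0 < 1 / a" "(1 + 1 / a) * x = x + x / a" using a elim by (simp_all add: algebra_simps)
          ultimately show ?thesis unfolding min_def by (cases "1 \<le> x"; simp only: if_True if_False mult_1_right; linarith)
        qed
        finally show ?case .
      qed
    next
      have "((\<lambda>z. (exp (- (z0 * of_real x)) - exp (- (z * of_real x))) / (z - z0)) \<longlongrightarrow> of_real x * exp (- (z0 * of_real x))) (at z0 within S)" for x :: real
      proof -
        have "((\<lambda>z. - exp (- (z * of_real x))) has_field_derivative of_real x * exp (- (z0 * of_real x))) (at z0 within S)"
          by (auto intro!: derivative_eq_intros)
        then show ?thesis by (simp add: has_field_derivative_iff)
      qed
      then show "AE x in \<nu>. ((\<lambda>z. (exp (- (z0 * of_real x)) - exp (- (z * of_real x))) / (z - z0)) \<longlongrightarrow> of_real x * exp (- (z0 * complex_of_real x))) (at z0 within S)"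
        by simp
    qed measurable
    show "\<forall>\<^sub>F z in at z0 within S. (\<integral>x. (exp (- (z0 * of_real x)) - exp (- (z * of_real x))) / (z - z0) \<partial>\<nu>) = (exponent z - exponent z0) / (z - z0)"
      unfolding eventually_at_topological
    proof (intro exI[of _ UNIV] conjI ballI impI)
      fix z assume "z \<in> S"
      then have z: "0 \<le> Re z" using a by (simp add: S_def)
      have "exponent z - exponent z0 = (\<integral>x. (1 - exp (- (z * of_real x))) - (1 - exp (- (z0 * of_real x))) \<partial>\<nu>)"
        unfolding exponent_def using z z0 by (intro Bochner_Integration.integral_diff[symmetric] integrable_exponent) auto
      then show "(\<integral>x. (exp (- (z0 * of_real x)) - exp (- (z * of_real x))) / (z - z0) \<partial>\<nu>) = (exponent z - exponent z0) / (z - z0)"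
        by simp
    qed auto
  qed
  moreover have "at z0 within S = at z0"
    unfolding S_def by (rule at_within_open[OF _ open_halfspace_Re_gt]) (use z0 in \<open>simp add: a_def\<close>)
  ultimately show "\<exists>f'. (exponent has_field_derivative f') (at z0)"
    by (auto simp: has_field_derivative_iff)
qed

text \<open>Positive reals accumulate at 1, so agreement there spreads to the open right half-plane
  by the identity theorem; both sides are then followed to the boundary.\<close>

lemma exponent_imaginary_axis:
  assumes F: "F holomorphic_on {z. 0 < Re z}"
    and eq: "\<And>\<mu>. 0 < \<mu> \<Longrightarrow> exponent (of_real \<mu>) = F (of_real \<mu>)"
    and lim: "((\<lambda>e. F (\<i> * of_real y + of_real e)) \<longlongrightarrow> L) (at_right 0)"
  shows "exponent (\<i> * of_real y) = L"
proof (rule tendsto_unique[OF trivial_limit_at_right_real exponent_tendsto_boundary])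
  have "exponent z - F z = 0" if "0 < Re z" for z
  proof (rule analytic_continuation[where f = "\<lambda>z. exponent z - F z" and S = "{z. 0 < Re z}" and U = "of_real ` {0<..}" and \<xi> = 1])
    show "(\<lambda>z. exponent z - F z) holomorphic_on {z. 0 < Re z}"
      by (intro holomorphic_intros exponent_holomorphic F)
    show "open {z. 0 < Re z}" by (rule open_halfspace_Re_gt)
    show "connected {z. 0 < Re z}" by (intro convex_connected convex_halfspace_Re_gt)
    show "(1::complex) islimpt of_real ` {0<..}"
      unfolding islimpt_approachable
    proof (intro allI impI)
      fix e :: real assume "0 < e"
      show "\<exists>x'\<in>complex_of_real ` {0<..}. x' \<noteq> 1 \<and> dist x' 1 < e"
      proof (intro bexI conjI)
        show "complex_of_real (1 + e / 2) \<in> complex_of_real ` {0<..}" using \<open>0 < e\<close> by (intro imageI) simp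
        show "complex_of_real (1 + e / 2) \<noteq> 1" using \<open>0 < e\<close> by simp
        show "dist (complex_of_real (1 + e / 2)) 1 < e" using \<open>0 < e\<close> by (simp add: dist_norm norm_divide)
      qed
    qed
  qed (use eq that in auto)
  then show "((\<lambda>e. exponent (\<i> * of_real y + of_real e)) \<longlongrightarrow> L) (at_right 0)"
    by (intro Lim_transform_eventually[OF lim]) (auto simp: eventually_at_right_field intro!: exI[of _ 1])
qed

end

section \<open>Fractional powers on the imaginary axis and stable laws\<close>

text \<open>Among the points i y only 0 lies on the branch cut, and there the positive exponent
  forces the limit 0.\<close>

lemma tendsto_imaginary_powr:
  fixes y \<beta> :: real
  assumes "0 < \<beta>"
  shows "((\<lambda>e. (\<i> * of_real y + complex_of_real e) powr of_real \<beta>) \<longlongrightarrow> (\<i> * of_real y) powr of_real \<beta>) (at_right 0)"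
proof -
  have "\<i> * of_real y \<notin> \<real>\<^sub>\<le>\<^sub>0 \<or> \<i> * of_real y = 0 \<and> 0 < Re (complex_of_real \<beta>)"
    using assms by (auto simp: complex_nonpos_Reals_iff)
  then have "((\<lambda>e. (\<i> * of_real y + complex_of_real e) powr of_real \<beta>) \<longlongrightarrow> (\<i> * of_real y + of_real 0) powr of_real \<beta>) (at_right 0)"
    by (intro tendsto_powr_complex' tendsto_intros) simp
  then show ?thesis by simp
qed

lemma imaginary_powr:
  fixes y \<beta> :: real
  assumes "0 < \<beta>"
  shows "(\<i> * of_real y) powr of_real \<beta>
    = of_real (\<bar>y\<bar> powr \<beta>) * (of_real (cos (\<beta> * pi / 2)) + \<i> * of_real (sgn y * sin (\<beta> * pi / 2)))"
proof (cases "y = 0")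
  case False
  have "Ln (\<i> * of_real y) = of_real (ln \<bar>y\<bar>) + \<i> * of_real (sgn y * pi / 2)"
  proof (cases "0 < y")
    case True
    then show ?thesis using Ln_times_of_real[of y \<i>] by (simp add: mult.commute Ln_of_real)
  next
    case F: False
    then show ?thesis using Ln_times_of_real[of "-y" "- \<i>"] Ln_of_real[of "-y"] F False by (simp add: mult.commute Ln_of_real)
  qed
  then have "(\<i> * of_real y) powr of_real \<beta> = exp (of_real (\<beta> * ln \<bar>y\<bar>) + \<i> * of_real (sgn y * (\<beta> * pi / 2)))"
    using False by (simp add: powr_def algebra_simps)
  also have "\<dots> = of_real (\<bar>y\<bar> powr \<beta>) * cis (sgn y * (\<beta> * pi / 2))"
    using False by (simp only: exp_add exp_of_real cis_conv_exp powr_def) simp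
  also have "cis (sgn y * (\<beta> * pi / 2)) = of_real (cos (\<beta> * pi / 2)) + \<i> * of_real (sgn y * sin (\<beta> * pi / 2))"
    by (cases "0 < y") (use False in \<open>auto simp: complex_eq_iff sgn_if\<close>)
  finally show ?thesis .
qed (use assms in simp)

text \<open>Only the boundary value of \<open>z\<^sup>\<beta>\<close> at \<open>z = i y\<close> is needed, but it can only be reached from the
  right half-plane, where both sides are holomorphic.\<close>

lemma stable_characteristic_function:
  fixes \<nu> :: "real measure" and \<beta> r :: real
  assumes "prob_space \<nu>" and sets [measurable_cong, simp]: "sets \<nu> = sets borel" and nonneg: "AE x in \<nu>. 0 \<le> x" and "0 < \<beta>"
    and laplace: "\<And>m. 0 < m \<Longrightarrow> (\<integral>x. exp (- (m * x)) \<partial>\<nu>) = exp (- (r * m powr \<beta>))"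
  shows "(\<integral>x. exp (- (\<i> * of_real (y * x))) \<partial>\<nu>) = exp (- (of_real r * (\<i> * of_real y) powr of_real \<beta>))"
proof -
  interpret prob_space \<nu> by fact
  have "integrable \<nu> (\<lambda>x. min 1 x)"
  proof (rule integrable_const_bound)
    show "AE x in \<nu>. norm (min 1 x) \<le> 1" using nonneg by eventually_elim (simp add: min_def)
  qed measurable
  then interpret laplace_exponent \<nu> using nonneg by unfold_locales auto
  have ie: "integrable \<nu> (\<lambda>x. exp (- (z * complex_of_real x)))" if "0 \<le> Re z" for z
    by (rule integrable_const_bound[of _ 1]) (use nonneg that in auto)
  have ex: "exponent z = 1 - (\<integral>x. exp (- (z * complex_of_real x)) \<partial>\<nu>)" if "0 \<le> Re z" for z
    unfolding exponent_def using ie[OF that] prob_space by simp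
  have "exponent (\<i> * of_real y) = 1 - exp (- (of_real r * (\<i> * of_real y) powr of_real \<beta>))"
  proof (rule exponent_imaginary_axis[where F = "\<lambda>z. 1 - exp (- (of_real r * z powr of_real \<beta>))"])
    show "(\<lambda>z. 1 - exp (- (of_real r * z powr of_real \<beta>))) holomorphic_on {z. 0 < Re z}"
      by (intro holomorphic_intros) (auto simp: complex_nonpos_Reals_iff)
    show "((\<lambda>e. 1 - exp (- (of_real r * (\<i> * of_real y + complex_of_real e) powr of_real \<beta>))) \<longlongrightarrow> 1 - exp (- (of_real r * (\<i> * of_real y) powr of_real \<beta>))) (at_right 0)"
      by (intro tendsto_intros tendsto_imaginary_powr \<open>0 < \<beta>\<close>)
    fix m :: real assume m: "0 < m"
    have "(\<integral>x. exp (- (of_real m * complex_of_real x)) \<partial>\<nu>) = (\<integral>x. complex_of_real (exp (- (m * x))) \<partial>\<nu>)"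
      by (simp flip: exp_of_real)
    also have "\<dots> = of_real (exp (- (r * m powr \<beta>)))"
      unfolding integral_complex_of_real laplace[OF m] ..
    also have "\<dots> = exp (- (of_real r * of_real m powr of_real \<beta>))"
      using m by (simp add: powr_of_real flip: exp_of_real)
    finally show "exponent (of_real m) = 1 - exp (- (of_real r * of_real m powr of_real \<beta>))"
      using ex[of "of_real m"] m by simp
  qed
  then show ?thesis using ex[of "\<i> * of_real y"] by (simp add: mult.assoc)
qed

lemma DERIV_powr_const: "0 < x \<Longrightarrow> ((\<lambda>x::real. x powr c) has_real_derivative c * x powr (c - 1)) (at x)"
  by (auto intro!: derivative_eq_intros)

section \<open>The Levy measure of the stable subordinator\<close>

text \<open>Normalised so that the mass beyond \<delta> is \<delta> to the power -\<beta>. This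
  matches the Pareto tail and leaves the factor \<Gamma>(1 - \<beta>) in the exponent.\<close>

definition stable_levy_measure :: "real \<Rightarrow> real measure" where
  "stable_levy_measure \<beta> = density lborel (\<lambda>x. ennreal (indicator {0<..} x * (\<beta> * x powr (- \<beta> - 1))))"

context
  fixes \<beta> :: real
  assumes \<beta>: "0 < \<beta>" "\<beta> < 1"
begin

lemma levy_min_integrable:
  "integrable lborel (\<lambda>x. indicator {0<..} x * (\<beta> * x powr (- \<beta> - 1)) * min 1 x)"
proof -
  have 1: "set_integrable lborel {0<..<1} (\<lambda>x. \<beta> * x powr (- \<beta>))"
  proof -
    have "set_integrable lborel (einterval (ereal 0) (ereal 1)) (\<lambda>x. \<beta> * x powr (- \<beta>))"
    proof (rule interval_integral_FTC_nonneg(1)[where F = "\<lambda>x. \<beta> / (1 - \<beta>) * x powr (1 - \<beta>)"])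
      fix x assume "ereal 0 < ereal x"
      then show "((\<lambda>x. \<beta> / (1 - \<beta>) * x powr (1 - \<beta>)) has_real_derivative \<beta> * x powr (- \<beta>)) (at x)"
        using \<beta> DERIV_cmult[OF DERIV_powr_const[of x "1 - \<beta>"], of "\<beta> / (1 - \<beta>)"] by simp
      show "isCont (\<lambda>x. \<beta> * x powr (- \<beta>)) x"
        using \<open>ereal 0 < ereal x\<close> by (auto intro!: continuous_intros)
    next
      show "(((\<lambda>x. \<beta> / (1 - \<beta>) * x powr (1 - \<beta>)) \<circ> real_of_ereal) \<longlongrightarrow> 0) (at_right (ereal 0))"
        unfolding ereal_tendsto_simps using \<beta> by real_asymp
      show "(((\<lambda>x. \<beta> / (1 - \<beta>) * x powr (1 - \<beta>)) \<circ> real_of_ereal) \<longlongrightarrow> \<beta> / (1 - \<beta>)) (at_left (ereal 1))"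
        unfolding ereal_tendsto_simps using \<beta> by (auto intro!: tendsto_eq_intros)
    qed (use \<beta> in auto)
    then show ?thesis by simp
  qed
  have 2: "set_integrable lborel {1<..} (\<lambda>x. \<beta> * x powr (- \<beta> - 1))"
  proof -
    have "set_integrable lborel (einterval (ereal 1) \<infinity>) (\<lambda>x. \<beta> * x powr (- \<beta> - 1))"
    proof (rule interval_integral_FTC_nonneg(1)[where F = "\<lambda>x. - (x powr (- \<beta>))"])
      fix x assume "ereal 1 < ereal x"
      then show "((\<lambda>x. - (x powr (- \<beta>))) has_real_derivative \<beta> * x powr (- \<beta> - 1)) (at x)"
        using \<beta> by (auto intro!: derivative_eq_intros simp: field_simps)
      show "isCont (\<lambda>x. \<beta> * x powr (- \<beta> - 1)) x"
        using \<open>ereal 1 < ereal x\<close> by (auto intro!: continuous_intros)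
    next
      show "(((\<lambda>x. - (x powr (- \<beta>))) \<circ> real_of_ereal) \<longlongrightarrow> - 1) (at_right (ereal 1))"
        unfolding ereal_tendsto_simps using \<beta> by (auto intro!: tendsto_eq_intros)
      show "(((\<lambda>x. - (x powr (- \<beta>))) \<circ> real_of_ereal) \<longlongrightarrow> 0) (at_left \<infinity>)"
        unfolding ereal_tendsto_simps using \<beta> by real_asymp
    qed (use \<beta> in auto)
    then show ?thesis by simp
  qed
  have "integrable lborel (\<lambda>x. indicator {0<..<1} x *\<^sub>R (\<beta> * x powr (- \<beta>)) + indicator {1<..} x *\<^sub>R (\<beta> * x powr (- \<beta> - 1)))"
    using 1 2 by (intro Bochner_Integration.integrable_add) (auto simp: set_integrable_def)
  then show ?thesis
  proof (rule integrable_cong_AE_imp)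
    have "AE x in lborel. x \<noteq> (1::real)" by (rule AE_lborel_singleton)
    then show "AE x in lborel. indicator {0<..<1} x *\<^sub>R (\<beta> * x powr (- \<beta>)) + indicator {1<..} x *\<^sub>R (\<beta> * x powr (- \<beta> - 1)) = indicator {0<..} x * (\<beta> * x powr (- \<beta> - 1)) * min 1 x"
      by eventually_elim (auto simp: indicator_def min_def powr_diff)
  qed measurable
qed

text \<open>The Gamma integral after t = m x: what remains of the Levy exponent after the
  integration by parts in \<open>levy_exponent_pos\<close>.\<close>

lemma gamma_scaled:
  assumes m: "0 < m"
  shows "has_bochner_integral lborel (\<lambda>x. indicator {0<..} x *\<^sub>R (m * exp (- (m * x)) * x powr (- \<beta>))) (Gamma (1 - \<beta>) * m powr \<beta>)"
proof -
  define f where "f t = indicator {0..} t * t powr ((1 - \<beta>) - 1) / exp t" for t :: real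
  have [measurable]: "f \<in> borel_measurable borel" unfolding f_def[abs_def] by measurable
  have "has_bochner_integral lborel f (Gamma (1 - \<beta>))"
  proof (rule has_bochner_integral_nn_integral)
    show "(\<integral>\<^sup>+ x. ennreal (f x) \<partial>lborel) = ennreal (Gamma (1 - \<beta>))"
      using Gamma_conv_nn_integral_real[of "1 - \<beta>"] \<beta> by (simp add: f_def)
  qed (use \<beta> in \<open>auto simp: f_def Gamma_real_pos less_imp_le\<close>)
  then have "integrable lborel f" "(LBINT t. f t) = Gamma (1 - \<beta>)"
    by (auto simp: has_bochner_integral_iff)
  then have "has_bochner_integral lborel (\<lambda>x. m powr \<beta> * (m * f (0 + m * x))) (m powr \<beta> * Gamma (1 - \<beta>))"
    using lborel_integral_real_affine[of m f 0] lborel_integrable_real_affine[of f m 0] m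
    by (auto simp: has_bochner_integral_iff)
  moreover have "m powr \<beta> * (m * f (0 + m * x)) = indicator {0<..} x *\<^sub>R (m * exp (- (m * x)) * x powr (- \<beta>))" for x
  proof (cases "0 < x")
    case True
    then have "(m * x) powr (- \<beta>) = m powr (- \<beta>) * x powr (- \<beta>)" using m by (simp add: powr_mult)
    moreover have "m powr \<beta> * m powr (- \<beta>) = 1" using m by (simp flip: powr_add)
    ultimately show ?thesis using True m by (simp add: f_def exp_minus field_simps)
  next
    case False
    then have "f (m * x) = 0" using m by (cases "x = 0") (auto simp: f_def indicator_def zero_le_mult_iff)
    then show ?thesis using False by simp
  qed
  ultimately show ?thesis by (simp only: mult.commute[of "Gamma _"])
qed

lemma laplace_exponent_stable_levy_measure: "laplace_exponent (stable_levy_measure \<beta>)"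
proof
  show "AE x in stable_levy_measure \<beta>. 0 \<le> x"
    unfolding stable_levy_measure_def by (subst AE_density) (auto simp: indicator_def)
  show "integrable (stable_levy_measure \<beta>) (\<lambda>x. min 1 x)"
    unfolding stable_levy_measure_def using levy_min_integrable \<beta> by (subst integrable_density) auto
qed (simp add: stable_levy_measure_def)

interpretation levy: laplace_exponent "stable_levy_measure \<beta>" by (rule laplace_exponent_stable_levy_measure)

text \<open>Integration by parts against the tail \<open>x powr (- \<beta>)\<close>. The boundary
  term (1 - exp (-m x)) times this tail vanishes at 0 because \<beta> < 1 and at infinity because
  \<beta> > 0.\<close>

lemma levy_exponent_pos:
  assumes m: "0 < m"
  shows "levy.exponent (of_real m) = of_real (Gamma (1 - \<beta>)) * of_real m powr of_real \<beta>"
proof -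
  let ?f = "\<lambda>x. (1 - exp (- (m * x))) * (\<beta> * x powr (- \<beta> - 1))"
  let ?g = "\<lambda>x. m * exp (- (m * x)) * x powr (- \<beta>)"
  have "levy.exponent (of_real m) = (LBINT x. (indicator {0<..} x * (\<beta> * x powr (- \<beta> - 1))) *\<^sub>R (1 - exp (- (of_real m * complex_of_real x))))"
    unfolding levy.exponent_def unfolding stable_levy_measure_def using \<beta> by (subst integral_density) auto
  also have "\<dots> = (LBINT x. complex_of_real (indicator {0<..} x *\<^sub>R ?f x))"
    by (intro Bochner_Integration.integral_cong) (auto simp: scaleR_conv_of_real simp flip: exp_of_real)
  also have "\<dots> = of_real (LBINT x:{0<..}. ?f x)"
    unfolding set_lebesgue_integral_def by (rule integral_complex_of_real)
  also have "(LBINT x:{0<..}. ?f x) = Gamma (1 - \<beta>) * m powr \<beta>"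
  proof -
    have fi: "set_integrable lborel {0<..} ?f"
    proof -
      have "integrable (stable_levy_measure \<beta>) (\<lambda>x. Re (1 - exp (- (of_real m * complex_of_real x))))"
        using levy.integrable_exponent[of "of_real m"] m by (intro integrable_Re) simp
      also have "(\<lambda>x. Re (1 - exp (- (of_real m * complex_of_real x)))) = (\<lambda>x. 1 - exp (- (m * x)))"
        by (simp add: Re_exp)
      finally have "integrable lborel (\<lambda>x. (indicator {0<..} x * (\<beta> * x powr (- \<beta> - 1))) *\<^sub>R (1 - exp (- (m * x))))"
        unfolding stable_levy_measure_def using \<beta> by (subst (asm) integrable_density) auto
      then show ?thesis by (simp add: set_integrable_def mult_ac)
    qed
    have gi: "set_integrable lborel {0<..} ?g" and gv: "(LBINT x:{0<..}. ?g x) = Gamma (1 - \<beta>) * m powr \<beta>"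
      using gamma_scaled[OF m] by (simp_all add: has_bochner_integral_iff set_integrable_def set_lebesgue_integral_def)
    have "(LBINT x=ereal 0..\<infinity>. ?f x - ?g x) = 0 - 0"
    proof (rule interval_integral_FTC_integrable[where F = "\<lambda>x. - ((1 - exp (- (m * x))) * x powr (- \<beta>))"])
      fix x assume "ereal 0 < ereal x"
      then have x: "0 < x" by simp
      show "((\<lambda>x. - ((1 - exp (- (m * x))) * x powr (- \<beta>))) has_vector_derivative ?f x - ?g x) (at x)"
        unfolding has_real_derivative_iff_has_vector_derivative[symmetric] using x
        by (auto intro!: derivative_eq_intros simp: field_simps)
      show "isCont (\<lambda>x. ?f x - ?g x) x" using x by (auto intro!: continuous_intros)
    next
      show "set_integrable lborel (einterval (ereal 0) \<infinity>) (\<lambda>x. ?f x - ?g x)"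
        unfolding einterval_eq by (intro set_integral_diff fi gi)
      show "(((\<lambda>x. - ((1 - exp (- (m * x))) * x powr (- \<beta>))) \<circ> real_of_ereal) \<longlongrightarrow> 0) (at_right (ereal 0))"
        unfolding ereal_tendsto_simps using \<beta> m by real_asymp
      show "(((\<lambda>x. - ((1 - exp (- (m * x))) * x powr (- \<beta>))) \<circ> real_of_ereal) \<longlongrightarrow> 0) (at_left \<infinity>)"
        unfolding ereal_tendsto_simps using \<beta> m by real_asymp
    qed simp
    then have "(LBINT x:{0<..}. ?f x) - (LBINT x:{0<..}. ?g x) = 0"
      using set_integral_diff(2)[OF fi gi] by (simp add: interval_lebesgue_integral_0_infty zero_ereal_def[symmetric])
    then show ?thesis using gv by simp
  qed
  finally show ?thesis using m by (simp add: powr_of_real)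
qed

lemma levy_exponent_imaginary:
  "levy.exponent (\<i> * of_real y) = of_real (Gamma (1 - \<beta>)) * (\<i> * of_real y) powr of_real \<beta>"
proof (rule levy.exponent_imaginary_axis[where F = "\<lambda>z. of_real (Gamma (1 - \<beta>)) * z powr of_real \<beta>"])
  show "(\<lambda>z. of_real (Gamma (1 - \<beta>)) * z powr of_real \<beta>) holomorphic_on {z. 0 < Re z}"
    by (intro holomorphic_intros) (auto simp: complex_nonpos_Reals_iff)
qed (auto intro!: levy_exponent_pos tendsto_intros tendsto_imaginary_powr \<beta>)

end

section \<open>The compound Poisson sum\<close>

text \<open>The hypotheses leave out w = \<delta>. There the tails at \<delta> + e, which tend to 1,
  bound the probability from below.\<close>

lemma pareto_tail:
  fixes Z :: "'a \<Rightarrow> real"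
  assumes "prob_space M" and [measurable]: "Z \<in> borel_measurable M" and \<delta>: "0 < \<delta>" and "0 < \<beta>"
    and tail: "\<And>w. \<delta> < w \<Longrightarrow> measure M {\<omega> \<in> space M. w < Z \<omega>} = (\<delta> / w) powr \<beta>"
    and full: "\<And>w. w < \<delta> \<Longrightarrow> measure M {\<omega> \<in> space M. w < Z \<omega>} = 1"
  shows "measure M {\<omega> \<in> space M. w < Z \<omega>} = (\<delta> / max w \<delta>) powr \<beta>"
proof -
  interpret prob_space M by fact
  consider "\<delta> < w" | "w < \<delta>" | "w = \<delta>" by linarith
  then show ?thesis
  proof cases
    case 3
    have "((\<lambda>e. (\<delta> / (\<delta> + e)) powr \<beta>) \<longlongrightarrow> (\<delta> / (\<delta> + 0)) powr \<beta>) (at_right 0)"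
      using \<delta> by (intro tendsto_intros) auto
    then have "((\<lambda>e. (\<delta> / (\<delta> + e)) powr \<beta>) \<longlongrightarrow> 1) (at_right 0)" using \<delta> by simp
    moreover have "\<forall>\<^sub>F e in at_right 0. (\<delta> / (\<delta> + e)) powr \<beta> \<le> prob {\<omega> \<in> space M. \<delta> < Z \<omega>}"
      unfolding eventually_at_right_field
    proof (intro exI[of _ 1] conjI allI impI)
      fix e :: real assume "0 < e"
      then have "(\<delta> / (\<delta> + e)) powr \<beta> = prob {\<omega> \<in> space M. \<delta> + e < Z \<omega>}" by (subst tail) auto
      also have "\<dots> \<le> prob {\<omega> \<in> space M. \<delta> < Z \<omega>}"
        by (rule finite_measure_mono) (use \<open>0 < e\<close> in auto)
      finally show "(\<delta> / (\<delta> + e)) powr \<beta> \<le> prob {\<omega> \<in> space M. \<delta> < Z \<omega>}" .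
    qed simp
    ultimately have "1 \<le> prob {\<omega> \<in> space M. \<delta> < Z \<omega>}"
      by (rule tendsto_upperbound) simp
    then show ?thesis using prob_le_1[of "{\<omega> \<in> space M. \<delta> < Z \<omega>}"] 3 \<delta> by simp
  qed (use tail full \<delta> in auto)
qed

text \<open>A finite law on the line is determined by its tails, and the tail of the density beyond
  max w \<delta> is computed from its primitive.\<close>

lemma pareto_distr:
  fixes Z :: "'a \<Rightarrow> real"
  assumes "prob_space M" and [measurable]: "Z \<in> borel_measurable M" and \<delta>: "0 < \<delta>" and \<beta>: "0 < \<beta>"
    and tail: "\<And>w. \<delta> < w \<Longrightarrow> measure M {\<omega> \<in> space M. w < Z \<omega>} = (\<delta> / w) powr \<beta>"
    and full: "\<And>w. w < \<delta> \<Longrightarrow> measure M {\<omega> \<in> space M. w < Z \<omega>} = 1"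
  shows "distr M borel Z = density lborel (\<lambda>x. ennreal (\<delta> powr \<beta> * (\<beta> * x powr (- \<beta> - 1)) * indicator {\<delta><..} x))"
proof (rule measure_eqI_lessThan)
  let ?f = "\<lambda>x. \<delta> powr \<beta> * (\<beta> * x powr (- \<beta> - 1))"
  let ?d = "\<lambda>x. ennreal (?f x * indicator {\<delta><..} x)"
  interpret prob_space M by fact
  show "emeasure (distr M borel Z) {w<..} < \<infinity>" for w
    using finite_measure.emeasure_finite[OF finite_measure_distr, of Z borel "{w<..}"] by (simp add: top.not_eq_extremum)
  fix w :: real
  define m where "m = max w \<delta>"
  have m: "0 < m" using \<delta> by (simp add: m_def)
  have "emeasure (distr M borel Z) {w<..} = emeasure M {\<omega> \<in> space M. w < Z \<omega>}"
    by (subst emeasure_distr) (auto intro!: arg_cong[where f = "emeasure M"])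
  also have "\<dots> = ennreal ((\<delta> / m) powr \<beta>)"
    unfolding emeasure_eq_measure m_def using pareto_tail[OF assms] by simp
  also have "\<dots> = ennreal (0 - - (\<delta> powr \<beta> * m powr (- \<beta>)))"
    using \<delta> m by (simp add: powr_divide powr_minus_divide)
  also have "\<dots> = (\<integral>\<^sup>+x. ennreal (?f x) * indicator {m..} x \<partial>lborel)"
  proof (rule nn_integral_FTC_atLeast[symmetric])
    fix x assume "m \<le> x"
    then have x: "0 < x" using m by simp
    show "((\<lambda>x. - (\<delta> powr \<beta> * x powr (- \<beta>))) has_real_derivative ?f x) (at x)"
      using DERIV_cmult[OF DERIV_powr_const[OF x, of "- \<beta>"], of "- (\<delta> powr \<beta>)"] by (simp add: mult_ac)
    show "0 \<le> ?f x" using \<beta> by simp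
  next
    have "((\<lambda>x::real. x powr (- \<beta>)) \<longlongrightarrow> 0) at_top" using \<beta> by real_asymp
    from tendsto_minus[OF tendsto_mult_right_zero[OF this, of "\<delta> powr \<beta>"]]
    show "((\<lambda>x. - (\<delta> powr \<beta> * x powr (- \<beta>))) \<longlongrightarrow> 0) at_top" by simp
  qed measurable
  also have "\<dots> = (\<integral>\<^sup>+x. ennreal (?f x * indicator {\<delta><..} x) * indicator {w<..} x \<partial>lborel)"
  proof (rule nn_integral_cong_AE)
    have "AE x in lborel. x \<noteq> m" by (rule AE_lborel_singleton)
    then show "AE x in lborel. ennreal (?f x) * indicator {m..} x
        = ennreal (?f x * indicator {\<delta><..} x) * indicator {w<..} x"
      by eventually_elim (auto simp: indicator_def m_def)
  qed
  also have "\<dots> = emeasure (density lborel ?d) {w<..}"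
    by (subst emeasure_density) auto
  finally show "emeasure (distr M borel Z) {w<..} = emeasure (density lborel ?d) {w<..}" .
qed auto

definition truncated_exponent :: "real \<Rightarrow> real \<Rightarrow> real \<Rightarrow> complex" where
  "truncated_exponent \<beta> \<delta> y =
     (\<integral>x. indicator {\<delta><..} x *\<^sub>R (1 - exp (- (\<i> * of_real y * of_real x))) \<partial>stable_levy_measure \<beta>)"

text \<open>The Pareto density is exactly \<open>\<delta> powr \<beta>\<close> times the Levy
  density on (\<delta>, \<infinity>). The deviation of the transform from 1 is therefore a truncated
  Levy exponent, without error term.\<close>

lemma pareto_characteristic_function:
  fixes Z :: "'a \<Rightarrow> real"
  assumes "prob_space M" and [measurable]: "Z \<in> borel_measurable M" and \<delta>: "0 < \<delta>" and \<beta>: "0 < \<beta>"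
    and tail: "\<And>w. \<delta> < w \<Longrightarrow> measure M {\<omega> \<in> space M. w < Z \<omega>} = (\<delta> / w) powr \<beta>"
    and full: "\<And>w. w < \<delta> \<Longrightarrow> measure M {\<omega> \<in> space M. w < Z \<omega>} = 1"
  shows "(\<integral>\<omega>. exp (- (\<i> * of_real (y * Z \<omega>))) \<partial>M) = 1 - of_real (\<delta> powr \<beta>) * truncated_exponent \<beta> \<delta> y"
proof -
  interpret prob_space M by fact
  let ?f = "\<lambda>x. 1 - exp (- (\<i> * of_real y * complex_of_real x))"
  have d: "distr M borel Z = density lborel (\<lambda>x. ennreal (\<delta> powr \<beta> * (\<beta> * x powr (- \<beta> - 1)) * indicator {\<delta><..} x))"
    by (rule pareto_distr) fact+
  have "1 - (\<integral>\<omega>. exp (- (\<i> * of_real (y * Z \<omega>))) \<partial>M) = (\<integral>\<omega>. ?f (Z \<omega>) \<partial>M)"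
  proof -
    have "integrable M (\<lambda>\<omega>. exp (- (\<i> * of_real y * complex_of_real (Z \<omega>))))"
      by (rule integrable_const_bound[of _ 1]) auto
    then show ?thesis using prob_space by (simp add: mult.assoc)
  qed
  also have "\<dots> = (\<integral>x. ?f x \<partial>distr M borel Z)"
    by (rule integral_distr[symmetric]) auto
  also have "\<dots> = (LBINT x. (\<delta> powr \<beta> * (\<beta> * x powr (- \<beta> - 1)) * indicator {\<delta><..} x) *\<^sub>R ?f x)"
    unfolding d using \<beta> by (subst integral_density) auto
  also have "\<dots> = (LBINT x. of_real (\<delta> powr \<beta>) * ((indicator {0<..} x * (\<beta> * x powr (- \<beta> - 1))) *\<^sub>R (indicator {\<delta><..} x *\<^sub>R ?f x)))"
    using \<delta> by (intro Bochner_Integration.integral_cong) (auto simp: indicator_def scaleR_conv_of_real)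
  also have "\<dots> = of_real (\<delta> powr \<beta>) * truncated_exponent \<beta> \<delta> y"
    unfolding integral_mult_right_zero truncated_exponent_def stable_levy_measure_def
    using \<beta> by (subst integral_density) auto
  finally show ?thesis by (simp add: algebra_simps)
qed

lemma truncated_exponent_tendsto:
  assumes \<beta>: "0 < \<beta>" "\<beta> < 1"
  shows "((\<lambda>\<delta>. truncated_exponent \<beta> \<delta> y) \<longlongrightarrow> of_real (Gamma (1 - \<beta>)) * (\<i> * of_real y) powr of_real \<beta>) (at_right 0)"
proof -
  interpret laplace_exponent "stable_levy_measure \<beta>" by (rule laplace_exponent_stable_levy_measure[OF \<beta>])
  let ?f = "\<lambda>x. 1 - exp (- (\<i> * of_real y * complex_of_real x))"
  have pos: "AE x in stable_levy_measure \<beta>. 0 < x"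
    unfolding stable_levy_measure_def by (subst AE_density) (auto simp: indicator_def)
  have "((\<lambda>\<delta>. truncated_exponent \<beta> \<delta> y) \<longlongrightarrow> exponent (\<i> * of_real y)) (at_right 0)"
    unfolding truncated_exponent_def exponent_def
  proof (rule integral_dominated_convergence_at_within)
    show "integrable (stable_levy_measure \<beta>) (\<lambda>x. norm (?f x))"
      by (intro integrable_norm integrable_exponent) simp
    show "AE x in stable_levy_measure \<beta>. norm (indicator {\<delta><..} x *\<^sub>R ?f x) \<le> norm (?f x)" for \<delta>
      by (intro AE_I2) (simp add: indicator_def)
    show "AE x in stable_levy_measure \<beta>. ((\<lambda>\<delta>. indicator {\<delta><..} x *\<^sub>R ?f x) \<longlongrightarrow> ?f x) (at_right 0)"
      using pos
    proof eventually_elim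
      case (elim x)
      then have "\<forall>\<^sub>F \<delta> in at_right 0. indicator {\<delta><..} x *\<^sub>R ?f x = ?f x"
        unfolding eventually_at_right_field by (intro exI[of _ x]) auto
      then show ?case by (rule tendsto_eventually)
    qed
  qed measurable
  then show ?thesis by (simp add: levy_exponent_imaginary[OF \<beta>])
qed

section \<open>Conditioning on the number of terms, the signs and the sizes\<close>

lemma indep_sign_size:
  fixes a b :: "real \<Rightarrow> complex"
  assumes "prob_space M" "indep_count_sign_size M n \<epsilon> Q"
    and [measurable]: "a \<in> borel_measurable borel" "b \<in> borel_measurable borel"
    and bound: "\<And>x. norm (a x) \<le> 1" "\<And>x. norm (b x) \<le> 1"
  shows "(\<integral>\<omega>. a (\<epsilon> j \<omega>) * b (Q j \<omega>) \<partial>M) = (\<integral>\<omega>. a (\<epsilon> j \<omega>) \<partial>M) * (\<integral>\<omega>. b (Q j \<omega>) \<partial>M)"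
proof -
  interpret prob_space M by fact
  let ?X = "\<lambda>i. case i of Count \<Rightarrow> (\<lambda>\<omega>. real (n \<omega>)) | Sign j \<Rightarrow> \<epsilon> j | Size j \<Rightarrow> Q j"
  let ?c = "\<lambda>i. case i of Sign j \<Rightarrow> a | _ \<Rightarrow> b"
  have ind: "indep_vars (\<lambda>_. borel) ?X UNIV" using assms(2) by (simp add: indep_count_sign_size_def)
  have [measurable]: "?X i \<in> borel_measurable M" for i using ind by (simp add: indep_vars_def)
  have cm [measurable]: "?c i \<in> borel_measurable borel" for i by (cases i) auto
  have "indep_vars (\<lambda>_. borel) (\<lambda>i \<omega>. ?c i (?X i \<omega>)) {Sign j, Size j}"
    by (rule indep_vars_compose2[OF indep_vars_subset[OF ind]]) auto
  moreover have "integrable M (\<lambda>\<omega>. ?c i (?X i \<omega>))" for i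
  proof (rule integrable_const_bound[of _ 1])
    show "AE \<omega> in M. norm (?c i (?X i \<omega>)) \<le> 1" using bound by (cases i) auto
  qed measurable
  ultimately have "(\<integral>\<omega>. (\<Prod>i\<in>{Sign j, Size j}. ?c i (?X i \<omega>)) \<partial>M) = (\<Prod>i\<in>{Sign j, Size j}. \<integral>\<omega>. ?c i (?X i \<omega>) \<partial>M)"
    by (intro indep_vars_lebesgue_integral) auto
  then show ?thesis by simp
qed

text \<open>Grouping turns joint independence into independence of one block for the count and one
  block per term. There are m + 1 factors because the product starts at j = 0.\<close>

lemma indep_count_product:
  fixes f :: "real \<Rightarrow> real \<Rightarrow> complex"
  assumes "prob_space M" "indep_count_sign_size M n \<epsilon> Q"
    and f [measurable]: "case_prod f \<in> borel_measurable (borel \<Otimes>\<^sub>M borel)" and bound: "\<And>x y. norm (f x y) \<le> 1"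
    and mean: "\<And>j. (\<integral>\<omega>. f (\<epsilon> j \<omega>) (Q j \<omega>) \<partial>M) = \<phi>"
  shows "(\<integral>\<omega>. indicator {m} (n \<omega>) * (\<Prod>j\<le>m. f (\<epsilon> j \<omega>) (Q j \<omega>)) \<partial>M) = of_real (measure M {\<omega> \<in> space M. n \<omega> = m}) * \<phi> ^ Suc m"
proof -
  interpret prob_space M by fact
  let ?X = "\<lambda>i. case i of Count \<Rightarrow> (\<lambda>\<omega>. real (n \<omega>)) | Sign j \<Rightarrow> \<epsilon> j | Size j \<Rightarrow> Q j"
  have ind: "indep_vars (\<lambda>_. borel) ?X UNIV" using assms(2) by (simp add: indep_count_sign_size_def)
  have Xm: "?X i \<in> borel_measurable M" for i using ind by (simp add: indep_vars_def)
  have [measurable]: "(\<lambda>\<omega>. real (n \<omega>)) \<in> borel_measurable M" "\<epsilon> j \<in> borel_measurable M" "Q j \<in> borel_measurable M" for j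
    using Xm[of Count] Xm[of "Sign j"] Xm[of "Size j"] by auto
  \<comment> \<open>\<open>None\<close> labels the count, and \<open>Some j\<close> the pair of sign
    and size in term j.\<close>
  define L where "L = insert None (Some ` {..m})"
  define K where "K l = (case l of None \<Rightarrow> {Count} | Some j \<Rightarrow> {Sign j, Size j})" for l
  define g where "g l z = (case l of None \<Rightarrow> indicator {real m} (z Count) | Some j \<Rightarrow> f (z (Sign j)) (z (Size j)))" for l and z :: "source \<Rightarrow> real"
  define Y where "Y l \<omega> = (case l of None \<Rightarrow> indicator {real m} (real (n \<omega>)) | Some j \<Rightarrow> f (\<epsilon> j \<omega>) (Q j \<omega>))" for l \<omega>
  have "disjoint_family_on K L"
    by (auto simp: disjoint_family_on_def K_def L_def)
  then have "indep_vars (\<lambda>l. PiM (K l) (\<lambda>_. borel)) (\<lambda>l \<omega>. restrict (\<lambda>i. ?X i \<omega>) (K l)) L"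
    by (intro indep_vars_restrict[OF ind]) auto
  moreover have "g l \<in> borel_measurable (PiM (K l) (\<lambda>_. borel))" if "l \<in> L" for l
  proof (cases l)
    case None
    have "(\<lambda>z. z Count) \<in> borel_measurable (PiM {Count} (\<lambda>_. borel :: real measure))"
      by (rule measurable_component_singleton) simp
    then show ?thesis using None by (simp add: g_def[abs_def] K_def)
  next
    case (Some j)
    have [measurable]: "(\<lambda>z. z (Sign j)) \<in> borel_measurable (PiM {Sign j, Size j} (\<lambda>_. borel :: real measure))"
      "(\<lambda>z. z (Size j)) \<in> borel_measurable (PiM {Sign j, Size j} (\<lambda>_. borel :: real measure))"
      by (auto intro: measurable_component_singleton)
    show ?thesis using Some by (simp add: g_def[abs_def] K_def)
  qed
  ultimately have "indep_vars (\<lambda>_. borel) (\<lambda>l \<omega>. g l (restrict (\<lambda>i. ?X i \<omega>) (K l))) L"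
    by (rule indep_vars_compose2)
  also have "(\<lambda>l \<omega>. g l (restrict (\<lambda>i. ?X i \<omega>) (K l))) = Y"
    by (auto simp: fun_eq_iff g_def Y_def K_def split: option.split)
  finally have indY: "indep_vars (\<lambda>_. borel) Y L" .
  have iY: "integrable M (Y l)" for l
  proof (rule integrable_const_bound[of _ 1])
    show "AE \<omega> in M. norm (Y l \<omega>) \<le> 1" using bound by (cases l) (auto simp: Y_def indicator_def)
    show "Y l \<in> borel_measurable M" unfolding Y_def[abs_def] by (cases l) auto
  qed
  have EY: "(\<integral>\<omega>. Y (Some j) \<omega> \<partial>M) = \<phi>" for j
    by (simp add: Y_def mean)
  have "(\<integral>\<omega>. (\<Prod>l\<in>L. Y l \<omega>) \<partial>M) = (\<Prod>l\<in>L. \<integral>\<omega>. Y l \<omega> \<partial>M)"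
    by (rule indep_vars_lebesgue_integral[OF _ indY iY]) (simp add: L_def)
  also have "(\<lambda>\<omega>. \<Prod>l\<in>L. Y l \<omega>) = (\<lambda>\<omega>. indicator {m} (n \<omega>) * (\<Prod>j\<le>m. f (\<epsilon> j \<omega>) (Q j \<omega>)))"
    by (auto simp: L_def fun_eq_iff prod.reindex Y_def indicator_def)
  also have "(\<Prod>l\<in>L. \<integral>\<omega>. Y l \<omega> \<partial>M) = (\<integral>\<omega>. Y None \<omega> \<partial>M) * \<phi> ^ Suc m"
    using EY by (simp add: L_def prod.reindex)
  also have "(\<integral>\<omega>. Y None \<omega> \<partial>M) = of_real (prob {\<omega> \<in> space M. n \<omega> = m})"
  proof -
    have "{\<omega> \<in> space M. n \<omega> = m} = {\<omega> \<in> space M. real (n \<omega>) = real m}" by auto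
    also have "\<dots> \<in> events" by measurable
    finally have ev: "{\<omega> \<in> space M. n \<omega> = m} \<in> events" .
    have "(\<integral>\<omega>. Y None \<omega> \<partial>M) = (\<integral>\<omega>. of_real (indicator {\<omega> \<in> space M. n \<omega> = m} \<omega>) \<partial>M)"
      by (intro Bochner_Integration.integral_cong) (auto simp: Y_def indicator_def)
    also have "\<dots> = of_real (prob {\<omega> \<in> space M. n \<omega> = m})"
      unfolding integral_complex_of_real using ev by simp
    finally show ?thesis .
  qed
  finally show ?thesis .
qed

text \<open>Summing over the values of the count gives the exponential series. The surplus factor
  \<phi> belongs to the extra term of the sum from 0 to n.\<close>

lemma poisson_random_product:
  fixes f :: "real \<Rightarrow> real \<Rightarrow> complex"
  assumes "prob_space M" "indep_count_sign_size M n \<epsilon> Q"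
    and [measurable]: "case_prod f \<in> borel_measurable (borel \<Otimes>\<^sub>M borel)" and bound: "\<And>x y. norm (f x y) \<le> 1"
    and mean: "\<And>j. (\<integral>\<omega>. f (\<epsilon> j \<omega>) (Q j \<omega>) \<partial>M) = \<phi>"
    and poisson: "0 < c" "\<And>m. measure M {\<omega> \<in> space M. n \<omega> = m} = pmf (poisson_pmf c) m"
  shows "(\<integral>\<omega>. (\<Prod>j\<le>n \<omega>. f (\<epsilon> j \<omega>) (Q j \<omega>)) \<partial>M) = \<phi> * exp (of_real c * (\<phi> - 1))"
proof -
  interpret prob_space M by fact
  let ?X = "\<lambda>i. case i of Count \<Rightarrow> (\<lambda>\<omega>. real (n \<omega>)) | Sign j \<Rightarrow> \<epsilon> j | Size j \<Rightarrow> Q j"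
  have Xm: "?X i \<in> borel_measurable M" for i using assms(2) by (simp add: indep_count_sign_size_def indep_vars_def)
  have [measurable]: "(\<lambda>\<omega>. real (n \<omega>)) \<in> borel_measurable M" "\<epsilon> j \<in> borel_measurable M" "Q j \<in> borel_measurable M" for j
    using Xm[of Count] Xm[of "Sign j"] Xm[of "Size j"] by auto
  let ?P = "\<lambda>m \<omega>. \<Prod>j\<le>m. f (\<epsilon> j \<omega>) (Q j \<omega>)"
  \<comment> \<open>Truncation to counts below N: each \<omega> contributes at most one summand, so
    the partial sums are bounded by 1 and eventually equal to the full product.\<close>
  let ?S = "\<lambda>N \<omega>. \<Sum>m<N. indicator {m} (n \<omega>) * ?P m \<omega>"
  have S_eq: "?S N \<omega> = (if n \<omega> < N then ?P (n \<omega>) \<omega> else 0)" for N \<omega>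
  proof -
    have "?S N \<omega> = (\<Sum>m<N. if m = n \<omega> then ?P (n \<omega>) \<omega> else 0)"
      by (intro sum.cong) (auto simp: indicator_def)
    then show ?thesis by (simp add: sum.delta)
  qed
  have P1: "norm (?P m \<omega>) \<le> 1" for m \<omega>
    unfolding prod_norm[symmetric] by (intro prod_le_1) (auto simp: bound)
  have ind_meas [measurable]: "(\<lambda>\<omega>. indicator {m} (n \<omega>) * ?P m \<omega>) \<in> borel_measurable M" for m
  proof -
    have "(\<lambda>\<omega>. indicator {real m} (real (n \<omega>)) * ?P m \<omega>) \<in> borel_measurable M" by measurable
    also have "(\<lambda>\<omega>. indicator {real m} (real (n \<omega>)) * ?P m \<omega>) = (\<lambda>\<omega>. indicator {m} (n \<omega>) * ?P m \<omega>)"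
      by (auto simp: indicator_def fun_eq_iff)
    finally show ?thesis .
  qed
  have S_lim: "(\<lambda>N. ?S N \<omega>) \<longlonglongrightarrow> ?P (n \<omega>) \<omega>" for \<omega>
    unfolding S_eq by (rule tendsto_eventually) (auto simp: eventually_sequentially intro!: exI[of _ "Suc (n \<omega>)"])
  have "(\<lambda>N. \<integral>\<omega>. ?S N \<omega> \<partial>M) \<longlonglongrightarrow> (\<integral>\<omega>. ?P (n \<omega>) \<omega> \<partial>M)"
  proof (rule integral_dominated_convergence[where w = "\<lambda>_. 1"])
    show "(\<lambda>\<omega>. ?P (n \<omega>) \<omega>) \<in> borel_measurable M"
      by (rule borel_measurable_LIMSEQ_metric[OF _ S_lim]) measurable
    show "AE \<omega> in M. norm (?S N \<omega>) \<le> 1" for N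
      unfolding S_eq using P1 by auto
    show "?S N \<in> borel_measurable M" for N by measurable
    show "AE \<omega> in M. (\<lambda>N. ?S N \<omega>) \<longlonglongrightarrow> ?P (n \<omega>) \<omega>" by (intro AE_I2 S_lim)
  qed simp
  moreover have "(\<integral>\<omega>. ?S N \<omega> \<partial>M) = (\<Sum>m<N. \<phi> * exp (- of_real c) * ((of_real c * \<phi>) ^ m /\<^sub>R fact m))" for N
  proof -
    have "integrable M (\<lambda>\<omega>. indicator {m} (n \<omega>) * ?P m \<omega>)" for m
    proof (rule integrable_const_bound[of _ 1])
      show "AE \<omega> in M. norm (indicator {m} (n \<omega>) * ?P m \<omega>) \<le> 1"
        using P1 by (auto simp: indicator_def norm_mult)
    qed measurable
    then have "(\<integral>\<omega>. ?S N \<omega> \<partial>M) = (\<Sum>m<N. \<integral>\<omega>. indicator {m} (n \<omega>) * ?P m \<omega> \<partial>M)"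
      by (intro Bochner_Integration.integral_sum)
    also have "\<dots> = (\<Sum>m<N. of_real (c ^ m / fact m * exp (- c)) * \<phi> ^ Suc m)"
      using poisson(1) by (simp only: indep_count_product[OF assms(1-5)] poisson(2) pmf_poisson)
    also have "\<dots> = (\<Sum>m<N. \<phi> * exp (- of_real c) * ((of_real c * \<phi>) ^ m /\<^sub>R fact m))"
      by (intro sum.cong) (simp_all add: power_mult_distrib scaleR_conv_of_real divide_inverse mult_ac exp_of_real[symmetric])
    finally show ?thesis .
  qed
  moreover have "(\<lambda>N. \<Sum>m<N. \<phi> * exp (- of_real c) * ((of_real c * \<phi>) ^ m /\<^sub>R fact m)) \<longlonglongrightarrow> \<phi> * exp (- of_real c) * exp (of_real c * \<phi>)"
    using sums_mult[OF exp_converges[of "of_real c * \<phi>"]] unfolding sums_def .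
  ultimately have "(\<integral>\<omega>. ?P (n \<omega>) \<omega> \<partial>M) = \<phi> * exp (- of_real c) * exp (of_real c * \<phi>)"
    using LIMSEQ_unique by simp
  then show ?thesis by (simp add: right_diff_distrib exp_diff exp_minus field_simps)
qed

section \<open>The limiting law\<close>

text \<open>Used twice: for the integrability of the limiting transform over frequency, and for that
  of the Laplace transform, which yields the moment of order -1.\<close>

lemma stretched_exp_integrable:
  assumes "0 < c" "0 < a"
  shows "integrable lborel (\<lambda>x::real. exp (- (c * \<bar>x\<bar> powr a)))"
proof -
  have "((\<lambda>x. exp (- (c * x powr a)) * (1 + x\<^sup>2)) \<longlongrightarrow> 0) at_top" using assms by real_asymp
  then have "\<forall>\<^sub>F x in at_top. exp (- (c * x powr a)) * (1 + x\<^sup>2) < 1" by (rule order_tendstoD) simp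
  then obtain X where X: "\<And>x. X \<le> x \<Longrightarrow> exp (- (c * x powr a)) * (1 + x\<^sup>2) < 1"
    by (auto simp: eventually_at_top_linorder)
  have bound: "exp (- (c * \<bar>x\<bar> powr a)) \<le> (2 + X\<^sup>2) * inverse (1 + x\<^sup>2)" for x
  proof -
    have "exp (- (c * \<bar>x\<bar> powr a)) * (1 + x\<^sup>2) \<le> 2 + X\<^sup>2"
    proof (cases "X \<le> \<bar>x\<bar>")
      case True
      have "exp (- (c * \<bar>x\<bar> powr a)) * (1 + x\<^sup>2) < 1" using X[OF True] by simp
      then show ?thesis using zero_le_power2[of X] by linarith
    next
      case False
      then have "x\<^sup>2 \<le> X\<^sup>2" using power_mono[of "\<bar>x\<bar>" X 2] by simp
      moreover have "exp (- (c * \<bar>x\<bar> powr a)) * (1 + x\<^sup>2) \<le> 1 * (1 + x\<^sup>2)"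
        using assms by (intro mult_right_mono) auto
      ultimately show ?thesis by simp
    qed
    moreover have "0 < 1 + x\<^sup>2" by (simp add: add_pos_nonneg)
    ultimately show ?thesis by (simp add: field_simps)
  qed
  show ?thesis
  proof (rule Bochner_Integration.integrable_bound)
    show "integrable lborel (\<lambda>x::real. (2 + X\<^sup>2) * inverse (1 + x\<^sup>2))"
      by (intro integrable_mult_right integrable_inverse_1_plus_sq)
    show "AE x in lborel. norm (exp (- (c * \<bar>x\<bar> powr a))) \<le> norm ((2 + X\<^sup>2) * inverse (1 + x\<^sup>2))"
      unfolding real_norm_def abs_exp_cancel by (intro AE_I2 order_trans[OF bound abs_ge_self])
  qed measurable
qed

lemma abs_powr_integrable_near_0:
  assumes "0 < a"
  shows "integrable lborel (\<lambda>x::real. indicator {-1..1} x * \<bar>x\<bar> powr (a - 1))"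
proof -
  have "set_integrable lborel (einterval (ereal 0) (ereal 1)) (\<lambda>x. x powr (a - 1))"
  proof (rule interval_integral_FTC_nonneg(1)[where F = "\<lambda>x. 1 / a * x powr a"])
    fix x assume "ereal 0 < ereal x"
    then have x: "0 < x" by simp
    show "((\<lambda>x. 1 / a * x powr a) has_real_derivative x powr (a - 1)) (at x)"
      using DERIV_cmult[OF DERIV_powr_const[OF x, of a], of "1 / a"] assms by simp
    show "isCont (\<lambda>x. x powr (a - 1)) x" using x by (auto intro!: continuous_intros)
  next
    show "(((\<lambda>x. 1 / a * x powr a) \<circ> real_of_ereal) \<longlongrightarrow> 0) (at_right (ereal 0))"
      unfolding ereal_tendsto_simps using assms by real_asymp
    show "(((\<lambda>x. 1 / a * x powr a) \<circ> real_of_ereal) \<longlongrightarrow> 1 / a) (at_left (ereal 1))"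
      unfolding ereal_tendsto_simps using assms by (auto intro!: tendsto_eq_intros)
  qed auto
  then have 1: "integrable lborel (\<lambda>x. indicator {0<..<1} x * x powr (a - 1))"
    by (simp add: set_integrable_def)
  have 2: "integrable lborel (\<lambda>x. indicator {0<..<1} (- x) * (- x) powr (a - 1))"
    using lborel_integrable_real_affine[OF 1, of "-1" 0] by simp
  have "AE x in lborel. x \<noteq> -1 \<and> x \<noteq> 1 \<and> x \<noteq> (0::real)"
    by (intro AE_conjI AE_lborel_singleton)
  then have "AE x in lborel. indicator {0<..<1} x * x powr (a - 1) + indicator {0<..<1} (- x) * (- x) powr (a - 1) = indicator {-1..1} x * \<bar>x\<bar> powr (a - 1)"
    by eventually_elim (auto simp: indicator_def abs_if)
  then show ?thesis
    by (rule integrable_cong_AE_imp[OF Bochner_Integration.integrable_add[OF 1 2], rotated]) measurable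
qed

lemma abs_power_powr: "\<bar>x ^ n\<bar> powr \<beta> = \<bar>x::real\<bar> powr (\<beta> * real n)" if "0 < n"
proof (cases "x = 0")
  case False
  then have "\<bar>x ^ n\<bar> = \<bar>x\<bar> powr real n" by (simp add: power_abs powr_realpow)
  then show ?thesis by (simp add: powr_powr mult.commute)
qed (use that in simp)

definition stable_transform :: "nat \<Rightarrow> real \<Rightarrow> real \<Rightarrow> real \<Rightarrow> complex" where
  "stable_transform n \<beta> r v = exp (- (of_real r * (\<i> * of_real (v ^ n)) powr of_real \<beta>))"

context
  fixes n :: nat and \<beta> r :: real
  assumes n: "0 < n" and \<beta>: "0 < \<beta>" "\<beta> < 1" and r: "0 < r"
begin

lemma stable_transform_eq:
  "stable_transform n \<beta> r v = exp (- (of_real r * (of_real (\<bar>v\<bar> powr (\<beta> * real n))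
     * (of_real (cos (\<beta> * pi / 2)) + \<i> * of_real (sgn (v ^ n) * sin (\<beta> * pi / 2))))))"
  by (simp only: stable_transform_def imaginary_powr[OF \<beta>(1)] abs_power_powr[OF n])

lemma cos_half_angle_pos: "0 < cos (\<beta> * pi / 2)"
proof (rule cos_gt_zero_pi)
  have "0 < \<beta> * pi" "\<beta> * pi < pi" using \<beta> mult_strict_right_mono[of \<beta> 1 pi] by auto
  then show "- (pi / 2) < \<beta> * pi / 2" "\<beta> * pi / 2 < pi / 2" by linarith+
qed

lemma norm_stable_transform: "norm (stable_transform n \<beta> r v) = exp (- (r * cos (\<beta> * pi / 2) * \<bar>v\<bar> powr (\<beta> * real n)))"
  unfolding stable_transform_eq by (simp add: mult_ac)

lemma borel_measurable_stable_transform [measurable]: "stable_transform n \<beta> r \<in> borel_measurable borel"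
  unfolding stable_transform_eq[abs_def] by measurable

lemma integrable_stable_transform: "integrable lborel (stable_transform n \<beta> r)"
proof (rule Bochner_Integration.integrable_bound)
  show "integrable lborel (\<lambda>v. exp (- (r * cos (\<beta> * pi / 2) * \<bar>v\<bar> powr (\<beta> * real n))))"
    using cos_half_angle_pos r \<beta> n by (intro stretched_exp_integrable) auto
qed (auto simp: norm_stable_transform)

text \<open>At \<xi> = 0 differentiability may fail, but the increment is at most 2 r |v|^(\<beta>
  n), so the quotient is dominated by an integrable power. Elsewhere the transform is differentiable
  and the quotient is bounded.\<close>

lemma stable_transform_Dini:
  "\<exists>d>0. set_integrable lborel {-d..d} (\<lambda>v. (stable_transform n \<beta> r (\<xi> - v) - stable_transform n \<beta> r \<xi>) / of_real v)"
proof -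
  let ?S = "stable_transform n \<beta> r"
  let ?q = "\<lambda>v. (?S (\<xi> - v) - ?S \<xi>) / of_real v"
  show ?thesis
  proof (cases "\<xi> = 0")
  case True
  define a where "a = \<beta> * real n"
  have a: "0 < a" using \<beta> n by (simp add: a_def)
  have "set_integrable lborel {-1..1} (\<lambda>v. (?S (0 - v) - ?S 0) / of_real v)"
    unfolding set_integrable_def
  proof (rule Bochner_Integration.integrable_bound)
    show "integrable lborel (\<lambda>v::real. 2 * r * (indicator {-1..1} v * \<bar>v\<bar> powr (a - 1)))"
      by (intro integrable_mult_right abs_powr_integrable_near_0 a)
    show "AE v in lborel. norm (indicator {-1..1} v *\<^sub>R ((?S (0 - v) - ?S 0) / of_real v)) \<le> norm (2 * r * (indicator {-1..1} v * \<bar>v\<bar> powr (a - 1)))"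
    proof (rule AE_I2)
      fix v :: real
      define w where "w = of_real r * (of_real (\<bar>- v\<bar> powr a) * (of_real (cos (\<beta> * pi / 2)) + \<i> * of_real (sgn ((- v) ^ n) * sin (\<beta> * pi / 2))))"
      have "?S (0 - v) = exp (- w)" unfolding stable_transform_eq w_def a_def by simp
      moreover have "?S 0 = 1" using n \<beta> by (simp add: stable_transform_def zero_power)
      moreover have "0 \<le> Re w" using r cos_half_angle_pos by (simp add: w_def)
      ultimately have 1: "norm (?S (0 - v) - ?S 0) \<le> norm w"
        using norm_one_minus_exp_le(1)[of w] by (simp add: norm_minus_commute)
      have 2: "norm (complex_of_real (cos (\<beta> * pi / 2)) + \<i> * of_real (sgn ((- v) ^ n) * sin (\<beta> * pi / 2))) \<le> 1 + 1"
      proof (rule norm_triangle_mono)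
        show "norm (complex_of_real (cos (\<beta> * pi / 2))) \<le> 1" by simp
        have "\<bar>sgn ((- v) ^ n)\<bar> * \<bar>sin (\<beta> * pi / 2)\<bar> \<le> 1 * 1"
          by (intro mult_mono) (auto simp: sgn_if)
        then show "norm (\<i> * complex_of_real (sgn ((- v) ^ n) * sin (\<beta> * pi / 2))) \<le> 1"
          by (simp only: norm_mult norm_of_real norm_ii abs_mult mult_1_left)
      qed
      have "norm w \<le> r * (\<bar>v\<bar> powr a * 2)"
        unfolding w_def norm_mult using 2 r by (auto intro!: mult_left_mono)
      with 1 have "norm (?S (0 - v) - ?S 0) / \<bar>v\<bar> \<le> r * (\<bar>v\<bar> powr a * 2) / \<bar>v\<bar>"
        by (intro divide_right_mono) auto
      also have "\<dots> = 2 * r * \<bar>v\<bar> powr (a - 1)"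
        by (cases "v = 0") (auto simp: powr_diff)
      finally show "norm (indicator {-1..1} v *\<^sub>R ((?S (0 - v) - ?S 0) / of_real v)) \<le> norm (2 * r * (indicator {-1..1} v * \<bar>v\<bar> powr (a - 1)))"
        using r by (simp add: indicator_def norm_divide abs_mult)
    qed
  qed measurable
  then show ?thesis using True by (intro exI[of _ 1]) simp
next
  case False
  \<comment> \<open>An extension to complex arguments: for \<xi> \<noteq> 0 the point i \<xi>^n is
    off the branch cut, so complex differentiation rules give the bound on real increments.\<close>
  define G where "G z = exp (- (of_real r * (\<i> * z ^ n) powr of_real \<beta>))" for z :: complex
  have G: "?S v = G (of_real v)" for v
    by (simp add: G_def stable_transform_def)
  have "\<i> * of_real \<xi> ^ n \<notin> \<real>\<^sub>\<le>\<^sub>0"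
    using False by (simp add: complex_nonpos_Reals_iff flip: of_real_power)
  then have "\<exists>D. (G has_field_derivative D) (at (of_real \<xi>))"
    unfolding G_def[abs_def] by (intro exI) (rule derivative_eq_intros refl | simp)+
  then obtain D where "((\<lambda>z. (G z - G (of_real \<xi>)) / (z - of_real \<xi>)) \<longlongrightarrow> D) (at (of_real \<xi>))"
    unfolding has_field_derivative_iff by blast
  then have "\<forall>\<^sub>F z in at (of_real \<xi>). dist ((G z - G (of_real \<xi>)) / (z - of_real \<xi>)) D < 1"
    by (rule tendstoD) simp
  then obtain d where d: "0 < d" "\<And>z. z \<noteq> of_real \<xi> \<Longrightarrow> dist z (of_real \<xi>) < d \<Longrightarrow> dist ((G z - G (of_real \<xi>)) / (z - of_real \<xi>)) D < 1"
    unfolding eventually_at by blast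
  have bound: "norm (?q v) \<le> norm D + 1" if "\<bar>v\<bar> < d" for v
  proof (cases "v = 0")
    case False
    have "dist ((G (of_real (\<xi> - v)) - G (of_real \<xi>)) / (of_real (\<xi> - v) - of_real \<xi>)) D < 1"
      by (rule d(2)) (use False that in \<open>auto simp: dist_norm\<close>)
    then have "norm ((G (of_real (\<xi> - v)) - G (of_real \<xi>)) / (of_real (\<xi> - v) - of_real \<xi>)) \<le> norm D + 1"
      using norm_triangle_ineq2[of "(G (of_real (\<xi> - v)) - G (of_real \<xi>)) / (of_real (\<xi> - v) - of_real \<xi>)" D] by (simp add: dist_norm)
    then show ?thesis by (simp add: G norm_divide)
  qed simp
  have "set_integrable lborel {-(d/2)..d/2} (\<lambda>v. ?q v)"
    unfolding set_integrable_def
  proof (rule Bochner_Integration.integrable_bound)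
    show "integrable lborel (\<lambda>v::real. (norm D + 1) * indicator {-(d/2)..d/2} v)"
      by (intro integrable_mult_right integrable_real_indicator) (auto simp: emeasure_lborel_Icc_eq)
    show "AE v in lborel. norm (indicator {-(d/2)..d/2} v *\<^sub>R (?q v)) \<le> norm ((norm D + 1) * indicator {-(d/2)..d/2} v)"
    proof (rule AE_I2)
      fix v
      show "norm (indicator {-(d/2)..d/2} v *\<^sub>R (?q v)) \<le> norm ((norm D + 1) * indicator {-(d/2)..d/2} v)"
      proof (cases "v \<in> {-(d/2)..d/2}")
        case True
        then have "\<bar>v\<bar> < d" using d(1) by auto
        from bound[OF this] True show ?thesis by simp
      qed simp
    qed
  qed measurable
  then show ?thesis using d(1) by (intro exI[of _ "d/2"]) simp
qed
qed

end

section \<open>The law of the pseudoprocess at the random time\<close>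

locale stable_density =
  fixes \<beta> r :: real and g :: "real \<Rightarrow> real" and \<nu> :: "real measure"
  assumes \<beta>: "0 < \<beta>" "\<beta> < 1" and r: "0 < r"
    and g_nonneg: "\<And>s. 0 \<le> g s" and g_meas [measurable]: "g \<in> borel_measurable borel"
    and \<nu>_def: "\<nu> = density lborel (\<lambda>s. ennreal (g s))"
    and prob: "prob_space \<nu>" and nonneg: "AE s in \<nu>. 0 \<le> s"
    and laplace: "\<And>\<mu>. 0 \<le> \<mu> \<Longrightarrow> (\<integral>x. exp (- (\<mu> * x)) \<partial>\<nu>) = exp (- (r * \<mu> powr \<beta>))"
begin

sublocale prob_space \<nu> by (rule prob)

lemma sets_\<nu> [measurable_cong, simp]: "sets \<nu> = sets borel"
  by (simp add: \<nu>_def)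

lemma g_integrable: "integrable lborel g"
proof -
  have "integrable \<nu> (\<lambda>_. 1::real)" by simp
  then show ?thesis unfolding \<nu>_def by (subst (asm) integrable_density) (auto simp: g_nonneg)
qed

lemma g_zero: "AE s in lborel. s < 0 \<longrightarrow> g s = 0"
proof -
  have "AE s in lborel. 0 < ennreal (g s) \<longrightarrow> 0 \<le> s"
    using nonneg unfolding \<nu>_def by (subst (asm) AE_density) auto
  then show ?thesis by eventually_elim (use g_nonneg in \<open>force simp: order.order_iff_strict\<close>)
qed

text \<open>The moment of order \<open>-1\<close> is the integral of the Laplace transform.\<close>

lemma g_over_s_integrable: "integrable lborel (\<lambda>s. g s / s)"
proof -
  interpret P: pair_sigma_finite \<nu> lborel ..
  \<comment> \<open>For s > 0, 1 / s is the integral of exp (-\<mu> s) over \<mu> \<ge> 0.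
    Nonnegative integrals allow the exchange before finiteness is known.\<close>
  have "(\<integral>\<^sup>+s. ennreal (1 / s) * indicator {0<..} s \<partial>\<nu>) \<le> (\<integral>\<^sup>+s. (\<integral>\<^sup>+\<mu>. ennreal (exp (- (\<mu> * s))) * indicator {0..} \<mu> \<partial>lborel) \<partial>\<nu>)"
  proof (rule nn_integral_mono)
    fix s :: real
    show "ennreal (1 / s) * indicator {0<..} s \<le> (\<integral>\<^sup>+\<mu>. ennreal (exp (- (\<mu> * s))) * indicator {0..} \<mu> \<partial>lborel)"
    proof (cases "0 < s")
      case True
      have "(\<integral>\<^sup>+\<mu>. ennreal (exp (- (\<mu> * s))) * indicator {0..} \<mu> \<partial>lborel) = ennreal (0 - - (exp (- (0 * s)) / s))"
      proof (rule nn_integral_FTC_atLeast)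
        show "((\<lambda>\<mu>. - (exp (- (\<mu> * s)) / s)) has_real_derivative exp (- (x * s))) (at x)" for x
          using True by (auto intro!: derivative_eq_intros)
        show "((\<lambda>\<mu>. - (exp (- (\<mu> * s)) / s)) \<longlongrightarrow> 0) at_top" using True by real_asymp
      qed auto
      then show ?thesis using True by simp
    qed simp
  qed
  also have "\<dots> = (\<integral>\<^sup>+\<mu>. (\<integral>\<^sup>+s. ennreal (exp (- (\<mu> * s))) * indicator {0..} \<mu> \<partial>\<nu>) \<partial>lborel)"
    by (rule P.Fubini'[symmetric]) measurable
  also have "\<dots> \<le> (\<integral>\<^sup>+\<mu>. ennreal (exp (- (r * \<bar>\<mu>\<bar> powr \<beta>))) \<partial>lborel)"
  proof (rule nn_integral_mono)
    fix \<mu> :: real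
    show "(\<integral>\<^sup>+s. ennreal (exp (- (\<mu> * s))) * indicator {0..} \<mu> \<partial>\<nu>) \<le> ennreal (exp (- (r * \<bar>\<mu>\<bar> powr \<beta>)))"
    proof (cases "0 \<le> \<mu>")
      case True
      have "integrable \<nu> (\<lambda>s. exp (- (\<mu> * s)))"
      proof (rule integrable_const_bound)
        show "AE s in \<nu>. norm (exp (- (\<mu> * s))) \<le> 1" using nonneg True by (auto elim!: eventually_mono)
      qed measurable
      then have "(\<integral>\<^sup>+s. ennreal (exp (- (\<mu> * s))) \<partial>\<nu>) = ennreal (exp (- (r * \<mu> powr \<beta>)))"
        using laplace[OF True] by (subst nn_integral_eq_integral) auto
      then show ?thesis using True by simp
    qed simp
  qed
  also have "\<dots> < \<infinity>"
    using stretched_exp_integrable[OF r \<beta>(1)] by (simp add: integrable_iff_bounded)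
  finally have fin: "(\<integral>\<^sup>+s. ennreal (1 / s) * indicator {0<..} s \<partial>\<nu>) < \<infinity>" .
  have "(\<integral>\<^sup>+s. ennreal (norm (g s / s)) \<partial>lborel) = (\<integral>\<^sup>+s. ennreal (g s) * (ennreal (1 / s) * indicator {0<..} s) \<partial>lborel)"
  proof (rule nn_integral_cong_AE)
    show "AE s in lborel. ennreal (norm (g s / s)) = ennreal (g s) * (ennreal (1 / s) * indicator {0<..} s)"
      using g_zero
    proof eventually_elim
      case (elim s)
      then consider "0 < s" | "s = 0" | "g s = 0" by force
      then show ?case
        by cases (use g_nonneg[of s] in \<open>auto simp: ennreal_mult[symmetric]\<close>)
    qed
  qed
  also have "\<dots> = (\<integral>\<^sup>+s. ennreal (1 / s) * indicator {0<..} s \<partial>\<nu>)"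
    unfolding \<nu>_def by (rule nn_integral_density[symmetric]) measurable
  finally show ?thesis using fin by (simp add: integrable_iff_bounded)
qed

lemma characteristic_function:
  "(LBINT s:{0<..}. exp (- (\<i> * of_real (s * y))) * of_real (g s)) = exp (- (of_real r * (\<i> * of_real y) powr of_real \<beta>))"
proof -
  have "(LBINT s:{0<..}. exp (- (\<i> * of_real (s * y))) * of_real (g s)) = (LBINT s. g s *\<^sub>R exp (- (\<i> * complex_of_real (y * s))))"
    unfolding set_lebesgue_integral_def
  proof (rule integral_cong_AE)
    have "AE s in lborel. s \<noteq> (0::real)" by (rule AE_lborel_singleton)
    with g_zero show "AE s in lborel. indicator {0<..} s *\<^sub>R (exp (- (\<i> * of_real (s * y))) * of_real (g s)) = g s *\<^sub>R exp (- (\<i> * complex_of_real (y * s)))"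
      by eventually_elim (auto simp: indicator_def scaleR_conv_of_real mult.commute)
  qed measurable
  also have "\<dots> = (\<integral>s. exp (- (\<i> * complex_of_real (y * s))) \<partial>\<nu>)"
    unfolding \<nu>_def by (rule integral_density[symmetric]) (auto simp: g_nonneg)
  also have "\<dots> = exp (- (of_real r * (\<i> * of_real y) powr of_real \<beta>))"
    using prob nonneg \<beta> laplace by (intro stable_characteristic_function) auto
  finally show ?thesis .
qed

end

lemma fourier_subordinated:
  assumes "odd_order_kernel n u" "stable_density \<beta> r g \<nu>"
  shows "fourier (\<lambda>x. LBINT s:{0..}. u x s * g s) \<xi> = stable_transform n \<beta> r \<xi>"
proof -
  interpret odd_order_kernel n u by fact
  interpret stable_density \<beta> r g \<nu> by fact
  have cf: "(LBINT s:{0<..}. exp (- (\<i> * of_real (s * v ^ n))) * of_real (g s)) = stable_transform n \<beta> r v" for v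
    unfolding stable_transform_def by (rule characteristic_function)
  have \<Psi>: "integrable lborel (stable_transform n \<beta> r)"
    by (rule integrable_stable_transform[OF n_pos \<beta> r])
  have w: "complex_of_real (LBINT s:{0..}. u x s * g s) = (LBINT v. stable_transform n \<beta> r v * cis (- (v * x))) / (2 * pi)" for x
  proof -
    \<comment> \<open>Nothing is known about \<open>u x 0\<close>; the point has measure
      zero.\<close>
    have "(LBINT s:{0..}. u x s * g s) = (LBINT s:{0<..}. u x s * g s)"
      unfolding set_lebesgue_integral_def by (rule integral_discrete_difference[of "{0}"]) (auto simp: indicator_def)
    then show ?thesis
      using subordinated_density_inversion[OF g_meas g_integrable g_over_s_integrable, of x] \<Psi> by (simp only: cf)
  qed
  obtain d where d: "0 < d" "set_integrable lborel {-d..d} (\<lambda>v. (stable_transform n \<beta> r (\<xi> - v) - stable_transform n \<beta> r \<xi>) / of_real v)"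
    using stable_transform_Dini[OF n_pos \<beta> r] by blast
  show ?thesis
    unfolding fourier_def w by (rule integral_unique[OF fourier_inversion_Dini[OF \<Psi> d]])
qed

text \<open>Continuity in x is the case m = 0 of the smoothness clause; continuity in time comes
  from the time derivative in the equation.\<close>

lemma fundamental_solution_kernel:
  assumes "fundamental_solution k u"
  shows "odd_order_kernel (2 * k + 1) u"
proof
  fix s :: real assume s: "0 < s"
  have "((deriv ^^ 0) (\<lambda>y. u y s)) differentiable (at x)" for x
    using assms s unfolding fundamental_solution_def by blast
  then show "continuous_on UNIV (\<lambda>x. u x s)"
    by (auto intro!: continuous_at_imp_continuous_on differentiable_imp_continuous_within)
  show "bounded (range (\<lambda>x. u x s))"
    using assms s unfolding fundamental_solution_def by blast
  fix \<xi>
  show "((\<lambda>x. cis (\<xi> * x) * complex_of_real (u x s)) has_integral exp (- (\<i> * complex_of_real (s * \<xi> ^ (2 * k + 1))))) UNIV"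
    using assms s unfolding fundamental_solution_def by blast
next
  fix x
  have "isCont (\<lambda>s. u x s) s" if "0 < s" for s
    using assms that unfolding fundamental_solution_def by (blast intro: DERIV_isCont)
  then show "continuous_on {0<..} (\<lambda>s. u x s)"
    by (intro continuous_at_imp_continuous_on) auto
qed simp

lemma stable_subordinator_density:
  assumes "0 < \<beta>" "\<beta> < 1" and "prob_space M" and H: "stable_subordinator M \<beta> H"
    and h: "\<And>s. 0 \<le> h s" "distributed M lborel (H r) (\<lambda>s. ennreal (h s))" and r: "0 < r"
  shows "stable_density \<beta> r h (density lborel (\<lambda>s. ennreal (h s)))"
proof -
  interpret prob_space M by fact
  have Hm [measurable]: "H r \<in> borel_measurable M"
    using H r unfolding stable_subordinator_def by auto
  have \<nu>: "density lborel (\<lambda>s. ennreal (h s)) = distr M lborel (H r)"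
    using h(2) by (simp add: distributed_def)
  have "(\<lambda>s. ennreal (h s)) \<in> borel_measurable borel"
    using h(2) by (simp add: distributed_def)
  \<comment> \<open>Measurability is known only after the embedding by \<open>ennreal\<close>;
    nonnegativity of \<open>h\<close> lets it be undone.\<close>
  then have "(\<lambda>s. enn2real (ennreal (h s))) \<in> borel_measurable borel" by measurable
  then have hm: "h \<in> borel_measurable borel" using h(1) by simp
  have ae: "AE \<omega> in M. H 0 \<omega> = 0 \<and> mono_on {0..} (\<lambda>s. H s \<omega>) \<and> (\<forall>s\<ge>0. continuous (at_right s) (\<lambda>r. H r \<omega>))"
    using H unfolding stable_subordinator_def by blast
  show ?thesis
  proof (rule stable_density.intro)
    show "prob_space (density lborel (\<lambda>s. ennreal (h s)))"
      unfolding \<nu> by (rule prob_space_distr) simp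
    have "AE \<omega> in M. 0 \<le> H r \<omega>"
      using ae
    proof eventually_elim
      case (elim \<omega>)
      then show ?case using mono_onD[of "{0..}" "\<lambda>s. H s \<omega>" 0 r] r by simp
    qed
    then show "AE s in density lborel (\<lambda>s. ennreal (h s)). 0 \<le> s"
      unfolding \<nu> by (subst AE_distr_iff) auto
    fix \<mu> :: real assume \<mu>: "0 \<le> \<mu>"
    have "(\<integral>x. exp (- (\<mu> * x)) \<partial>density lborel (\<lambda>s. ennreal (h s))) = (\<integral>\<omega>. exp (- (\<mu> * H r \<omega>)) \<partial>M)"
      unfolding \<nu> by (rule integral_distr) auto
    also have "\<dots> = (\<integral>\<omega>. exp (- \<mu> * (H r \<omega> - H 0 \<omega>)) \<partial>M)"
    proof (rule integral_cong_AE)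
      have "H 0 \<in> borel_measurable M" using H unfolding stable_subordinator_def by auto
      then show "(\<lambda>\<omega>. exp (- \<mu> * (H r \<omega> - H 0 \<omega>))) \<in> borel_measurable M" by measurable
      show "AE \<omega> in M. exp (- (\<mu> * H r \<omega>)) = exp (- \<mu> * (H r \<omega> - H 0 \<omega>))"
        using ae by eventually_elim simp
    qed measurable
    also have "\<dots> = exp (- (r - 0) * \<mu> powr \<beta>)"
      using H r \<mu> unfolding stable_subordinator_def by blast
    finally show "(\<integral>x. exp (- (\<mu> * x)) \<partial>density lborel (\<lambda>s. ennreal (h s))) = exp (- (r * \<mu> powr \<beta>))"
      by simp
  qed (use assms hm in auto)
qed

section \<open>The terms of the sum and the limit\<close>

text \<open>Splitting by the sign: for odd m a negative sign passes through the power and reverses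
  y.\<close>

lemma signed_power_mean:
  assumes "prob_space M" "indep_count_sign_size M n \<epsilon> Q"
    and p: "measure M {\<omega> \<in> space M. \<epsilon> j \<omega> = 1} = p" and q: "measure M {\<omega> \<in> space M. \<epsilon> j \<omega> = - 1} = q" and "p + q = 1"
    and "odd m"
  shows "(\<integral>\<omega>. exp (- (\<i> * of_real (y * (\<epsilon> j \<omega> * Q j \<omega>) ^ m))) \<partial>M)
    = of_real p * (\<integral>\<omega>. exp (- (\<i> * of_real (y * Q j \<omega> ^ m))) \<partial>M) + of_real q * (\<integral>\<omega>. exp (- (\<i> * of_real (- y * Q j \<omega> ^ m))) \<partial>M)"
proof -
  interpret prob_space M by fact
  let ?X = "\<lambda>i. case i of Count \<Rightarrow> (\<lambda>\<omega>. real (n \<omega>)) | Sign j \<Rightarrow> \<epsilon> j | Size j \<Rightarrow> Q j"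
  have Xm: "?X i \<in> borel_measurable M" for i using assms(2) by (simp add: indep_count_sign_size_def indep_vars_def)
  have [measurable]: "\<epsilon> j \<in> borel_measurable M" "Q j \<in> borel_measurable M"
    using Xm[of "Sign j"] Xm[of "Size j"] by auto
  define a where "a c x = complex_of_real (indicator {c} x)" for c x :: real
  define b where "b y x = exp (- (\<i> * complex_of_real (y * x ^ m)))" for y x :: real
  have [measurable]: "a c \<in> borel_measurable borel" "b y \<in> borel_measurable borel" for c y
    unfolding a_def[abs_def] b_def[abs_def] by measurable
  have ab: "norm (a c x) \<le> 1" "norm (b y x) \<le> 1" for c y x
    by (auto simp: a_def b_def indicator_def)
  have mean_a: "(\<integral>\<omega>. a c (\<epsilon> j \<omega>) \<partial>M) = of_real (prob {\<omega> \<in> space M. \<epsilon> j \<omega> = c})" for c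
  proof -
    have "(\<integral>\<omega>. a c (\<epsilon> j \<omega>) \<partial>M) = (\<integral>\<omega>. of_real (indicator {\<omega> \<in> space M. \<epsilon> j \<omega> = c} \<omega>) \<partial>M)"
      by (intro Bochner_Integration.integral_cong) (auto simp: a_def indicator_def)
    also have "\<dots> = of_real (prob {\<omega> \<in> space M. \<epsilon> j \<omega> = c})"
      unfolding integral_complex_of_real by simp
    finally show ?thesis .
  qed
  have i: "integrable M (\<lambda>\<omega>. a c (\<epsilon> j \<omega>) * b y (Q j \<omega>))" for c y
  proof (rule integrable_const_bound[of _ 1])
    show "AE \<omega> in M. norm (a c (\<epsilon> j \<omega>) * b y (Q j \<omega>)) \<le> 1"
      using mult_mono[OF ab(1) ab(2)] by (intro AE_I2) (simp add: norm_mult)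
  qed measurable
  have indep: "(\<integral>\<omega>. a c (\<epsilon> j \<omega>) * b y (Q j \<omega>) \<partial>M) = of_real (prob {\<omega> \<in> space M. \<epsilon> j \<omega> = c}) * (\<integral>\<omega>. b y (Q j \<omega>) \<partial>M)" for c y
    unfolding mean_a[symmetric] by (rule indep_sign_size[OF assms(1,2)]) (auto simp: ab)
  \<comment> \<open>As p + q = 1, the sign almost surely takes no third value.\<close>
  have "prob ({\<omega> \<in> space M. \<epsilon> j \<omega> = 1} \<union> {\<omega> \<in> space M. \<epsilon> j \<omega> = - 1}) = 1"
    by (subst finite_measure_Union) (use p q \<open>p + q = 1\<close> in auto)
  then have "AE \<omega> in M. \<omega> \<in> {\<omega> \<in> space M. \<epsilon> j \<omega> = 1} \<union> {\<omega> \<in> space M. \<epsilon> j \<omega> = - 1}"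
    by (rule AE_prob_1)
  then have "AE \<omega> in M. exp (- (\<i> * of_real (y * (\<epsilon> j \<omega> * Q j \<omega>) ^ m))) = a 1 (\<epsilon> j \<omega>) * b y (Q j \<omega>) + a (-1) (\<epsilon> j \<omega>) * b (- y) (Q j \<omega>)"
    by eventually_elim (use \<open>odd m\<close> in \<open>auto simp: a_def b_def\<close>)
  then have "(\<integral>\<omega>. exp (- (\<i> * of_real (y * (\<epsilon> j \<omega> * Q j \<omega>) ^ m))) \<partial>M) = (\<integral>\<omega>. a 1 (\<epsilon> j \<omega>) * b y (Q j \<omega>) + a (-1) (\<epsilon> j \<omega>) * b (- y) (Q j \<omega>) \<partial>M)"
    by (intro integral_cong_AE) measurable
  also have "\<dots> = (\<integral>\<omega>. a 1 (\<epsilon> j \<omega>) * b y (Q j \<omega>) \<partial>M) + (\<integral>\<omega>. a (-1) (\<epsilon> j \<omega>) * b (- y) (Q j \<omega>) \<partial>M)"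
    by (intro Bochner_Integration.integral_add i)
  also have "\<dots> = of_real p * (\<integral>\<omega>. b y (Q j \<omega>) \<partial>M) + of_real q * (\<integral>\<omega>. b (- y) (Q j \<omega>) \<partial>M)"
    using indep[of 1 y] indep[of "- 1" "- y"] by (simp only: p q)
  finally show ?thesis by (simp only: b_def)
qed

text \<open>The odd power is an increasing bijection of the line, so tails of the power are tails of
  X at the root. The index \<beta> m drops to \<beta> and the threshold becomes \<gamma>^m.\<close>

lemma power_pareto_mean:
  fixes X :: "'a \<Rightarrow> real"
  assumes "prob_space M" and [measurable]: "X \<in> borel_measurable M" and \<gamma>: "0 < \<gamma>" and \<beta>: "0 < \<beta>" and m: "odd m"
    and tail: "\<And>w. \<gamma> < w \<Longrightarrow> measure M {\<omega> \<in> space M. w < X \<omega>} = (\<gamma> / w) powr (\<beta> * real m)"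
    and full: "\<And>w. w < \<gamma> \<Longrightarrow> measure M {\<omega> \<in> space M. w < X \<omega>} = 1"
  shows "(\<integral>\<omega>. exp (- (\<i> * of_real (y * X \<omega> ^ m))) \<partial>M) = 1 - of_real (\<gamma> powr (\<beta> * real m)) * truncated_exponent \<beta> (\<gamma> ^ m) y"
proof -
  have m0: "0 < m" using m by (rule odd_pos)
  have root: "w < x ^ m \<longleftrightarrow> root m w < x" for w x :: real
    using real_root_less_iff[OF m0, of w "x ^ m"] odd_real_root_power_cancel[OF m, of x] by simp
  have pr: "(\<gamma> ^ m) powr \<beta> = \<gamma> powr (\<beta> * real m)"
    using abs_power_powr[OF m0, of \<gamma> \<beta>] \<gamma> by simp
  have "(\<integral>\<omega>. exp (- (\<i> * of_real (y * X \<omega> ^ m))) \<partial>M) = 1 - of_real ((\<gamma> ^ m) powr \<beta>) * truncated_exponent \<beta> (\<gamma> ^ m) y"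
  proof (rule pareto_characteristic_function[OF assms(1)])
    fix w
    show "measure M {\<omega> \<in> space M. w < X \<omega> ^ m} = (\<gamma> ^ m / w) powr \<beta>" if "\<gamma> ^ m < w"
    proof -
      have w: "0 < w" using that \<gamma> by (meson less_trans zero_less_power)
      have "\<gamma> < root m w"
        using real_root_less_iff[OF m0, of "\<gamma> ^ m" w] that odd_real_root_power_cancel[OF m, of \<gamma>] by simp
      then have "measure M {\<omega> \<in> space M. root m w < X \<omega>} = (\<gamma> / root m w) powr (\<beta> * real m)" by (rule tail)
      also have "\<dots> = ((\<gamma> / root m w) ^ m) powr \<beta>"
        using abs_power_powr[OF m0, of "\<gamma> / root m w" \<beta>] \<gamma> w m0 by simp
      also have "(\<gamma> / root m w) ^ m = \<gamma> ^ m / w" using w m0 by (simp add: power_divide)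
      finally show ?thesis by (simp only: root)
    qed
    show "measure M {\<omega> \<in> space M. w < X \<omega> ^ m} = 1" if "w < \<gamma> ^ m"
    proof -
      have "root m w < \<gamma>"
        using real_root_less_iff[OF m0, of w "\<gamma> ^ m"] that odd_real_root_power_cancel[OF m, of \<gamma>] by simp
      then show ?thesis unfolding root by (rule full)
    qed
  qed (use \<gamma> \<beta> in auto)
  then show ?thesis by (simp only: pr)
qed

text \<open>The law is prescribed for increments; since N 0 = 0 almost surely, it passes to the
  process itself.\<close>

lemma poisson_process_distribution:
  assumes "prob_space M" "homogeneous_poisson_process M rate N" "0 < s"
  shows "measure M {\<omega> \<in> space M. N s \<omega> = m} = pmf (poisson_pmf (rate * s)) m"
proof -
  interpret prob_space M by fact
  have "N s \<in> measurable M (count_space UNIV)" "N 0 \<in> measurable M (count_space UNIV)"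
    using assms unfolding homogeneous_poisson_process_def by auto
  from this[THEN measurable_compose, of real borel]
  have [measurable]: "(\<lambda>\<omega>. real (N s \<omega>)) \<in> borel_measurable M" "(\<lambda>\<omega>. real (N 0 \<omega>)) \<in> borel_measurable M"
    by simp_all
  have "{\<omega> \<in> space M. real (N s \<omega>) = real m} \<in> events"
    "{\<omega> \<in> space M. real (N s \<omega>) = real (N 0 \<omega>) + real m} \<in> events" by measurable
  then have sets: "{\<omega> \<in> space M. N s \<omega> = m} \<in> events" "{\<omega> \<in> space M. N s \<omega> = N 0 \<omega> + m} \<in> events"
    by (simp_all flip: of_nat_add)
  have "AE \<omega> in M. N 0 \<omega> = 0"
    using assms(2) unfolding homogeneous_poisson_process_def by (auto elim: eventually_mono)
  then have "measure M {\<omega> \<in> space M. N s \<omega> = m} = measure M {\<omega> \<in> space M. N s \<omega> = N 0 \<omega> + m}"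
    by (intro measure_eq_AE sets) (auto elim: eventually_mono)
  also have "\<dots> = pmf (poisson_pmf (rate * (s - 0))) m"
    using assms(2,3) unfolding homogeneous_poisson_process_def by blast
  finally show ?thesis by simp
qed

theorem theorem3p1:
  fixes \<beta> p q t :: real and k :: nat
    and u h :: "real \<Rightarrow> real \<Rightarrow> real"
    and M :: "'a measure" and N :: "real \<Rightarrow> 'a \<Rightarrow> nat"
    and \<epsilon> :: "nat \<Rightarrow> 'a \<Rightarrow> real" and Q :: "real \<Rightarrow> nat \<Rightarrow> 'a \<Rightarrow> real"
    and M' :: "'b measure" and H1 H2 :: "real \<Rightarrow> 'b \<Rightarrow> real"
  assumes "0 < \<beta>" and "\<beta> < 1"
    and "p \<in> {0..1}" and "q \<in> {0..1}" and "p + q = 1" and "0 < t"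
    and "fundamental_solution k u"
    and "prob_space M"
    and "homogeneous_poisson_process M (1 / Gamma (1 - \<beta>)) N"
    and "\<And>j. measure M {\<omega> \<in> space M. \<epsilon> j \<omega> = 1} = p"
    and "\<And>j. measure M {\<omega> \<in> space M. \<epsilon> j \<omega> = - 1} = q"
    and "\<And>\<gamma> j w. 0 < \<gamma> \<Longrightarrow> \<gamma> < w \<Longrightarrow>
           measure M {\<omega> \<in> space M. w < Q \<gamma> j \<omega>} = (\<gamma> / w) powr (\<beta> * real (2 * k + 1))"
    and "\<And>\<gamma> j w. 0 < \<gamma> \<Longrightarrow> w < \<gamma> \<Longrightarrow> measure M {\<omega> \<in> space M. w < Q \<gamma> j \<omega>} = 1"
    and "\<And>\<gamma> s. 0 < \<gamma> \<Longrightarrow> 0 \<le> s \<Longrightarrow> indep_count_sign_size M (N s) \<epsilon> (Q \<gamma>)"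
    and "prob_space M'"
    and "stable_subordinator M' \<beta> H1" and "stable_subordinator M' \<beta> H2"
    and "indep_processes M' H1 H2"
    and "\<And>s r. 0 \<le> h s r"
    and "\<And>r. 0 < r \<Longrightarrow> distributed M' lborel (H1 r) (\<lambda>s. ennreal (h s r))"
    and "\<And>r. 0 < r \<Longrightarrow> distributed M' lborel (H2 r) (\<lambda>s. ennreal (h s r))"
  shows "(\<forall>\<xi>. ((\<lambda>\<gamma>. random_sum_fourier M (\<lambda>x. u x 1)
                        (N (t * \<gamma> powr (- (\<beta> * real (2 * k + 1)))))
                        (\<lambda>j \<omega>. \<epsilon> j \<omega> * Q \<gamma> j \<omega>) \<xi>)
                 \<longlongrightarrow> difference_fourier (subordinated_fourier u h (p * t))
                                            (subordinated_fourier u h (q * t)) \<xi>) (at_right 0))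
       \<and> (\<forall>\<xi>. difference_fourier (subordinated_fourier u h (p * t))
                                 (subordinated_fourier u h (q * t)) \<xi>
              = exp (- complex_of_real (t * \<bar>\<xi>\<bar> powr (\<beta> * real (2 * k + 1)))
                     * (complex_of_real (cos (\<beta> * pi / 2))
                        + \<i> * complex_of_real (sgn \<xi> * (p - q) * sin (\<beta> * pi / 2)))))"
proof -
  define n where "n = 2 * k + 1"
  have n: "0 < n" "odd n" by (simp_all add: n_def)
  note \<beta> = assms(1,2)
  define Z where "Z y = (\<i> * complex_of_real y) powr of_real \<beta>" for y
  have kernel: "odd_order_kernel n u"
    unfolding n_def by (rule fundamental_solution_kernel[OF assms(7)])
  \<comment> \<open>The time r = 0 occurs when p or q vanishes; the value 1 fixed by
    \<open>subordinated_fourier\<close> agrees with the formula.\<close>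
  have sub: "subordinated_fourier u h r \<xi> = exp (- (of_real r * Z (\<xi> ^ n)))" if "0 \<le> r" for r \<xi>
  proof (cases "r = 0")
    case False
    then have r: "0 < r" using that by simp
    have "fourier (\<lambda>x. LBINT s:{0..}. u x s * h s r) \<xi> = stable_transform n \<beta> r \<xi>"
      by (rule fourier_subordinated[OF kernel
            stable_subordinator_density[OF \<beta> assms(15,16) assms(19) assms(20)[OF r] r]])
    then show ?thesis
      using False unfolding subordinated_fourier_def subordinated_law_def[abs_def] stable_transform_def Z_def by simp
  qed (simp add: subordinated_fourier_def)
  \<comment> \<open>The subtracted component is evaluated at -\<xi>, and for odd n the minus sign
    leaves the power.\<close>
  define \<Lambda> where "\<Lambda> \<xi> = of_real p * Z (\<xi> ^ n) + of_real q * Z (- (\<xi> ^ n))" for \<xi> :: real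
  have diff: "difference_fourier (subordinated_fourier u h (p * t)) (subordinated_fourier u h (q * t)) \<xi> = exp (- (of_real t * \<Lambda> \<xi>))" for \<xi>
  proof -
    have "difference_fourier (subordinated_fourier u h (p * t)) (subordinated_fourier u h (q * t)) \<xi>
      = exp (- (of_real (p * t) * Z (\<xi> ^ n))) * exp (- (of_real (q * t) * Z ((- \<xi>) ^ n)))"
      unfolding difference_fourier_def using assms(3-6) by (simp add: sub del: of_real_mult)
    also have "\<dots> = exp (- (of_real t * \<Lambda> \<xi>))"
      using n(2) by (simp add: \<Lambda>_def algebra_simps flip: exp_add)
    finally show ?thesis .
  qed
  \<comment> \<open>The cosine is unaffected by the sign and gets weight p + q = 1; the sine changes
    sign and gets weight p - q.\<close>
  have closed: "of_real t * \<Lambda> \<xi> = of_real (t * \<bar>\<xi>\<bar> powr (\<beta> * real n)) * (of_real (cos (\<beta> * pi / 2)) + \<i> * of_real (sgn \<xi> * (p - q) * sin (\<beta> * pi / 2)))" for \<xi>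
  proof -
    have sg: "sgn (\<xi> ^ n) = sgn \<xi>" using n by (auto simp: sgn_if zero_less_power_eq power_less_zero_eq zero_power)
    have pq: "p = 1 - q" using assms(5) by simp
    show ?thesis
      unfolding \<Lambda>_def Z_def imaginary_powr[OF \<beta>(1)] abs_minus_cancel abs_power_powr[OF n(1)] sgn_minus sg
      by (simp add: pq algebra_simps)
  qed
  have lim: "((\<lambda>\<gamma>. random_sum_fourier M (\<lambda>x. u x 1) (N (t * \<gamma> powr (- (\<beta> * real n)))) (\<lambda>j \<omega>. \<epsilon> j \<omega> * Q \<gamma> j \<omega>) \<xi>)
      \<longlongrightarrow> exp (- (of_real t * \<Lambda> \<xi>))) (at_right 0)" for \<xi>
  proof -
    define y where "y = \<xi> ^ n"
    define \<Gamma> where "\<Gamma> = Gamma (1 - \<beta>)"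
    have \<Gamma>: "0 < \<Gamma>" using \<beta> by (simp add: \<Gamma>_def Gamma_real_pos)
    \<comment> \<open>The part of the exponent due to jumps beyond \<gamma>^n, averaged over the two
      signs.\<close>
    define T where "T \<gamma> = of_real p * truncated_exponent \<beta> (\<gamma> ^ n) y + of_real q * truncated_exponent \<beta> (\<gamma> ^ n) (- y)" for \<gamma>
    define \<phi> where "\<phi> \<gamma> = 1 - of_real (\<gamma> powr (\<beta> * real n)) * T \<gamma>" for \<gamma>
    have four: "fourier (\<lambda>x. u x 1) (\<xi> * a) = exp (- (\<i> * of_real (y * a ^ n)))" for a
      unfolding fourier_def using integral_unique[OF odd_order_kernel.transform[OF kernel, of 1 "\<xi> * a"]]
      by (simp add: y_def power_mult_distrib)
    have eq: "random_sum_fourier M (\<lambda>x. u x 1) (N (t * \<gamma> powr (- (\<beta> * real n)))) (\<lambda>j \<omega>. \<epsilon> j \<omega> * Q \<gamma> j \<omega>) \<xi>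
        = \<phi> \<gamma> * exp (- (of_real (t / \<Gamma>) * T \<gamma>))" if \<gamma>: "0 < \<gamma>" for \<gamma>
    proof -
      define s where "s = t * \<gamma> powr (- (\<beta> * real n))"
      have s: "0 < s" using assms(6) \<gamma> by (simp add: s_def)
      have ind: "indep_count_sign_size M (N s) \<epsilon> (Q \<gamma>)" using assms(14) \<gamma> s by simp
      let ?X = "\<lambda>i. case i of Count \<Rightarrow> (\<lambda>\<omega>. real (N s \<omega>)) | Sign j \<Rightarrow> \<epsilon> j | Size j \<Rightarrow> Q \<gamma> j"
      have Xm: "?X i \<in> borel_measurable M" for i
        using ind by (simp add: indep_count_sign_size_def prob_space.indep_vars_def[OF assms(8)])
      have Qm: "Q \<gamma> j \<in> borel_measurable M" for j using Xm[of "Size j"] by simp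
      have pareto: "(\<integral>\<omega>. exp (- (\<i> * of_real (z * Q \<gamma> j \<omega> ^ n))) \<partial>M) = 1 - of_real (\<gamma> powr (\<beta> * real n)) * truncated_exponent \<beta> (\<gamma> ^ n) z" for z j
        using assms(12)[OF \<gamma>] assms(13)[OF \<gamma>] unfolding n_def[symmetric]
        by (intro power_pareto_mean[OF assms(8) Qm \<gamma> \<beta>(1) n(2)])
      have mean: "(\<integral>\<omega>. exp (- (\<i> * of_real (y * (\<epsilon> j \<omega> * Q \<gamma> j \<omega>) ^ n))) \<partial>M) = \<phi> \<gamma>" for j
      proof -
        have "(\<integral>\<omega>. exp (- (\<i> * of_real (y * (\<epsilon> j \<omega> * Q \<gamma> j \<omega>) ^ n))) \<partial>M)
          = of_real p * (1 - of_real (\<gamma> powr (\<beta> * real n)) * truncated_exponent \<beta> (\<gamma> ^ n) y)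
            + of_real q * (1 - of_real (\<gamma> powr (\<beta> * real n)) * truncated_exponent \<beta> (\<gamma> ^ n) (- y))"
          unfolding signed_power_mean[OF assms(8) ind assms(10,11,5) n(2)] pareto ..
        also have "\<dots> = of_real (p + q) - of_real (\<gamma> powr (\<beta> * real n)) * T \<gamma>"
          by (simp add: T_def algebra_simps)
        finally show ?thesis using assms(5) by (simp add: \<phi>_def)
      qed
      have rs: "1 / \<Gamma> * s = t / \<Gamma> * \<gamma> powr (- (\<beta> * real n))" by (simp add: s_def)
      have "random_sum_fourier M (\<lambda>x. u x 1) (N s) (\<lambda>j \<omega>. \<epsilon> j \<omega> * Q \<gamma> j \<omega>) \<xi>
        = (\<integral>\<omega>. (\<Prod>j\<le>N s \<omega>. exp (- (\<i> * of_real (y * (\<epsilon> j \<omega> * Q \<gamma> j \<omega>) ^ n)))) \<partial>M)"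
        unfolding random_sum_fourier_def four ..
      also have "\<dots> = \<phi> \<gamma> * exp (of_real (1 / \<Gamma> * s) * (\<phi> \<gamma> - 1))"
      proof (rule poisson_random_product[OF assms(8) ind, where f = "\<lambda>a b. exp (- (\<i> * of_real (y * (a * b) ^ n)))"])
        show "measure M {\<omega> \<in> space M. N s \<omega> = m} = pmf (poisson_pmf (1 / \<Gamma> * s)) m" for m
          unfolding \<Gamma>_def by (rule poisson_process_distribution[OF assms(8,9) s])
      qed (use mean s \<Gamma> in auto)
      \<comment> \<open>The Poisson time is the reciprocal power of the factor in 1 - \<phi>, so the
        exponent depends on \<gamma> through \<open>T\<close> alone.\<close>
      also have "of_real (1 / \<Gamma> * s) * (\<phi> \<gamma> - 1) = - (of_real (t / \<Gamma>) * T \<gamma>)"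
      proof -
        have "\<gamma> powr (- (\<beta> * real n)) * \<gamma> powr (\<beta> * real n) = 1" using \<gamma> by (simp flip: powr_add)
        then have "complex_of_real (\<gamma> powr (- (\<beta> * real n))) * of_real (\<gamma> powr (\<beta> * real n)) = 1"
          by (simp flip: of_real_mult)
        then show ?thesis unfolding rs \<phi>_def by (simp add: mult.assoc)
      qed
      finally show ?thesis by (simp only: s_def)
    qed
    have pow: "filterlim (\<lambda>\<gamma>::real. \<gamma> ^ n) (at_right 0) (at_right 0)"
      unfolding filterlim_at
    proof
      show "\<forall>\<^sub>F \<gamma> in at_right 0. \<gamma> ^ n \<in> {0<..} \<and> \<gamma> ^ n \<noteq> (0::real)"
        unfolding eventually_at_right_field by (intro exI[of _ 1]) auto
      have "((\<lambda>\<gamma>::real. \<gamma> ^ n) \<longlongrightarrow> 0 ^ n) (at_right 0)" by (intro tendsto_intros)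
      then show "((\<lambda>\<gamma>::real. \<gamma> ^ n) \<longlongrightarrow> 0) (at_right 0)" using n(1) by (simp add: zero_power)
    qed
    have T: "(T \<longlongrightarrow> of_real \<Gamma> * \<Lambda> \<xi>) (at_right 0)"
    proof -
      have "(T \<longlongrightarrow> of_real p * (of_real \<Gamma> * Z y) + of_real q * (of_real \<Gamma> * Z (- y))) (at_right 0)"
        unfolding T_def[abs_def] \<Gamma>_def Z_def
        by (intro tendsto_intros filterlim_compose[OF truncated_exponent_tendsto[OF \<beta>] pow])
      then show ?thesis by (simp add: \<Lambda>_def y_def algebra_simps)
    qed
    have "((\<lambda>\<gamma>. \<gamma> powr (\<beta> * real n)) \<longlongrightarrow> 0) (at_right 0)"
    proof -
      define b where "b = \<beta> * real n"
      have "0 < b" using \<beta> n by (simp add: b_def)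
      then show ?thesis unfolding b_def[symmetric] by real_asymp
    qed
    \<comment> \<open>This is the factor of the surplus term j = 0..N; convergence of
      \<open>T\<close> makes it tend to 1.\<close>
    then have "(\<phi> \<longlongrightarrow> 1 - of_real 0 * (of_real \<Gamma> * \<Lambda> \<xi>)) (at_right 0)"
      unfolding \<phi>_def[abs_def] by (intro tendsto_intros T)
    then have "((\<lambda>\<gamma>. \<phi> \<gamma> * exp (- (of_real (t / \<Gamma>) * T \<gamma>))) \<longlongrightarrow> 1 * exp (- (of_real (t / \<Gamma>) * (of_real \<Gamma> * \<Lambda> \<xi>)))) (at_right 0)"
      by (intro tendsto_intros T) simp
    also have "1 * exp (- (of_real (t / \<Gamma>) * (of_real \<Gamma> * \<Lambda> \<xi>))) = exp (- (of_real t * \<Lambda> \<xi>))"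
      using \<Gamma> by simp
    finally show ?thesis
      by (rule Lim_transform_eventually) (auto simp: eventually_at_right_field eq intro!: exI[of _ 1])
  qed
  show ?thesis
    unfolding n_def[symmetric] using lim by (simp only: diff closed minus_mult_left simp_thms)
qed

end
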